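(* Let $\alpha\ge0$ be real and $u_\alpha(n)=\frac{r_\alpha(n-1)r_\alpha(n+1)}{r_\alpha(n)^2}$. For all integers $n\ge\widetilde N(\alpha)$, $$L(n,\alpha)<u_\alpha(n)<U(n,\alpha)\quad\text{and}\quad L_1(n,\alpha)<u_\alpha(n+1)<U_1(n,\alpha),$$ where $$U(n,\alpha)=1+\frac{3\pi}{4n^{5/2}}+\frac{3+3\alpha-2\log8-2(1+\alpha)\log n}{n^3}-\frac{15}{4\pi n^{7/2}}-\frac{3}{\pi^2n^4}+\frac{35(-16+3\pi^4)}{192\pi^3n^{9/2}}+\frac{6\alpha+2^{12}+2^{31+18\alpha}+(2+17\alpha)\log n}{n^5},$$ $$L(n,\alpha)=1+\frac{3\pi}{4n^{5/2}}+\frac{3+3\alpha-2\log8-2(1+\alpha)\log n}{n^3}-\frac{15}{4\pi n^{7/2}}-\frac{3}{\pi^2n^4}+\frac{35(-16+3\pi^4)}{192\pi^3n^{9/2}}-\frac{258+(80+2^{16+7\alpha})\log n}{n^5},$$ $$U_1(n,\alpha)=1+\frac{3\pi}{4n^{5/2}}+\frac{3+3\alpha-2\log8-2(1+\alpha)\log n}{n^3}-\frac{15(2+\pi^2)}{8\pi n^{7/2}}+\frac{-3-11\pi^2-11\alpha\pi^2+6\pi^2\log8+(6+6\alpha)\pi^2\log n}{\pi^2n^4}+\frac{35(21\pi^4+72\pi^2-16)}{192\pi^3n^{9/2}}+\frac{12+(2^{12}+26)\pi^2-12\pi^2\log8+32\alpha\pi^2+\pi^22^{31+18\alpha}+(2+17\alpha)\pi^2\log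 n}{n^5},$$ $$L_1(n,\alpha)=1+\frac{3\pi}{4n^{5/2}}+\frac{3+3\alpha-2\log8-2(1+\alpha)\log n}{n^3}-\frac{15(2+\pi^2)}{8\pi n^{7/2}}+\frac{-3-11\pi^2-11\alpha\pi^2+6\pi^2\log8+(6+6\alpha)\pi^2\log n}{\pi^2n^4}+\frac{35(21\pi^4+72\pi^2-16)}{192\pi^3n^{9/2}}-\frac{1}{n^5}\Bigl(256+\frac{105(9\pi^2(4+\pi^2)-16)}{128\pi^3}+8(3\alpha+2^{7\alpha+13}+13)\log n\Bigr).$$
   Context: $\overline{p}(n)$ is the number of overpartitions of $n$ (partitions of $n$ into non-increasing parts in which the first occurrence of each part size may be overlined); $r_\alpha(n)=\sqrt[n]{\overline{p}(n)/n^\alpha}$. $\widetilde N_1(\alpha)=\max\{\lceil\sqrt{2\alpha}\rceil,\lceil\sqrt[3]{3\alpha}\rceil,\lceil\sqrt[4]{11\alpha/3}\rceil,\lceil\sqrt[5]{10\alpha}\rceil\}$, $\widetilde N_2(\alpha)=\max\{2,\lceil\sqrt{2\alpha}\rceil,\lceil\sqrt[3]{3\alpha}\rceil,\lceil\sqrt[4]{11\alpha/3}\rceil,\lceil\sqrt[5]{12\alpha}\rceil\}$, $\widetilde N_3(\alpha)=\max\{5505,\lceil(4\alpha/(\alpha^2+1))^{4/3}\rceil,\lceil(4\alpha)^{4/11}\rceil\}$, and $\widetilde N(\alpha)=\max_{1\le i\le3}\widetilde N_i(\alpha)$. *)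

theory Defs
  imports "HOL-Analysis.Analysis"
begin

text \<open>
  An overpartition is a non-increasing list of positive parts, each carrying a flag that tells
  whether it is overlined; only the first occurrence of a part size may carry the flag.
\<close>

definition overpartition :: "nat \<Rightarrow> (nat \<times> bool) list \<Rightarrow> bool" where
  "overpartition n xs \<longleftrightarrow>
     sorted_wrt (\<ge>) (map fst xs) \<and>
     (\<forall>x\<in>set xs. fst x > 0) \<and>
     sum_list (map fst xs) = n \<and>
     (\<forall>i<length xs. snd (xs ! i) \<longrightarrow> (\<forall>j<i. fst (xs ! j) \<noteq> fst (xs ! i)))"

definition pbar :: "nat \<Rightarrow> nat" where
  "pbar n = card {xs. overpartition n xs}"

lemma finite_overpartition: "finite {xs. overpartition n xs}"
proof (rule finite_subset)
  show "{xs. overpartition n xs} \<subseteq> {xs. set xs \<subseteq> {..n} \<times> UNIV \<and> length xs \<le> n}"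
  proof (rule subsetI, rule CollectI, rule conjI)
    fix xs assume "xs \<in> {xs. overpartition n xs}"
    then have pos: "\<forall>x\<in>set xs. fst x > 0" and sum: "sum_list (map fst xs) = n"
      by (auto simp: overpartition_def)
    show "set xs \<subseteq> {..n} \<times> UNIV"
    proof
      fix x assume "x \<in> set xs"
      then have "fst x \<le> sum_list (map fst xs)"
        by (intro member_le_sum_list) auto
      then show "x \<in> {..n} \<times> UNIV"
        using sum by (cases x) auto
    qed
    have "(\<forall>y\<in>set ys. fst y > 0) \<Longrightarrow> length ys \<le> sum_list (map fst ys)"
      for ys :: "(nat \<times> bool) list"
      by (induction ys) auto
    then show "length xs \<le> n"
      using pos sum by blast
  qed
  show "finite {xs :: (nat \<times> bool) list. set xs \<subseteq> {..n} \<times> UNIV \<and> length xs \<le> n}"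
    by (rule finite_lists_length_le) simp
qed

definition r :: "real \<Rightarrow> nat \<Rightarrow> real" where
  "r \<alpha> n = root n (real (pbar n) / real n powr \<alpha>)"

definition u :: "real \<Rightarrow> nat \<Rightarrow> real" where
  "u \<alpha> n = r \<alpha> (n - 1) * r \<alpha> (n + 1) / (r \<alpha> n)\<^sup>2"

definition N1 :: "real \<Rightarrow> int" where
  "N1 \<alpha> = Max {\<lceil>sqrt (2 * \<alpha>)\<rceil>, \<lceil>root 3 (3 * \<alpha>)\<rceil>, \<lceil>root 4 (11 * \<alpha> / 3)\<rceil>, \<lceil>root 5 (10 * \<alpha>)\<rceil>}"

definition N2 :: "real \<Rightarrow> int" where
  "N2 \<alpha> = Max {2, \<lceil>sqrt (2 * \<alpha>)\<rceil>, \<lceil>root 3 (3 * \<alpha>)\<rceil>, \<lceil>root 4 (11 * \<alpha> / 3)\<rceil>, \<lceil>root 5 (12 * \<alpha>)\<rceil>}"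

definition N3 :: "real \<Rightarrow> int" where
  "N3 \<alpha> = Max {5505, \<lceil>(4 * \<alpha> / (\<alpha>\<^sup>2 + 1)) powr (4 / 3)\<rceil>, \<lceil>(4 * \<alpha>) powr (4 / 11)\<rceil>}"

definition N :: "real \<Rightarrow> int" where
  "N \<alpha> = Max {N1 \<alpha>, N2 \<alpha>, N3 \<alpha>}"

definition U :: "nat \<Rightarrow> real \<Rightarrow> real" where
  "U n \<alpha> =
     1 + 3 * pi / (4 * real n powr (5 / 2))
     + (3 + 3 * \<alpha> - 2 * ln 8 - 2 * (1 + \<alpha>) * ln (real n)) / real n ^ 3
     - 15 / (4 * pi * real n powr (7 / 2))
     - 3 / (pi\<^sup>2 * real n ^ 4)
     + 35 * (- 16 + 3 * pi ^ 4) / (192 * pi ^ 3 * real n powr (9 / 2))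
     + (6 * \<alpha> + 2 ^ 12 + 2 powr (31 + 18 * \<alpha>) + (2 + 17 * \<alpha>) * ln (real n)) / real n ^ 5"

definition L :: "nat \<Rightarrow> real \<Rightarrow> real" where
  "L n \<alpha> =
     1 + 3 * pi / (4 * real n powr (5 / 2))
     + (3 + 3 * \<alpha> - 2 * ln 8 - 2 * (1 + \<alpha>) * ln (real n)) / real n ^ 3
     - 15 / (4 * pi * real n powr (7 / 2))
     - 3 / (pi\<^sup>2 * real n ^ 4)
     + 35 * (- 16 + 3 * pi ^ 4) / (192 * pi ^ 3 * real n powr (9 / 2))
     - (258 + (80 + 2 powr (16 + 7 * \<alpha>)) * ln (real n)) / real n ^ 5"

definition U1 :: "nat \<Rightarrow> real \<Rightarrow> real" where
  "U1 n \<alpha> =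
     1 + 3 * pi / (4 * real n powr (5 / 2))
     + (3 + 3 * \<alpha> - 2 * ln 8 - 2 * (1 + \<alpha>) * ln (real n)) / real n ^ 3
     - 15 * (2 + pi\<^sup>2) / (8 * pi * real n powr (7 / 2))
     + (- 3 - 11 * pi\<^sup>2 - 11 * \<alpha> * pi\<^sup>2 + 6 * pi\<^sup>2 * ln 8 + (6 + 6 * \<alpha>) * pi\<^sup>2 * ln (real n))
         / (pi\<^sup>2 * real n ^ 4)
     + 35 * (21 * pi ^ 4 + 72 * pi\<^sup>2 - 16) / (192 * pi ^ 3 * real n powr (9 / 2))
     + (12 + (2 ^ 12 + 26) * pi\<^sup>2 - 12 * pi\<^sup>2 * ln 8 + 32 * \<alpha> * pi\<^sup>2
          + pi\<^sup>2 * 2 powr (31 + 18 * \<alpha>) + (2 + 17 * \<alpha>) * pi\<^sup>2 * ln (real n)) / real n ^ 5"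

definition L1 :: "nat \<Rightarrow> real \<Rightarrow> real" where
  "L1 n \<alpha> =
     1 + 3 * pi / (4 * real n powr (5 / 2))
     + (3 + 3 * \<alpha> - 2 * ln 8 - 2 * (1 + \<alpha>) * ln (real n)) / real n ^ 3
     - 15 * (2 + pi\<^sup>2) / (8 * pi * real n powr (7 / 2))
     + (- 3 - 11 * pi\<^sup>2 - 11 * \<alpha> * pi\<^sup>2 + 6 * pi\<^sup>2 * ln 8 + (6 + 6 * \<alpha>) * pi\<^sup>2 * ln (real n))
         / (pi\<^sup>2 * real n ^ 4)
     + 35 * (21 * pi ^ 4 + 72 * pi\<^sup>2 - 16) / (192 * pi ^ 3 * real n powr (9 / 2))
     - 1 / real n ^ 5
         * (256 + 105 * (9 * pi\<^sup>2 * (4 + pi\<^sup>2) - 16) / (128 * pi ^ 3)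
            + 8 * (3 * \<alpha> + 2 powr (7 * \<alpha> + 13) + 13) * ln (real n))"

end

theory Submission
  imports Defs "HOL-Complex_Analysis.Complex_Analysis" "HOL-Probability.Characteristic_Functions"
begin

text \<open>
  The generating function \<open>P\<close> of the overpartitions is the reciprocal of the theta series
  \<open>1 + 2 \<Sum> (-1)\<^sup>s q\<^bsup>s\<^sup>2\<^esup>\<close> (Gauss). The transformation of that series shows that near \<open>q = 1\<close>, with
  \<open>q = exp (-t)\<close>, \<open>P\<close> equals \<open>(t/\<pi>)\<^bsup>1/2\<^esup> exp (\<pi>\<^sup>2/(4t)) / 2\<close> up to an exponentially small relative error,
  while the product for \<open>P\<close> makes it small away from \<open>q = 1\<close>. In Cauchy's integral for the coefficient
  the chord \<open>|Im t| \<le> \<surd>3 Re t\<close> is deformed to the arc \<open>|t| = x = \<pi>/(2\<surd>n)\<close>, on which the integrand is an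
  elementary Gaussian. Hence, for \<open>n \<ge> 5476\<close>, the ratio of the coefficient to \<open>exp \<mu> / (8n)\<close> with
  \<open>\<mu> = \<pi>\<surd>n\<close> is \<open>1 - 1/\<mu>\<close> up to \<open>20000/n\<^sup>4\<close>. Taking logarithms, \<open>ln u\<^sub>\<alpha>(n)\<close> becomes a second difference of
  powers \<open>n\<^bsup>-s\<^esup>\<close> and of \<open>ln n / n\<close>, which Taylor expansion evaluates up to \<open>O(n\<^sup>-\<^sup>5)\<close>; finally
  \<open>1 + x \<le> exp x \<le> 1 + x + x\<^sup>2\<close> for \<open>|x| \<le> 1\<close>.
\<close>

section \<open>Overpartitions and their generating function\<close>

text \<open>The line of integration is Re t = x/2, half the saddle point x: it cuts the circle |t| =
  x at the angles -pi/3 and pi/3, so chord and arc share their endpoints and the deformation leaves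
  no connecting pieces. The price is a pointwise size of about exp (5\<mu>/4) on this line, above
  the main term exp \<mu>; both error terms have to win back the surplus \<mu>/4. On the chord this
  is easy: the dual series begins with 1 + Q^2, and |Q| \<le> exp (-\<mu>) there, so the relative
  error is of order exp (-2\<mu>). Off the chord the product saves the factor exp (-0.98 (1/a - 1))
  with a = x/2. Since 1/a = 4 sqrt n / pi, the net exponent is about (pi/4 - 3.92/pi) sqrt n < -0.46
  sqrt n, and from sqrt n = 74 on, that is n = 5476, such a term is small enough for an error
  20000/n^4. In ln u this error is divided by n and taken with the weights 1, 2, 1. Together with
  the Taylor remainders it stays below 82500/n^5 apart from multiples of 1 + \<alpha>; the 2^16 ln n
  in L and the 2^31 in U absorb it.\<close>

lemma overpartition_Nil [simp]: "overpartition n [] \<longleftrightarrow> n = 0"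
  by (auto simp: overpartition_def)

text \<open>In the positional flag condition index 0 is vacuous, and for a later index the
  comparison with index 0 is the only new constraint. The counting recursion works with this
  recursive form.\<close>

lemma overpartition_Cons:
  "overpartition n (x # xs) \<longleftrightarrow>
     fst x > 0 \<and> fst x \<le> n \<and> overpartition (n - fst x) xs \<and>
     (\<forall>y\<in>set xs. fst y \<le> fst x \<and> (snd y \<longrightarrow> fst y \<noteq> fst x))"
proof -
  have flags: "(\<forall>i<length (x # xs). snd ((x # xs) ! i) \<longrightarrow>
                  (\<forall>j<i. fst ((x # xs) ! j) \<noteq> fst ((x # xs) ! i))) \<longleftrightarrow>
      (\<forall>i<length xs. snd (xs ! i) \<longrightarrow> (\<forall>j<i. fst (xs ! j) \<noteq> fst (xs ! i))) \<and>
      (\<forall>y\<in>set xs. snd y \<longrightarrow> fst y \<noteq> fst x)"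
    
    unfolding length_Cons All_less_Suc2 all_set_conv_all_nth
    by (auto simp: All_less_Suc2)
  show ?thesis
    unfolding overpartition_def flags by auto
qed

section \<open>Counting by the largest part\<close>

definition bounded_overpartitions :: "nat \<Rightarrow> nat \<Rightarrow> (nat \<times> bool) list set" where
  "bounded_overpartitions m n = {xs. overpartition n xs \<and> (\<forall>x\<in>set xs. fst x \<le> m)}"

definition headed_overpartitions :: "nat \<Rightarrow> nat \<Rightarrow> (nat \<times> bool) list set" where
  "headed_overpartitions m n = {xs. overpartition n xs \<and> xs \<noteq> [] \<and> fst (hd xs) = m}"

definition pbarb :: "nat \<Rightarrow> nat \<Rightarrow> nat" where
  "pbarb m n = card (bounded_overpartitions m n)"

lemma finite_bounded_overpartitions [simp]: "finite (bounded_overpartitions m n)"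
  by (rule finite_subset[OF _ finite_overpartition[of n]]) (auto simp: bounded_overpartitions_def)

lemma finite_headed_overpartitions [simp]: "finite (headed_overpartitions m n)"
  by (rule finite_subset[OF _ finite_overpartition[of n]]) (auto simp: headed_overpartitions_def)

lemma overpartition_part_le: "overpartition n xs \<Longrightarrow> x \<in> set xs \<Longrightarrow> fst x \<le> n"
  unfolding overpartition_def using member_le_sum_list[of "fst x" "map fst xs"] by auto

lemma pbarb_eq_pbar: "n \<le> m \<Longrightarrow> pbarb m n = pbar n"
  unfolding pbarb_def pbar_def bounded_overpartitions_def
  by (rule arg_cong[of _ _ card]) (auto dest: overpartition_part_le)

lemma pbarb_le_pbar: "pbarb m n \<le> pbar n"
  unfolding pbarb_def pbar_def bounded_overpartitions_def
  by (rule card_mono[OF finite_overpartition]) auto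

lemma pbarb_0: "pbarb 0 n = (if n = 0 then 1 else 0)"
proof -
  have "bounded_overpartitions 0 n = (if n = 0 then {[]} else {})"
  proof -
    have "xs \<in> bounded_overpartitions 0 n \<longleftrightarrow> xs = [] \<and> n = 0" for xs
      by (cases xs) (auto simp: bounded_overpartitions_def overpartition_Cons)
    thus ?thesis by auto
  qed
  thus ?thesis by (simp add: pbarb_def)
qed

lemma bounded_overpartitions_split:
  assumes "m > 0"
  shows "bounded_overpartitions m n = bounded_overpartitions (m - 1) n \<union> headed_overpartitions m n"
    and "bounded_overpartitions (m - 1) n \<inter> headed_overpartitions m n = {}"
proof -
  have "xs \<in> bounded_overpartitions m n \<longleftrightarrow>
      xs \<in> bounded_overpartitions (m - 1) n \<or> xs \<in> headed_overpartitions m n" for xs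
    using assms
    by (cases xs) (fastforce simp: bounded_overpartitions_def headed_overpartitions_def overpartition_Cons)+
  thus "bounded_overpartitions m n = bounded_overpartitions (m - 1) n \<union> headed_overpartitions m n"
    by blast
  have "xs \<notin> headed_overpartitions m n" if "xs \<in> bounded_overpartitions (m - 1) n" for xs
    using that assms
    by (cases xs) (auto simp: bounded_overpartitions_def headed_overpartitions_def)
  thus "bounded_overpartitions (m - 1) n \<inter> headed_overpartitions m n = {}" by blast
qed

lemma card_headed_add:
  "m > 0 \<Longrightarrow> pbarb m n = pbarb (m - 1) n + card (headed_overpartitions m n)"
  unfolding pbarb_def
  using bounded_overpartitions_split[of m n] by (simp add: card_Un_disjoint)

lemma headed_overpartitions_empty: "n < m \<Longrightarrow> headed_overpartitions m n = {}"
  by (auto simp: headed_overpartitions_def neq_Nil_conv overpartition_Cons)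

text \<open>A list headed by \<open>m\<close> either contains \<open>m\<close> once, or it arises from a list headed by \<open>m\<close>
  by inserting a second, non-overlined \<open>m\<close>.\<close>

lemma card_headed_overpartitions:
  assumes m: "m > 0" "m \<le> n"
  shows "card (headed_overpartitions m n) =
           2 * pbarb (m - 1) (n - m) + card (headed_overpartitions m (n - m))"
proof -
  \<comment> \<open>\<open>?f\<close> offers both flags to a single \<open>m\<close>, whence the
    factor 2. \<open>?g\<close> inserts behind the head, so a flag on the first occurrence stays in
    place.\<close>
  let ?f = "\<lambda>(b, xs). (m, b) # xs" and ?g = "\<lambda>xs. hd xs # (m, False) # tl xs"
  let ?A = "?f ` (UNIV \<times> bounded_overpartitions (m - 1) (n - m))"
  let ?B = "?g ` headed_overpartitions m (n - m)"
  have sub: "headed_overpartitions m n \<subseteq> ?A \<union> ?B"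
  proof
    fix xs assume xs: "xs \<in> headed_overpartitions m n"
    then obtain b ys where ys: "xs = (m, b) # ys"
      by (auto simp: headed_overpartitions_def neq_Nil_conv)
    have ov: "overpartition (n - m) ys" "\<forall>y\<in>set ys. fst y \<le> m \<and> (snd y \<longrightarrow> fst y \<noteq> m)"
      using xs by (auto simp: headed_overpartitions_def ys overpartition_Cons)
    hence "ys \<in> bounded_overpartitions m (n - m)"
      by (auto simp: bounded_overpartitions_def)
    hence "ys \<in> bounded_overpartitions (m - 1) (n - m) \<or> ys \<in> headed_overpartitions m (n - m)"
      using bounded_overpartitions_split(1)[OF m(1)] by auto
    thus "xs \<in> ?A \<union> ?B"
    proof
      assume "ys \<in> bounded_overpartitions (m - 1) (n - m)"
      thus ?thesis by (auto simp: ys image_iff)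
    next
      assume "ys \<in> headed_overpartitions m (n - m)"
      then obtain c zs where zs: "ys = (m, c) # zs"
        by (auto simp: headed_overpartitions_def neq_Nil_conv)
      have "xs = ?g ((m, b) # zs)" using ov(2) by (auto simp: ys zs)
      moreover have "(m, b) # zs \<in> headed_overpartitions m (n - m)"
        using ov by (auto simp: headed_overpartitions_def zs overpartition_Cons)
      ultimately show ?thesis by blast
    qed
  qed
  have A: "?A \<subseteq> headed_overpartitions m n"
    using m by (fastforce simp: bounded_overpartitions_def headed_overpartitions_def overpartition_Cons)
  have B: "?B \<subseteq> headed_overpartitions m n"
  proof (rule image_subsetI)
    fix xs assume xs: "xs \<in> headed_overpartitions m (n - m)"
    then obtain b ys where ys: "xs = (m, b) # ys"
      by (auto simp: headed_overpartitions_def neq_Nil_conv)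
    show "?g xs \<in> headed_overpartitions m n"
      using xs m by (auto simp: headed_overpartitions_def ys overpartition_Cons)
  qed
  have disj: "?A \<inter> ?B = {}"
    using m by (fastforce simp: bounded_overpartitions_def)
  have injg: "inj_on ?g (headed_overpartitions m (n - m))"
    by (rule inj_onI) (auto simp: headed_overpartitions_def neq_Nil_conv)
  have injf: "inj_on ?f (UNIV \<times> bounded_overpartitions (m - 1) (n - m))"
    by (rule inj_onI) auto
  have "headed_overpartitions m n = ?A \<union> ?B" using sub A B by blast
  also have "card \<dots> = card ?A + card ?B"
    using disj by (intro card_Un_disjoint) auto
  also have "card ?A = 2 * pbarb (m - 1) (n - m)"
    unfolding card_image[OF injf] pbarb_def by (simp add: card_cartesian_product)
  also have "card ?B = card (headed_overpartitions m (n - m))"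
    by (rule card_image[OF injg])
  finally show ?thesis .
qed

text \<open>The coefficient form of (1 - q^m) F_m = (1 + q^m) F_(m-1) for the generating functions
  F_m of \<open>pbarb m\<close>.\<close>

lemma pbarb_rec:
  assumes "m > 0" "m \<le> n"
  shows "pbarb m n = pbarb (m - 1) n + pbarb (m - 1) (n - m) + pbarb m (n - m)"
  using card_headed_add[OF assms(1), of n] card_headed_add[OF assms(1), of "n - m"]
    card_headed_overpartitions[OF assms] by simp

lemma pbarb_less: "m > 0 \<Longrightarrow> n < m \<Longrightarrow> pbarb m n = pbarb (m - 1) n"
  using card_headed_add[of m n] by (simp add: headed_overpartitions_empty)

section \<open>Generating functions of bounded and of all overpartitions\<close>

lemma pbarb_Suc_term:
  fixes q :: "'a::comm_semiring_1"
  shows "of_nat (pbarb (Suc m) n) * q ^ n = of_nat (pbarb m n) * q ^ n +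
    (if n \<ge> Suc m then q ^ Suc m * (of_nat (pbarb m (n - Suc m)) * q ^ (n - Suc m)
                     + of_nat (pbarb (Suc m) (n - Suc m)) * q ^ (n - Suc m)) else 0)"
proof (cases "n \<ge> Suc m")
  case True
  hence "q ^ n = q ^ Suc m * q ^ (n - Suc m)"
    by (metis le_add_diff_inverse power_add)
  moreover have "pbarb (Suc m) n = pbarb m n + pbarb m (n - Suc m) + pbarb (Suc m) (n - Suc m)"
    using pbarb_rec[of "Suc m" n] True by simp
  ultimately show ?thesis
    using True by (simp add: algebra_simps del: power_Suc)
next
  case False
  thus ?thesis using pbarb_less[of "Suc m" n] by simp
qed

lemma sum_shift_le:
  fixes c :: "nat \<Rightarrow> real"
  assumes "\<And>n. c n \<ge> 0"
  shows "(\<Sum>n<K. if n \<ge> M then c (n - M) else 0) \<le> (\<Sum>n<K. c n)"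
proof -
  have "(\<Sum>n<K. if n \<ge> M then c (n - M) else 0) = (\<Sum>n\<in>{M..<K}. c (n - M))"
    by (rule sum.mono_neutral_cong_right) auto
  also have "\<dots> = (\<Sum>n<K - M. c n)"
    by (rule sum.reindex_bij_witness[of _ "\<lambda>n. n + M" "\<lambda>n. n - M"]) auto
  also have "\<dots> \<le> (\<Sum>n<K. c n)"
    using assms by (intro sum_mono2) auto
  finally show ?thesis .
qed

text \<open>Convergence must precede any summation of the recursion. For partial sums the shifted
  copies can only be smaller, so the recursion becomes an inequality that bounds all partial sums by
  the previous series times (1 + \<rho>^(m+1)) / (1 - \<rho>^(m+1)).\<close>

lemma summable_pbarb_real:
  fixes \<rho> :: real
  assumes "0 \<le> \<rho>" "\<rho> < 1"
  shows "summable (\<lambda>n. real (pbarb m n) * \<rho> ^ n)"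
proof (induction m)
  case 0
  have "(\<lambda>n. real (pbarb 0 n) * \<rho> ^ n) = (\<lambda>n. if n = 0 then 1 else 0)"
    by (auto simp: pbarb_0)
  thus ?case by simp
next
  case (Suc m)
  let ?a = "\<lambda>n. real (pbarb m n) * \<rho> ^ n" and ?b = "\<lambda>n. real (pbarb (Suc m) n) * \<rho> ^ n"
  have q1: "\<rho> ^ Suc m < 1"
    using assms power_Suc_less_one[of \<rho> m] by (cases "\<rho> = 0") auto
  have "sum ?b {..<K} \<le> suminf ?a * (1 + \<rho> ^ Suc m) / (1 - \<rho> ^ Suc m)" for K
  proof -
    have 1: "sum ?a {..<K} \<le> suminf ?a"
      using assms by (intro sum_le_suminf Suc) auto
    let ?c = "\<lambda>n. \<rho> ^ Suc m * (?a n + ?b n)"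
    have 2: "sum ?b {..<K} = sum ?a {..<K} + (\<Sum>n<K. if n \<ge> Suc m then ?c (n - Suc m) else 0)"
      by (rule trans[OF sum.cong[OF refl pbarb_Suc_term] sum.distrib])
    have 3: "(\<Sum>n<K. if n \<ge> Suc m then ?c (n - Suc m) else 0) \<le> (\<Sum>n<K. ?c n)"
      by (rule sum_shift_le)
         (intro mult_nonneg_nonneg add_nonneg_nonneg zero_le_power assms of_nat_0_le_iff)
    have 4: "(\<Sum>n<K. ?c n) = \<rho> ^ Suc m * (sum ?a {..<K} + sum ?b {..<K})"
      by (simp only: sum_distrib_left sum.distrib distrib_left)
    have "sum ?b {..<K} \<le> sum ?a {..<K} + \<rho> ^ Suc m * (sum ?a {..<K} + sum ?b {..<K})"
      using 2 3 4 by linarith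
    hence "sum ?b {..<K} * (1 - \<rho> ^ Suc m) \<le> sum ?a {..<K} * (1 + \<rho> ^ Suc m)"
      by (simp only: algebra_simps)
    also have "\<dots> \<le> suminf ?a * (1 + \<rho> ^ Suc m)"
      using assms by (intro mult_right_mono 1) auto
    finally show ?thesis using q1 by (simp add: pos_le_divide_eq)
  qed
  thus ?case using assms by (intro summableI_nonneg_bounded) auto
qed

lemma summable_pbarb:
  fixes q :: "'a::{real_normed_field,banach}"
  assumes "norm q < 1"
  shows "summable (\<lambda>n. of_nat (pbarb m n) * q ^ n)"
  by (rule summable_norm_cancel)
     (use summable_pbarb_real[of "norm q" m] assms in \<open>simp add: norm_mult norm_power\<close>)

text \<open>The quotient (-q; q)_m / (q; q)_m of q-Pochhammer symbols, used both at real radii and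
  at complex \<open>q\<close>.\<close>

definition overprod :: "nat \<Rightarrow> 'a \<Rightarrow> 'a::field" where
  "overprod m q = (\<Prod>k=1..m. (1 + q ^ k) / (1 - q ^ k))"

lemma power_neq_one_of_norm:
  fixes q :: "'a::real_normed_field"
  assumes "norm q < 1" "k > 0"
  shows "1 - q ^ k \<noteq> 0" "1 + q ^ k \<noteq> 0"
proof -
  have "norm (q ^ k) < 1"
    using assms power_Suc_less_one[of "norm q" "k - 1"]
    by (cases "q = 0") (auto simp: norm_power power_0_left)
  hence "q ^ k \<noteq> 1" "q ^ k \<noteq> - 1" by auto
  thus "1 - q ^ k \<noteq> 0" "1 + q ^ k \<noteq> 0"
    by (auto simp: add_eq_0_iff)
qed

lemma pbarb_sums:
  fixes q :: "'a::{real_normed_field,banach}"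
  assumes q: "norm q < 1"
  shows "(\<lambda>n. of_nat (pbarb m n) * q ^ n) sums overprod m q"
proof (induction m)
  case 0
  have "(\<lambda>n. of_nat (pbarb 0 n) * q ^ n) = (\<lambda>n. if n = 0 then 1 else 0)"
    by (auto simp: pbarb_0)
  thus ?case using sums_If_finite[of "\<lambda>n. n = 0" "\<lambda>_. 1::'a"] by (simp add: overprod_def)
next
  case (Suc m)
  let ?a = "\<lambda>n. of_nat (pbarb m n) * q ^ n" and ?b = "\<lambda>n. of_nat (pbarb (Suc m) n) * q ^ n"
  let ?c = "\<lambda>n. if n \<ge> Suc m then q ^ Suc m * (?a (n - Suc m) + ?b (n - Suc m)) else 0"
  have b: "?b sums suminf ?b" using summable_pbarb[OF q] by (rule summable_sums)
  have "(\<lambda>n. q ^ Suc m * (?a n + ?b n)) sums (q ^ Suc m * (overprod m q + suminf ?b))"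
    by (intro sums_mult sums_add Suc b)
  hence "(\<lambda>n. ?c (n + Suc m)) sums (q ^ Suc m * (overprod m q + suminf ?b))" by simp
  hence "?c sums (q ^ Suc m * (overprod m q + suminf ?b))"
    by (subst (asm) sums_zero_iff_shift) auto
  from sums_add[OF Suc this] 
  have "?b sums (overprod m q + q ^ Suc m * (overprod m q + suminf ?b))"
    by (rule iffD2[OF sums_cong[OF pbarb_Suc_term]])
  with b have "suminf ?b = overprod m q + q ^ Suc m * (overprod m q + suminf ?b)"
    by (rule sums_unique2)
  hence "suminf ?b * (1 - q ^ Suc m) = overprod m q * (1 + q ^ Suc m)"
    by (simp add: algebra_simps)
  hence "suminf ?b = overprod (Suc m) q"
    using power_neq_one_of_norm(1)[OF q, of "Suc m"]
    by (simp add: overprod_def divide_simps del: power_Suc)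
  with b show ?case by simp
qed

text \<open>Each factor is 1 + 2 \<rho>^k / (1 - \<rho>^k), at most the exponential of 2 \<rho>^k /
  (1 - \<rho>), and these exponents form a geometric series. The bound is free of \<open>m\<close>,
  which makes the full series converge.\<close>

lemma overprod_real_bounded:
  fixes \<rho> :: real
  assumes "0 \<le> \<rho>" "\<rho> < 1"
  shows "overprod m \<rho> \<le> exp (2 * \<rho> / (1 - \<rho>) ^ 2)"
proof -
  have "overprod m \<rho> \<le> (\<Prod>k=1..m. exp (2 * \<rho> ^ k / (1 - \<rho>)))"
    unfolding overprod_def
  proof (intro prod_mono conjI)
    fix k assume k: "k \<in> {1..m}"
    hence le: "\<rho> ^ k \<le> \<rho>" using assms power_decreasing[of 1 k \<rho>] by simp
    show "0 \<le> (1 + \<rho> ^ k) / (1 - \<rho> ^ k)" using assms le by simp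
    have "(1 + \<rho> ^ k) / (1 - \<rho> ^ k) = 1 + 2 * \<rho> ^ k / (1 - \<rho> ^ k)"
      using assms le by (simp add: field_simps)
    also have "\<dots> \<le> 1 + 2 * \<rho> ^ k / (1 - \<rho>)"
      using assms le by (intro add_left_mono divide_left_mono) auto
    also have "\<dots> \<le> exp (2 * \<rho> ^ k / (1 - \<rho>))" by (rule exp_ge_add_one_self)
    finally show "(1 + \<rho> ^ k) / (1 - \<rho> ^ k) \<le> exp (2 * \<rho> ^ k / (1 - \<rho>))" .
  qed
  also have "\<dots> = exp (2 / (1 - \<rho>) * (\<Sum>k=1..m. \<rho> ^ k))"
    by (simp add: exp_sum sum_distrib_left)
  also have "(\<Sum>k=1..m. \<rho> ^ k) \<le> \<rho> / (1 - \<rho>)"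
  proof -
    have "(\<Sum>k=1..m. \<rho> ^ k) = \<rho> * (\<Sum>k<m. \<rho> ^ k)"
      by (simp add: sum_distrib_left sum.atLeast1_atMost_eq)
    also have "(\<Sum>k<m. \<rho> ^ k) \<le> (\<Sum>k. \<rho> ^ k)"
      using assms by (intro sum_le_suminf summable_geometric) auto
    also have "\<dots> = 1 / (1 - \<rho>)" using assms by (simp add: suminf_geometric)
    finally show ?thesis using assms by (simp add: mult_left_mono)
  qed
  finally have "overprod m \<rho> \<le> exp (2 / (1 - \<rho>) * (\<rho> / (1 - \<rho>)))"
    using assms by (simp add: mult_left_mono divide_right_mono)
  thus ?thesis by (simp add: power2_eq_square)
qed

lemma summable_pbar_real:
  fixes \<rho> :: real
  assumes \<rho>: "0 \<le> \<rho>" "\<rho> < 1"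
  shows "summable (\<lambda>n. real (pbar n) * \<rho> ^ n)"
proof (rule summableI_nonneg_bounded)
  show "0 \<le> real (pbar n) * \<rho> ^ n" for n using \<rho> by simp
  show "(\<Sum>n<K. real (pbar n) * \<rho> ^ n) \<le> exp (2 * \<rho> / (1 - \<rho>) ^ 2)" for K
  proof -
    \<comment> \<open>Parts of size above K cannot occur for n < K, so a partial sum of the full
      series is one of the series for \<open>pbarb K\<close>.\<close>
    have "(\<Sum>n<K. real (pbar n) * \<rho> ^ n) = (\<Sum>n<K. real (pbarb K n) * \<rho> ^ n)"
      by (intro sum.cong) (auto simp: pbarb_eq_pbar)
    also have "\<dots> \<le> (\<Sum>n. real (pbarb K n) * \<rho> ^ n)"
      using \<rho> by (intro sum_le_suminf summable_pbarb_real) auto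
    also have "\<dots> = overprod K \<rho>"
      using pbarb_sums[of \<rho> K] \<rho> by (simp add: sums_iff)
    also have "\<dots> \<le> exp (2 * \<rho> / (1 - \<rho>) ^ 2)" by (rule overprod_real_bounded[OF \<rho>])
    finally show ?thesis .
  qed
qed

definition overgf :: "'a \<Rightarrow> 'a::{real_normed_field,banach}" where
  "overgf q = (\<Sum>n. of_nat (pbar n) * q ^ n)"

lemma overgf_sums:
  fixes q :: "'a::{real_normed_field,banach}"
  assumes "norm q < 1"
  shows "(\<lambda>n. of_nat (pbar n) * q ^ n) sums overgf q"
  unfolding overgf_def
  by (rule summable_sums, rule summable_norm_cancel)
     (use summable_pbar_real[of "norm q"] assms in \<open>simp add: norm_mult norm_power\<close>)

text \<open>Tannery's theorem: each coefficient \<open>pbarb m n\<close> is eventually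
  \<open>pbar n\<close>, and the full series at \<open>norm q\<close> dominates.\<close>

lemma overprod_tendsto_overgf:
  fixes q :: "'a::{real_normed_field,banach}"
  assumes q: "norm q < 1"
  shows "(\<lambda>m. overprod m q) \<longlonglongrightarrow> overgf q"
proof -
  let ?M = "\<lambda>n. real (pbar n) * norm q ^ n"
  have "(\<lambda>m. \<Sum>n. of_nat (pbarb m n) * q ^ n) \<longlonglongrightarrow> (\<Sum>n. of_nat (pbar n) * q ^ n)"
  proof (rule conjunct2[OF conjunct2[OF tannerys_theorem[where M="?M"]]])
    show "((\<lambda>m. of_nat (pbarb m n) * q ^ n) \<longlongrightarrow> of_nat (pbar n) * q ^ n) sequentially" for n
      by (rule tendsto_eventually) (use eventually_ge_at_top[of n] in eventually_elim,
          simp add: pbarb_eq_pbar)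
    show "\<forall>\<^sub>F (n, m) in sequentially \<times>\<^sub>F sequentially. norm (of_nat (pbarb m n) * q ^ n) \<le> ?M n"
      by (intro always_eventually)
         (auto simp: norm_mult norm_power pbarb_le_pbar intro!: mult_right_mono)
    show "summable ?M" using q by (intro summable_pbar_real) auto
  qed auto
  moreover have "(\<Sum>n. of_nat (pbarb m n) * q ^ n) = overprod m q" for m
    using pbarb_sums[OF q, of m] by (simp add: sums_iff)
  ultimately show ?thesis by (simp add: overgf_def)
qed

lemma overprod_real_le_overgf:
  fixes \<rho> :: real
  assumes \<rho>: "0 \<le> \<rho>" "\<rho> < 1"
  shows "overprod m \<rho> \<le> overgf \<rho>"
proof -
  have "(\<Sum>n. real (pbarb m n) * \<rho> ^ n) \<le> (\<Sum>n. real (pbar n) * \<rho> ^ n)"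
    using \<rho> by (intro suminf_le summable_pbarb_real summable_pbar_real)
       (auto intro!: mult_right_mono simp: pbarb_le_pbar)
  thus ?thesis using pbarb_sums[of \<rho> m] \<rho> by (simp add: sums_iff overgf_def)
qed

section \<open>The identity of Gauss and the decay off the positive axis\<close>

text \<open>Jacobi's theta function with index 4 and nome \<open>q\<close>, at argument 0.\<close>

definition theta4 :: "'a \<Rightarrow> 'a::{real_normed_field,banach}" where
  "theta4 q = 1 + 2 * (\<Sum>s. (-1) ^ Suc s * q ^ (Suc s)\<^sup>2)"

lemma theta4_sums:
  fixes q :: "'a::{real_normed_field,banach}"
  assumes q: "norm q < 1"
  shows "(\<lambda>n. 1 + 2 * (\<Sum>s=1..n. (-1) ^ s * q ^ s\<^sup>2)) \<longlonglongrightarrow> theta4 q"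
proof -
  have "summable (\<lambda>s. (-1) ^ Suc s * q ^ (Suc s)\<^sup>2)"
  proof (rule summable_comparison_test)
    show "summable (\<lambda>s. norm q ^ s)" using q by (simp add: summable_geometric)
    have "norm q ^ (Suc s)\<^sup>2 \<le> norm q ^ s" for s
      using q by (intro power_decreasing) (auto simp: power2_eq_square)
    thus "\<exists>K. \<forall>n\<ge>K. norm ((-1) ^ Suc n * q ^ (Suc n)\<^sup>2) \<le> norm q ^ n"
      by (simp add: norm_mult norm_power)
  qed
  hence "(\<lambda>n. \<Sum>s<n. (-1) ^ Suc s * q ^ (Suc s)\<^sup>2) \<longlonglongrightarrow> (\<Sum>s. (-1) ^ Suc s * q ^ (Suc s)\<^sup>2)"
    by (rule summable_LIMSEQ)
  moreover have "(\<Sum>s<n. (-1) ^ Suc s * q ^ (Suc s)\<^sup>2) = (\<Sum>s=1..n. (-1) ^ s * q ^ s\<^sup>2)" for n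
    by (simp add: sum.atLeast1_atMost_eq)
  ultimately show ?thesis
    unfolding theta4_def by (intro tendsto_intros) simp
qed

section \<open>Shanks' finite form of Gauss' identity\<close>

context
  fixes q :: "'a::real_normed_field"
  assumes q: "norm q < 1"
begin

definition shanks_tail :: "nat \<Rightarrow> nat \<Rightarrow> 'a" where
  "shanks_tail s n = (\<Prod>k=Suc s..n. (1 - q ^ k) / (1 + q ^ k))"

text \<open>As 2 / (1 + q^0) = 1, the term s = 0 is \<open>shanks_tail 0 n\<close>, the reciprocal
  of \<open>overprod n q\<close>. It alone survives for large n, because the others carry
  q^(s(n+1)).\<close>

definition shanks_sum :: "nat \<Rightarrow> 'a" where
  "shanks_sum n = (\<Sum>s\<le>n. (-1) ^ s * (2 / (1 + q ^ s)) * shanks_tail s n * q ^ (s * Suc n))"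

lemma one_plus_power_nonzero: "1 + q ^ k \<noteq> 0"
  using power_neq_one_of_norm(2)[OF q, of k] by (cases "k = 0") auto

lemma shanks_tail_Suc_right:
  "s \<le> n \<Longrightarrow> shanks_tail s (Suc n) = shanks_tail s n * ((1 - q ^ Suc n) / (1 + q ^ Suc n))"
  by (simp add: shanks_tail_def)

lemma shanks_tail_left:
  "s < n \<Longrightarrow> shanks_tail s n = (1 - q ^ Suc s) / (1 + q ^ Suc s) * shanks_tail (Suc s) n"
  unfolding shanks_tail_def by (subst prod.atLeast_Suc_atMost) auto

text \<open>Passing from \<open>n\<close> to \<open>n + 1\<close>, the terms \<open>s \<le> n\<close> of Shanks' sum change by a telescoping amount.\<close>

lemma shanks_telescope:
  assumes "j \<le> n"
  shows "(\<Sum>s\<le>j. (-1) ^ s * (2 / (1 + q ^ s)) *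
            (shanks_tail s (Suc n) * q ^ (s * Suc (Suc n)) - shanks_tail s n * q ^ (s * Suc n)))
         = - (2 / (1 + q ^ Suc n)) * ((-1) ^ j * q ^ (Suc j * Suc n) * shanks_tail j n)"
  using assms
proof (induction j)
  case 0
  have "1 + q ^ Suc n \<noteq> 0" by (rule one_plus_power_nonzero)
  thus ?case
    by (simp add: shanks_tail_Suc_right divide_simps del: power_Suc) (simp add: algebra_simps)
next
  case (Suc j)
  let ?R = "shanks_tail (Suc j) n" and ?Q = "q ^ Suc n" and ?a = "q ^ Suc j" 
    and ?b = "q ^ (Suc j * Suc n)" and ?e = "(-1) ^ j :: 'a"
  have nz: "1 + ?Q \<noteq> 0" "1 + ?a \<noteq> 0" by (rule one_plus_power_nonzero)+
  have p: "q ^ (Suc j * Suc (Suc n)) = ?b * ?a" "q ^ (Suc (Suc j) * Suc n) = ?b * ?Q"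
    by (simp_all add: power_add[symmetric] algebra_simps)
  have "(-1) ^ Suc j * (2 / (1 + ?a)) *
          (shanks_tail (Suc j) (Suc n) * q ^ (Suc j * Suc (Suc n)) - ?R * ?b)
      + - (2 / (1 + ?Q)) * (?e * ?b * shanks_tail j n)
      = - ?e * (2 / (1 + ?a)) * (?R * ((1 - ?Q) / (1 + ?Q)) * (?b * ?a) - ?R * ?b)
      - (2 / (1 + ?Q)) * (?e * ?b * ((1 - ?a) / (1 + ?a) * ?R))"
    using Suc.prems shanks_tail_left[of j n] shanks_tail_Suc_right[of "Suc j" n]
    by (simp only: p) simp
  also have "\<dots> = - (2 / (1 + ?Q)) * (- ?e * (?b * ?Q) * ?R)"
    using nz by (simp add: divide_simps del: power_Suc) (simp add: algebra_simps del: power_Suc)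
  also have "\<dots> = - (2 / (1 + ?Q)) * ((-1) ^ Suc j * q ^ (Suc (Suc j) * Suc n) * ?R)"
    by (simp only: p) simp
  finally show ?case
    using Suc by (simp add: add.commute del: power_Suc mult_Suc)
qed

text \<open>For j = n the telescoped change is a single term with denominator 1 + q^(n+1). Adding
  the new term s = n + 1 cancels this denominator and leaves 2 (-1)^(n+1) q^((n+1)^2), the next term
  of the theta series.\<close>

lemma shanks_sum_eq: "shanks_sum n = 1 + 2 * (\<Sum>s=1..n. (-1) ^ s * q ^ s\<^sup>2)"
proof (induction n)
  case 0
  show ?case by (simp add: shanks_sum_def shanks_tail_def)
next
  case (Suc n)
  let ?Q = "q ^ Suc n" and ?b = "q ^ (Suc n * Suc n)"
  have nz: "1 + ?Q \<noteq> 0" by (rule one_plus_power_nonzero)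
  have tail: "shanks_tail m m = 1" for m by (simp add: shanks_tail_def)
  have "shanks_sum (Suc n) - shanks_sum n =
      (\<Sum>s\<le>n. (-1) ^ s * (2 / (1 + q ^ s)) *
            (shanks_tail s (Suc n) * q ^ (s * Suc (Suc n)) - shanks_tail s n * q ^ (s * Suc n)))
      + (-1) ^ Suc n * (2 / (1 + ?Q)) * q ^ (Suc n * Suc (Suc n))"
    by (simp add: shanks_sum_def tail sum_subtractf[symmetric] right_diff_distrib mult.assoc
          del: power_Suc mult_Suc)
  also have "\<dots> = - (2 / (1 + ?Q)) * ((-1) ^ n * ?b)
      + (-1) ^ Suc n * (2 / (1 + ?Q)) * q ^ (Suc n * Suc (Suc n))"
    by (subst shanks_telescope) (simp_all add: tail del: power_Suc mult_Suc)
  also have "q ^ (Suc n * Suc (Suc n)) = ?b * ?Q"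
    by (simp add: power_add[symmetric] algebra_simps)
  also have "- (2 / (1 + ?Q)) * ((-1) ^ n * ?b) + (-1) ^ Suc n * (2 / (1 + ?Q)) * (?b * ?Q)
      = 2 * ((-1) ^ Suc n * ?b) * ((1 + ?Q) / (1 + ?Q))"
    using nz by (simp add: divide_simps del: power_Suc mult_Suc) (simp add: algebra_simps)
  also have "\<dots> = 2 * ((-1) ^ Suc n * q ^ (Suc n)\<^sup>2)"
    using nz by (simp add: power2_eq_square del: power_Suc mult_Suc)
  finally have "shanks_sum (Suc n) = shanks_sum n + 2 * ((-1) ^ Suc n * q ^ (Suc n)\<^sup>2)"
    by (simp add: algebra_simps del: power_Suc)
  thus ?case using Suc by (simp add: algebra_simps del: power_Suc)
qed

text \<open>Each factor satisfies |(1 - z)/(1 + z)| \<le> (1 + |z|)/(1 - |z|), and the missing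
  factors k \<le> s of the majorant are at least 1. The bound is uniform in
  \<open>s\<close>.\<close>

lemma norm_shanks_tail_le: "norm (shanks_tail s n) \<le> overprod n (norm q)"
proof -
  have lt: "norm q ^ k < 1" if "k > 0" for k
    using q that power_Suc_less_one[of "norm q" "k - 1"]
    by (cases "q = 0") (auto simp: power_0_left)
  have ge1: "1 \<le> (1 + norm q ^ k) / (1 - norm q ^ k)" if "k > 0" for k
    using lt[OF that] by (simp add: field_simps)
  have "norm (shanks_tail s n) \<le> (\<Prod>k=Suc s..n. (1 + norm q ^ k) / (1 - norm q ^ k))"
    unfolding shanks_tail_def prod_norm[symmetric]
  proof (intro prod_mono conjI norm_ge_zero)
    fix k assume k: "k \<in> {Suc s..n}"
    have "norm (1 - q ^ k) \<le> 1 + norm q ^ k"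
      using norm_triangle_ineq4[of 1 "q ^ k"] by (simp add: norm_power)
    moreover have "1 - norm q ^ k \<le> norm (1 + q ^ k)"
      using norm_triangle_ineq2[of 1 "- (q ^ k)"] by (simp add: norm_power)
    ultimately show "norm ((1 - q ^ k) / (1 + q ^ k)) \<le> (1 + norm q ^ k) / (1 - norm q ^ k)"
      unfolding norm_divide using lt[of k] k by (intro frac_le) auto
  qed
  also have "\<dots> \<le> (\<Prod>k=1..n. (1 + norm q ^ k) / (1 - norm q ^ k))"
  proof (rule prod_mono2)
    show "1 \<le> (1 + norm q ^ k) / (1 - norm q ^ k)" if "k \<in> {1..n} - {Suc s..n}" for k
      using that by (intro ge1) auto
    show "0 \<le> (1 + norm q ^ k) / (1 - norm q ^ k)" if "k \<in> {Suc s..n}" for k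
      using that ge1[of k] by auto
  qed auto
  finally show ?thesis by (simp add: overprod_def)
qed

end

text \<open>\<open>E n\<close> collects the terms s \<ge> 1 of Shanks' sum. Each of these n terms is
  a bounded multiple of |q|^n, so \<open>E\<close> tends to 0, while the term s = 0 times
  \<open>overprod n q\<close> is exactly 1.\<close>

theorem overgf_theta4:
  fixes q :: "'a::{real_normed_field,banach}"
  assumes q: "norm q < 1"
  shows "overgf q * theta4 q = 1"
proof -
  define B where "B = overgf (norm q)"
  define E where "E = (\<lambda>n. shanks_sum q n - shanks_tail q 0 n)"
  have "1 - norm q > 0" using q by simp
  have E: "norm (E n) \<le> (2 * B / (1 - norm q)) * (real n * norm q ^ n)" for n
  proof -
    have "E n = (\<Sum>s=1..n. (-1) ^ s * (2 / (1 + q ^ s)) * shanks_tail q s n * q ^ (s * Suc n))"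
      unfolding E_def shanks_sum_def[OF q]
      by (simp add: atMost_atLeast0 sum.atLeast_Suc_atMost)
    also have "norm \<dots> \<le> (\<Sum>s=1..n. (2 * B / (1 - norm q)) * norm q ^ n)"
    proof (rule sum_norm_le)
      fix s assume s: "s \<in> {1..n}"
      have "1 - norm q \<le> 1 - norm q ^ s"
        using s q power_decreasing[of 1 s "norm q"] by auto
      also have "\<dots> \<le> norm (1 + q ^ s)"
        using norm_triangle_ineq2[of 1 "- (q ^ s)"] by (simp add: norm_power)
      finally have 1: "2 / norm (1 + q ^ s) \<le> 2 / (1 - norm q)"
        using q by (intro divide_left_mono mult_pos_pos) auto
      have 2: "norm (shanks_tail q s n) \<le> B"
        unfolding B_def using norm_shanks_tail_le[OF q] overprod_real_le_overgf[of "norm q"] q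
        by (meson norm_ge_zero order_trans)
      have 3: "norm q ^ (s * Suc n) \<le> norm q ^ n"
        using q s by (intro power_decreasing) (cases s; simp)+
      have "norm ((-1) ^ s * (2 / (1 + q ^ s)) * shanks_tail q s n * q ^ (s * Suc n))
          = (2 / norm (1 + q ^ s)) * norm (shanks_tail q s n) * norm q ^ (s * Suc n)"
        by (simp add: norm_mult norm_power norm_divide)
      also have "\<dots> \<le> (2 / (1 - norm q)) * B * norm q ^ n"
        using q order_trans[OF norm_ge_zero 2] by (intro mult_mono 1 2 3) auto
      finally show "norm ((-1) ^ s * (2 / (1 + q ^ s)) * shanks_tail q s n * q ^ (s * Suc n))
          \<le> (2 * B / (1 - norm q)) * norm q ^ n" by simp
    qed
    finally show ?thesis by (simp add: mult_ac)
  qed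
  have "(\<lambda>n. (2 * B / (1 - norm q)) * (real n * norm q ^ n)) \<longlonglongrightarrow> (2 * B / (1 - norm q)) * 0"
    using q powser_times_n_limit_0[of "norm q"] by (intro tendsto_intros) simp
  hence "(\<lambda>n. (2 * B / (1 - norm q)) * (real n * norm q ^ n)) \<longlonglongrightarrow> 0" by simp
  hence E0: "E \<longlonglongrightarrow> 0"
    by (rule Lim_null_comparison[rotated]) (use E in \<open>simp add: always_eventually\<close>)
  have one: "overprod n q * shanks_tail q 0 n = 1" for n
    unfolding overprod_def shanks_tail_def[OF q] One_nat_def prod.distrib[symmetric]
    by (rule prod.neutral) (use power_neq_one_of_norm[OF q] in auto)
  have "(\<lambda>n. overprod n q * shanks_sum q n) \<longlonglongrightarrow> overgf q * theta4 q"
    unfolding shanks_sum_eq[OF q] by (intro tendsto_mult overprod_tendsto_overgf theta4_sums q)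
  moreover have "(\<lambda>n. 1 + overprod n q * E n) \<longlonglongrightarrow> 1 + overgf q * 0"
    by (intro tendsto_intros overprod_tendsto_overgf q E0)
  moreover have "1 + overprod n q * E n = overprod n q * shanks_sum q n" for n
    using one[of n] by (simp add: E_def algebra_simps)
  ultimately show ?thesis using LIMSEQ_unique by fastforce
qed

section \<open>Decay of the product away from the positive axis\<close>

text \<open>The series ln |(1 + z)/(1 - z)| = 2 Re (z + z^3/3 + z^5/5 + ...) is compared term by
  term with its value at |z|. Every difference is nonnegative, and the first one alone, 2 (|z| - Re
  z), already gives the exponential factor.\<close>

lemma norm_factor_le:
  fixes z :: complex
  assumes z: "cmod z < 1"
  shows "cmod ((1 + z) / (1 - z)) \<le> (1 + cmod z) / (1 - cmod z) * exp (- 2 * (cmod z - Re z))"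
proof -
  define a where "a = cmod z"
  have a: "0 \<le> a" "a < 1" using z by (auto simp: a_def)
  have series: "(\<lambda>n. Re (w ^ n - (-w) ^ n) / real n) sums ln (cmod ((1 + w) / (1 - w)))"
    if w: "cmod w < 1" for w :: complex
  proof -
    have nz: "1 + w \<noteq> 0" "1 - w \<noteq> 0"
      using w by (auto simp: add_eq_0_iff)
    have "(\<lambda>n. - ((-w) ^ n) / of_nat n - - ((- (- w)) ^ n) / of_nat n) sums (Ln (1 + w) - Ln (1 + - w))"
      using w by (intro sums_diff Ln_series') auto
    hence "(\<lambda>n. Re (- ((-w) ^ n) / of_nat n - - ((- (- w)) ^ n) / of_nat n))
        sums Re (Ln (1 + w) - Ln (1 + - w))" by (rule sums_Re)
    moreover have "Re (Ln (1 + w) - Ln (1 + - w)) = ln (cmod ((1 + w) / (1 - w)))"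
      using nz by (simp add: norm_divide ln_div)
    moreover have "Re (- ((-w) ^ n) / of_nat n - - ((- (- w)) ^ n) / of_nat n)
        = Re (w ^ n - (-w) ^ n) / real n" for n
      by (simp add: diff_divide_distrib Re_divide_of_nat)
    ultimately show ?thesis by simp
  qed
  have nz: "1 + z \<noteq> 0" "1 - z \<noteq> 0" using z by (auto simp: add_eq_0_iff)
  let ?d = "\<lambda>n. Re (of_real a ^ n - (- of_real a) ^ n) / real n - Re (z ^ n - (-z) ^ n) / real n"
  have sums: "?d sums (ln ((1 + a) / (1 - a)) - ln (cmod ((1 + z) / (1 - z))))"
  proof (rule sums_diff)
    have "cmod ((1 + of_real a) / (1 - of_real a)) = (1 + a) / (1 - a)"
      using a norm_of_real[of "(1 + a) / (1 - a)", where 'a = complex] by (simp add: norm_divide)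
    thus "(\<lambda>n. Re (of_real a ^ n - (- of_real a) ^ n) / real n) sums ln ((1 + a) / (1 - a))"
      using series[of "of_real a"] a by simp
    show "(\<lambda>n. Re (z ^ n - (-z) ^ n) / real n) sums ln (cmod ((1 + z) / (1 - z)))"
      by (rule series[OF z])
  qed
  have nonneg: "?d n \<ge> 0" for n
  proof -
    have "Re (z ^ n) \<le> a ^ n" using complex_Re_le_cmod[of "z ^ n"] by (simp add: norm_power a_def)
    moreover have "(- of_real a :: complex) ^ n = (-1) ^ n * of_real (a ^ n)"
      by (metis mult_minus1 power_mult_distrib of_real_power)
    moreover have "(- z) ^ n = (-1) ^ n * z ^ n" by (metis mult_minus1 power_mult_distrib)
    ultimately show ?thesis
      by (cases "even n") (auto simp: divide_right_mono simp flip: of_real_power)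
  qed
  have "?d 1 \<le> ln ((1 + a) / (1 - a)) - ln (cmod ((1 + z) / (1 - z)))"
    using sum_le_suminf[of ?d "{1}"] sums nonneg by (auto simp: sums_iff)
  hence "ln (cmod ((1 + z) / (1 - z))) \<le> ln ((1 + a) / (1 - a)) + - 2 * (a - Re z)"
    by simp
  hence "exp (ln (cmod ((1 + z) / (1 - z)))) \<le> exp (ln ((1 + a) / (1 - a)) + - 2 * (a - Re z))"
    by simp
  thus ?thesis
    using nz a unfolding exp_add a_def[symmetric] by (simp add: exp_ln)
qed

text \<open>Over all factors the gains 2 (\<rho>^k - Re q^k) add up to two geometric series, 2
  (\<rho>/(1 - \<rho>) - Re (q/(1 - q))). Bounding the real part by the modulus leaves a quantity
  that depends on \<open>q\<close> only through |q| and |1 - q|.\<close>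

theorem norm_overgf_le:
  fixes q :: complex
  assumes q: "cmod q < 1"
  shows "cmod (overgf q) \<le> overgf (cmod q) *
           exp (- 2 * cmod q * (1 / (1 - cmod q) - 1 / cmod (1 - q)))"
proof -
  define \<rho> where "\<rho> = cmod q"
  have \<rho>: "0 \<le> \<rho>" "\<rho> < 1" using q by (auto simp: \<rho>_def)
  have nz: "1 - q \<noteq> 0" using q by auto
  have le: "cmod (overprod m q) \<le> overprod m \<rho> * exp (- 2 * (\<Sum>k<m. \<rho> ^ Suc k - Re (q ^ Suc k)))" for m
  proof -
    have "cmod (overprod m q) = (\<Prod>k=1..m. cmod ((1 + q ^ k) / (1 - q ^ k)))"
      by (simp add: overprod_def prod_norm)
    also have "\<dots> \<le> (\<Prod>k=1..m. (1 + \<rho> ^ k) / (1 - \<rho> ^ k) * exp (- 2 * (\<rho> ^ k - Re (q ^ k))))"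
    proof (intro prod_mono conjI norm_ge_zero)
      fix k assume k: "k \<in> {1..m}"
      have "cmod (q ^ k) < 1"
        using k q power_Suc_less_one[of "cmod q" "k - 1"]
        by (cases "q = 0") (auto simp: norm_power power_0_left)
      from norm_factor_le[OF this]
      show "cmod ((1 + q ^ k) / (1 - q ^ k)) \<le> (1 + \<rho> ^ k) / (1 - \<rho> ^ k) * exp (- 2 * (\<rho> ^ k - Re (q ^ k)))"
        by (simp add: norm_power \<rho>_def)
    qed
    also have "\<dots> = overprod m \<rho> * exp (- 2 * (\<Sum>k=1..m. \<rho> ^ k - Re (q ^ k)))"
      by (simp only: overprod_def prod.distrib sum_distrib_left exp_sum finite_atLeastAtMost)
    finally show ?thesis by (simp only: sum.atLeast1_atMost_eq One_nat_def)
  qed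
  have "(\<lambda>k. \<rho> ^ k * \<rho>) sums (1 / (1 - \<rho>) * \<rho>)"
    using \<rho> by (intro sums_mult2 geometric_sums) auto
  moreover have "(\<lambda>k. Re (q ^ k * q)) sums Re (1 / (1 - q) * q)"
    using q by (intro sums_Re sums_mult2 geometric_sums)
  ultimately have "(\<lambda>k. \<rho> ^ Suc k - Re (q ^ Suc k)) sums (\<rho> / (1 - \<rho>) - Re (q / (1 - q)))"
    using sums_diff by (fastforce simp: mult.commute)
  hence lim: "(\<lambda>m. \<Sum>k<m. \<rho> ^ Suc k - Re (q ^ Suc k)) \<longlonglongrightarrow> \<rho> / (1 - \<rho>) - Re (q / (1 - q))"
    by (simp add: sums_def)
  have "cmod (overgf q) \<le> overgf \<rho> * exp (- 2 * (\<rho> / (1 - \<rho>) - Re (q / (1 - q))))"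
  proof (rule tendsto_le)
    show "(\<lambda>m. cmod (overprod m q)) \<longlonglongrightarrow> cmod (overgf q)"
      by (intro tendsto_norm overprod_tendsto_overgf q)
    show "(\<lambda>m. overprod m \<rho> * exp (- 2 * (\<Sum>k<m. \<rho> ^ Suc k - Re (q ^ Suc k))))
        \<longlonglongrightarrow> overgf \<rho> * exp (- 2 * (\<rho> / (1 - \<rho>) - Re (q / (1 - q))))"
      by (intro tendsto_mult tendsto_exp tendsto_const lim overprod_tendsto_overgf) (use \<rho> in auto)
  qed (use le in auto)
  also have "\<dots> \<le> overgf \<rho> * exp (- 2 * \<rho> * (1 / (1 - \<rho>) - 1 / cmod (1 - q)))"
  proof (intro mult_left_mono)
    have "Re (q / (1 - q)) \<le> \<rho> / cmod (1 - q)"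
      using complex_Re_le_cmod[of "q / (1 - q)"] by (simp add: norm_divide \<rho>_def)
    moreover have "- 2 * \<rho> * (1 / (1 - \<rho>) - 1 / cmod (1 - q)) = - 2 * (\<rho> / (1 - \<rho>) - \<rho> / cmod (1 - q))"
      by (simp add: right_diff_distrib)
    ultimately show "exp (- 2 * (\<rho> / (1 - \<rho>) - Re (q / (1 - q))))
        \<le> exp (- 2 * \<rho> * (1 / (1 - \<rho>) - 1 / cmod (1 - q)))" by simp
    show "0 \<le> overgf \<rho>" using overprod_real_le_overgf[OF \<rho>, of 0] by (simp add: overprod_def)
  qed
  finally show ?thesis by (simp add: \<rho>_def)
qed

section \<open>The transformation of the theta function\<close>

text \<open>The real part of the characteristic function of the standard normal distribution, after
  the substitution x -> c x with c^2 = 2 T.\<close>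

lemma gaussian_cos_has_integral:
  fixes T s :: real
  assumes T: "T > 0"
  shows "((\<lambda>x. exp (- (T * x\<^sup>2)) * cos (s * x)) has_integral sqrt (pi / T) * exp (- s\<^sup>2 / (4 * T))) UNIV"
proof -
  define c where "c = sqrt (2 * T)"
  have c: "c > 0" "c\<^sup>2 = 2 * T" using T by (auto simp: c_def)
  define t where "t = s / c"
  interpret std: real_distribution std_normal_distribution by (rule real_dist_normal_dist)
  have int: "integrable std_normal_distribution (\<lambda>x. iexp (t * x))"
    by (intro std.integrable_iexp) auto
  have intc: "integrable std_normal_distribution (\<lambda>x. cos (t * x))"
    using integrable_Re[OF int] by (simp add: Re_exp)
  have "exp (- (t\<^sup>2) / 2) = Re (char std_normal_distribution t)"
    by (simp add: char_std_normal_distribution del: of_real_exp)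
  also have "\<dots> = (LINT x|std_normal_distribution. cos (t * x))"
    unfolding char_def using integral_Re[OF int] by (simp add: Re_exp)
  also have "\<dots> = (LINT x|lborel. std_normal_density x * cos (t * x))"
    by (subst integral_density) (auto simp: normal_density_nonneg)
  also have "\<dots> = c * (LINT x|lborel. std_normal_density (c * x) * cos (t * (c * x)))"
    using c by (subst lborel_integral_real_affine[where c = c and t = 0]) auto
  also have "(\<lambda>x. std_normal_density (c * x) * cos (t * (c * x)))
      = (\<lambda>x. (1 / sqrt (2 * pi)) * (exp (- (T * x\<^sup>2)) * cos (s * x)))"
    using c by (auto simp: std_normal_density_def t_def power_mult_distrib)
  finally have eq: "exp (- (t\<^sup>2) / 2) = c / sqrt (2 * pi) * (LINT x|lborel. exp (- (T * x\<^sup>2)) * cos (s * x))"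
    by simp
  have "integrable lborel (\<lambda>x. std_normal_density x * cos (t * x))"
    using intc by (subst (asm) integrable_density) (auto simp: normal_density_nonneg)
  hence "integrable lborel (\<lambda>x. std_normal_density (c * x) * cos (t * (c * x)))"
    using c lborel_integrable_real_affine[of "\<lambda>x. std_normal_density x * cos (t * x)" c 0] by simp
  also have "(\<lambda>x. std_normal_density (c * x) * cos (t * (c * x)))
      = (\<lambda>x. (1 / sqrt (2 * pi)) * (exp (- (T * x\<^sup>2)) * cos (s * x)))"
    using c by (auto simp: std_normal_density_def t_def power_mult_distrib)
  finally have "integrable lborel (\<lambda>x. sqrt (2 * pi) *
      ((1 / sqrt (2 * pi)) * (exp (- (T * x\<^sup>2)) * cos (s * x))))"
    by (rule integrable_mult_right)
  hence "integrable lborel (\<lambda>x. exp (- (T * x\<^sup>2)) * cos (s * x))" by simp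
  hence "((\<lambda>x. exp (- (T * x\<^sup>2)) * cos (s * x)) has_integral
      (LINT x|lborel. exp (- (T * x\<^sup>2)) * cos (s * x))) UNIV"
    by (rule has_integral_integral_lborel)
  also have "(LINT x|lborel. exp (- (T * x\<^sup>2)) * cos (s * x)) = sqrt (2 * pi) / c * exp (- (t\<^sup>2) / 2)"
    using eq c by (simp add: field_simps)
  also have "sqrt (2 * pi) / c = sqrt (pi / T)"
    using T by (simp add: c_def real_sqrt_divide real_sqrt_mult)
  also have "- (t\<^sup>2) / 2 = - s\<^sup>2 / (4 * T)"
    using T by (simp add: t_def power_divide c)
  finally show ?thesis .
qed

section \<open>Uniqueness of even Fourier expansions\<close>

text \<open>The product formula trades one power of cos (2 pi x) for the two neighbouring
  frequencies, so vanishing cosine coefficients make \<open>g\<close> orthogonal to every polynomial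
  in cos (2 pi x).\<close>

lemma cos_mult_power_has_integral_0:
  fixes g :: "real \<Rightarrow> real"
  assumes "\<And>m::nat. ((\<lambda>x. g x * cos (2 * pi * real m * x)) has_integral 0) S"
  shows "((\<lambda>x. g x * cos (2 * pi * real m * x) * cos (2 * pi * x) ^ j) has_integral 0) S"
proof (induction j arbitrary: m)
  case 0
  thus ?case using assms by simp
next
  case (Suc j)
  \<comment> \<open>This is the absolute value of m - 1; truncated subtraction would give 0 for m =
    0, where the cosine has frequency 1.\<close>
  define m' where "m' = (if m = 0 then 1 else m - 1)"
  have "cos (2 * pi * real m' * x) = cos (2 * pi * real m * x - 2 * pi * x)" for x
    by (cases m) (auto simp: m'_def algebra_simps)
  moreover have "2 * pi * real (Suc m) * x = 2 * pi * real m * x + 2 * pi * x" for x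
    by (simp add: algebra_simps)
  ultimately have prod: "cos (2 * pi * real m * x) * cos (2 * pi * x) =
      (cos (2 * pi * real (Suc m) * x) + cos (2 * pi * real m' * x)) / 2" for x
    by (simp only: cos_times_cos add.commute)
  have half: "w * a * b ^ Suc j = (w * c * b ^ j + w * d * b ^ j) / 2"
    if "a * b = (c + d) / 2" for w a b c d :: real
  proof -
    have "w * a * b ^ Suc j = w * (a * b) * b ^ j" by simp
    also have "\<dots> = (w * c * b ^ j + w * d * b ^ j) / 2"
      by (simp only: that) (simp add: field_simps)
    finally show ?thesis .
  qed
  note eq = half[OF prod]
  have "((\<lambda>x. (g x * cos (2 * pi * real (Suc m) * x) * cos (2 * pi * x) ^ j +
       g x * cos (2 * pi * real m' * x) * cos (2 * pi * x) ^ j) / 2) has_integral (0 + 0) / 2) S"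
    by (intro has_integral_divide has_integral_add Suc)
  thus ?case by (simp only: eq) simp
qed

text \<open>An even \<open>g\<close> is a continuous function \<open>\<phi>\<close> of cos (2 pi x).
  By Weierstrass \<open>\<phi>\<close> is uniformly close to a polynomial, and \<open>g\<close> is
  orthogonal to that polynomial in the cosine, so the integral of g^2 is at most every e > 0.
  Pointwise convergence of Fourier series does not enter.\<close>

lemma even_fourier_unique:
  fixes g :: "real \<Rightarrow> real"
  assumes cont: "continuous_on {-1/2..1/2} g"
    and even: "\<And>x. g (- x) = g x"
    and coeff: "\<And>m::nat. ((\<lambda>x. g x * cos (2 * pi * real m * x)) has_integral 0) {-1/2..1/2}"
    and x: "x \<in> {-1/2..1/2}"
  shows "g x = 0"
proof -
  define \<phi> where "\<phi> = (\<lambda>c. g (arccos c / (2 * pi)))"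
  have "continuous_on {-1..1} \<phi>"
    unfolding \<phi>_def
  proof (rule continuous_on_compose2[OF cont])
    show "continuous_on {-1..1} (\<lambda>c. arccos c / (2 * pi))"
      by (intro continuous_intros continuous_on_arccos') auto
    show "(\<lambda>c. arccos c / (2 * pi)) ` {- 1..1} \<subseteq> {- 1/2..1/2}"
      using arccos_lbound arccos_ubound by (force simp: field_simps)
  qed
  have g_eq: "g x = \<phi> (cos (2 * pi * x))" if "x \<in> {-1/2..1/2}" for x
  proof -
    have "arccos (cos (2 * pi * \<bar>x\<bar>)) = 2 * pi * \<bar>x\<bar>"
      using that by (intro arccos_cos) (auto simp: field_simps)
    moreover have "cos (2 * pi * \<bar>x\<bar>) = cos (2 * pi * x)" by (cases "x \<ge> 0") auto
    moreover have "g \<bar>x\<bar> = g x" using even[of x] by (cases "x \<ge> 0") auto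
    ultimately show ?thesis by (simp add: \<phi>_def)
  qed
  have poly: "((\<lambda>x. g x * p (cos (2 * pi * x))) has_integral 0) {-1/2..1/2}"
    if p: "real_polynomial_function p" for p
  proof -
    obtain a n where p_eq: "p = (\<lambda>x. \<Sum>i\<le>n. a i * x ^ i)"
      using real_polynomial_function_imp_sum[OF p] by auto
    have "((\<lambda>x. \<Sum>i\<le>n. a i * (g x * cos (2 * pi * real 0 * x) * cos (2 * pi * x) ^ i))
        has_integral (\<Sum>i\<le>n. a i * 0)) {-1/2..1/2}"
      by (intro has_integral_sum has_integral_mult_right cos_mult_power_has_integral_0 coeff) auto
    thus ?thesis by (simp add: p_eq sum_distrib_left mult_ac)
  qed
  have "bounded (g ` {-1/2..1/2})"
    by (intro compact_imp_bounded compact_continuous_image cont) auto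
  then obtain B where B: "B > 0" "\<And>x. x \<in> {-1/2..1/2} \<Longrightarrow> \<bar>g x\<bar> \<le> B"
    unfolding bounded_pos by auto
  have int: "(\<lambda>x. g x * g x) integrable_on {-1/2..1/2}"
    by (intro integrable_continuous_interval continuous_intros cont)
  have "integral {-1/2..1/2} (\<lambda>x. g x * g x) \<le> 0 + e" if e: "e > 0" for e
  proof -
    obtain p where p: "real_polynomial_function p" "\<And>c. c \<in> {-1..1} \<Longrightarrow> \<bar>\<phi> c - p c\<bar> < e / B"
      using Stone_Weierstrass_real_polynomial_function[of "{-1..1}" \<phi> "e / B"] 
        \<open>continuous_on {-1..1} \<phi>\<close> e B by auto
    have "((\<lambda>x. g x * g x - g x * p (cos (2 * pi * x))) has_integral
        integral {-1/2..1/2} (\<lambda>x. g x * g x) - 0) {-1/2..1/2}"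
      by (intro has_integral_diff poly p integrable_integral int)
    moreover have "((\<lambda>x. e) has_integral e) {-1/2..1/2::real}"
      using has_integral_const_real[of e "-1/2" "1/2"] by simp
    ultimately have "integral {-1/2..1/2} (\<lambda>x. g x * g x) - 0 \<le> e"
    proof (rule has_integral_le)
      fix x :: real assume x: "x \<in> {-1/2..1/2}"
      have "g x * g x - g x * p (cos (2 * pi * x)) = g x * (\<phi> (cos (2 * pi * x)) - p (cos (2 * pi * x)))"
        using g_eq[OF x] by (simp only: right_diff_distrib)
      also have "\<dots> \<le> \<bar>g x\<bar> * \<bar>\<phi> (cos (2 * pi * x)) - p (cos (2 * pi * x))\<bar>"
        by (metis abs_ge_self abs_mult)
      also have "\<dots> \<le> B * (e / B)"
        using p(2)[of "cos (2 * pi * x)"] B(1) by (intro mult_mono B x) auto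
      also have "\<dots> = e" using B by simp
      finally show "g x * g x - g x * p (cos (2 * pi * x)) \<le> e" .
    qed
    thus ?thesis by simp
  qed
  hence "integral {-1/2..1/2} (\<lambda>x. g x * g x) \<le> 0" by (rule field_le_epsilon)
  moreover have "integral {-1/2..1/2} (\<lambda>x. g x * g x) \<ge> 0"
    by (intro integral_nonneg int) auto
  ultimately have "integral {-1/2..1/2} (\<lambda>x. g x * g x) = 0" by simp
  moreover have "continuous_on {-1/2..1/2} (\<lambda>x. g x * g x)" by (intro continuous_intros cont)
  ultimately have "\<forall>x\<in>{-1/2..1/2}. g x * g x = 0"
    using integral_eq_0_iff[of "-1/2" "1/2" "\<lambda>x. g x * g x"] by auto
  thus ?thesis using x by simp
qed

text \<open>This allows the Fourier coefficients of a uniformly convergent series to be read off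
  from its partial sums.\<close>

lemma has_integral_uniform_limit_mult_cos:
  fixes f :: "real \<Rightarrow> real"
  assumes lim: "uniform_limit {a..b} F f sequentially"
    and cont: "\<And>n. continuous_on {a..b} (F n)"
    and int: "\<And>n. ((\<lambda>x. F n x * cos (c * x)) has_integral I n) {a..b}"
    and I: "I \<longlonglongrightarrow> J"
  shows "((\<lambda>x. f x * cos (c * x)) has_integral J) {a..b}"
proof -
  have "uniform_limit {a..b} (\<lambda>n x. F n x * cos (c * x)) (\<lambda>x. f x * cos (c * x)) sequentially"
  proof (rule uniform_limitI)
    fix e :: real assume e: "e > 0"
    have le: "dist (F n x * cos (c * x)) (f x * cos (c * x)) \<le> dist (F n x) (f x)" for n x
    proof -
      have "dist (F n x * cos (c * x)) (f x * cos (c * x)) = dist (F n x) (f x) * \<bar>cos (c * x)\<bar>"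
        by (simp add: dist_real_def abs_mult[symmetric] left_diff_distrib)
      also have "\<dots> \<le> dist (F n x) (f x) * 1" by (intro mult_left_mono) auto
      finally show ?thesis by simp
    qed
    show "\<forall>\<^sub>F n in sequentially. \<forall>x\<in>{a..b}. dist (F n x * cos (c * x)) (f x * cos (c * x)) < e"
      using uniform_limitD[OF lim e] by eventually_elim (use le in \<open>blast intro: le_less_trans\<close>)
  qed
  moreover have "continuous_on {a..b} (\<lambda>x. F n x * cos (c * x))" for n
    by (intro continuous_intros cont)
  ultimately obtain I' J' where *: "\<And>n. ((\<lambda>x. F n x * cos (c * x)) has_integral I' n) {a..b}"
      "((\<lambda>x. f x * cos (c * x)) has_integral J') {a..b}" "I' \<longlonglongrightarrow> J'"
    by (rule uniform_limit_integral) auto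
  have "I' = I" using *(1) int has_integral_unique by blast
  hence "J' = J" using *(3) I LIMSEQ_unique by blast
  thus ?thesis using *(2) by simp
qed

lemma has_integral_cos_period:
  assumes "k \<noteq> (0::int)"
  shows "((\<lambda>x. cos (2 * pi * of_int k * x)) has_integral 0) {-1/2..1/2::real}"
proof -
  have k: "2 * pi * real_of_int k \<noteq> 0" using assms by simp
  have "((\<lambda>x. cos (2 * pi * of_int k * x)) has_integral
      sin (2 * pi * of_int k * (1/2)) / (2 * pi * of_int k) -
      sin (2 * pi * of_int k * (- 1/2)) / (2 * pi * of_int k)) {-1/2..1/2::real}"
    by (rule fundamental_theorem_of_calculus)
       (use k in \<open>auto simp flip: has_real_derivative_iff_has_vector_derivative
         intro!: derivative_eq_intros\<close>)
  moreover have "sin (pi * of_int k) = 0" by (simp add: sin_zero_iff_int2 mult.commute)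
  ultimately show ?thesis by (simp add: mult_ac)
qed

lemma has_integral_cos_cos:
  "((\<lambda>x. cos (2 * pi * real m * x) * cos (2 * pi * real l * x)) has_integral
      (if m = l then if m = 0 then 1 else 1 / 2 else 0)) {-1/2..1/2::real}"
proof -
  have cos1: "((\<lambda>x. cos (2 * pi * of_int k * x)) has_integral (if k = 0 then 1 else 0)) {-1/2..1/2::real}"
    for k :: int
    using has_integral_cos_period[of k] has_integral_const_real[of "1::real" "-1/2" "1/2"]
    by (cases "k = 0") auto
  have "((\<lambda>x. (cos (2 * pi * of_int (int m - int l) * x) + cos (2 * pi * of_int (int m + int l) * x)) / 2)
      has_integral ((if int m - int l = 0 then 1 else 0) + (if int m + int l = 0 then 1 else 0)) / 2)
      {-1/2..1/2::real}"
    by (intro has_integral_divide has_integral_add cos1)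
  moreover have prod: "cos (2 * pi * real m * x) * cos (2 * pi * real l * x) =
      (cos (2 * pi * of_int (int m - int l) * x) + cos (2 * pi * of_int (int m + int l) * x)) / 2" for x
  proof -
    have "2 * pi * of_int (int m - int l) * x = 2 * pi * real m * x - 2 * pi * real l * x"
      "2 * pi * of_int (int m + int l) * x = 2 * pi * real m * x + 2 * pi * real l * x"
      by (simp_all add: algebra_simps)
    thus ?thesis by (simp only: cos_times_cos)
  qed
  moreover have "((if int m - int l = 0 then 1 else 0) + (if int m + int l = 0 then 1 else 0)) / 2
      = (if m = l then if m = 0 then 1 else 1 / 2 else (0::real))" by auto
  ultimately show ?thesis by (simp only:)
qed

lemma summable_exp_neg: "a > 0 \<Longrightarrow> summable (\<lambda>j::nat. exp (- (a * real j)))"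
proof -
  assume "a > 0"
  hence "summable (\<lambda>j. exp (- a) ^ j)" by (intro summable_geometric) auto
  thus ?thesis by (simp add: exp_of_nat_mult[symmetric] mult.commute)
qed

section \<open>Poisson summation for the Gaussian\<close>

context
  fixes T :: real
  assumes T: "T > 0"
begin

definition gauss :: "real \<Rightarrow> real" where "gauss x = exp (- (T * x\<^sup>2))"

text \<open>Joining the translates by j and -j writes the periodised Gaussian as a series of even
  functions over the naturals. The factor 2 in \<open>gauss_cos_term\<close> joins the frequencies m
  and -m in the same way.\<close>

definition gauss_pair :: "nat \<Rightarrow> real \<Rightarrow> real" where
  "gauss_pair j x = (if j = 0 then gauss x else gauss (x + real j) + gauss (x - real j))"

definition gauss_coeff :: "nat \<Rightarrow> real" where
  "gauss_coeff m = sqrt (pi / T) * exp (- (pi\<^sup>2 * (real m)\<^sup>2 / T))"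

definition gauss_cos_term :: "nat \<Rightarrow> real \<Rightarrow> real" where
  "gauss_cos_term m x = (if m = 0 then 1 else 2) * gauss_coeff m * cos (2 * pi * real m * x)"

lemma gauss_uminus [simp]: "gauss (- x) = gauss x"
  by (simp add: gauss_def)

lemma gauss_pair_uminus: "gauss_pair j (- x) = gauss_pair j x"
  using gauss_uminus[of "x - real j"] gauss_uminus[of "x + real j"]
  by (simp add: gauss_pair_def algebra_simps del: gauss_uminus) (simp add: algebra_simps)

lemma continuous_on_gauss [continuous_intros]: "continuous_on A f \<Longrightarrow> continuous_on A (\<lambda>x. gauss (f x))"
  unfolding gauss_def by (intro continuous_intros)

lemma continuous_on_gauss_pair: "continuous_on A (gauss_pair j)"
  unfolding gauss_pair_def[abs_def] by (cases "j = 0") (auto intro!: continuous_intros)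

text \<open>For j \<ge> 1 one has j - 1/2 \<ge> j/2 and j^2 \<ge> j, so the quadratic exponent can
  be weakened to a linear one, which turns the majorant into a geometric series.\<close>

lemma gauss_le:
  assumes "j \<ge> 1" "\<bar>x\<bar> \<ge> real j - 1/2"
  shows "gauss x \<le> exp (- (T / 4 * real j))"
proof -
  have "real j / 4 \<le> (real j / 2)\<^sup>2"
    using assms(1) mult_left_mono[of 1 "real j" "real j"] by (simp add: power2_eq_square)
  also have "\<dots> \<le> \<bar>x\<bar>\<^sup>2"
    using assms by (intro power_mono) auto
  finally have "T * (real j / 4) \<le> T * x\<^sup>2" using T by (intro mult_left_mono) auto
  thus ?thesis by (simp add: gauss_def)
qed

lemma gauss_pair_bound: "x \<in> {-1/2..1/2} \<Longrightarrow> norm (gauss_pair j x) \<le> 2 * exp (- (T / 4 * real j))"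
proof (cases "j = 0")
  case True
  have "gauss x \<le> 1" "gauss x \<ge> 0" using T by (auto simp: gauss_def)
  thus ?thesis using True by (simp add: gauss_pair_def)
next
  case False
  assume x: "x \<in> {-1/2..1/2}"
  have "gauss (x + real j) \<le> exp (- (T / 4 * real j))" "gauss (x - real j) \<le> exp (- (T / 4 * real j))"
    using False x by (intro gauss_le; auto)+
  moreover have "gauss y \<ge> 0" for y by (simp add: gauss_def)
  ultimately show ?thesis using False by (simp add: gauss_pair_def)
qed

lemma gauss_pair_uniform:
  "uniform_limit {-1/2..1/2} (\<lambda>K x. \<Sum>j<K. gauss_pair j x) (\<lambda>x. \<Sum>j. gauss_pair j x) sequentially"
  using T by (intro Weierstrass_m_test[where M = "\<lambda>j. 2 * exp (- (T / 4 * real j))"] gauss_pair_bound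
      summable_mult summable_exp_neg) auto

text \<open>Unfolding: the cosine has period 1, and the translates of the unit interval by the
  integers from -K to K tile the interval on the right.\<close>

lemma gauss_pair_partial_integral:
  "((\<lambda>x. (\<Sum>j<Suc K. gauss_pair j x) * cos (2 * pi * real m * x)) has_integral
     integral {-(real K + 1/2)..real K + 1/2} (\<lambda>x. gauss x * cos (2 * pi * real m * x))) {-1/2..1/2}"
proof (induction K)
  case 0
  show ?case
    by (simp add: gauss_pair_def) (intro integrable_integral integrable_continuous_interval continuous_intros)
next
  case (Suc K)
  let ?w = "\<lambda>x. gauss x * cos (2 * pi * real m * x)"
  let ?k = "real (Suc K)"
  have int: "(?w has_integral integral {a..b} ?w) {a..b}" for a b
    by (intro integrable_integral integrable_continuous_interval continuous_intros)
  have per: "cos (2 * pi * real m * (x + of_int i)) = cos (2 * pi * real m * x)" for x and i :: int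
  proof -
    have "cos (2 * pi * real m * x + 2 * pi * of_int (int m * i)) = cos (2 * pi * real m * x)"
      using cos_int_2pin[of "int m * i"] sin_int_2pin[of "int m * i"] by (simp add: cos_add)
    thus ?thesis by (simp add: algebra_simps)
  qed
  have A: "((\<lambda>x. gauss (x + ?k) * cos (2 * pi * real m * x)) has_integral
      integral {real K + 1/2..real K + 3/2} ?w) {-1/2..1/2}"
    using has_integral_shift_real_ivl[OF int[of "real K + 1/2" "real K + 3/2"], of ?k]
      per[of _ "int (Suc K)"] by (simp add: algebra_simps)
  have B: "((\<lambda>x. gauss (x - ?k) * cos (2 * pi * real m * x)) has_integral
      integral {-(real K + 3/2)..-(real K + 1/2)} ?w) {-1/2..1/2}"
    using has_integral_shift_real_ivl[OF int[of "-(real K + 3/2)" "-(real K + 1/2)"], of "-?k"]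
      per[of _ "- int (Suc K)"] by (simp add: algebra_simps)
  have "((\<lambda>x. (\<Sum>j<Suc K. gauss_pair j x) * cos (2 * pi * real m * x) +
       (gauss (x + ?k) * cos (2 * pi * real m * x) + gauss (x - ?k) * cos (2 * pi * real m * x))) has_integral
     integral {-(real K + 1/2)..real K + 1/2} ?w + (integral {real K + 1/2..real K + 3/2} ?w +
       integral {-(real K + 3/2)..-(real K + 1/2)} ?w)) {-1/2..1/2}"
    by (intro has_integral_add Suc A B)
  moreover have "integral {-(real K + 3/2)..real K + 3/2} ?w =
      integral {-(real K + 3/2)..-(real K + 1/2)} ?w + integral {-(real K + 1/2)..real K + 1/2} ?w
      + integral {real K + 1/2..real K + 3/2} ?w"
    by (intro integral_unique has_integral_combine[where c = "real K + 1/2"]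
        has_integral_combine[where c = "-(real K + 1/2)"] int) auto
  ultimately show ?case
    by (simp add: gauss_pair_def algebra_simps)
qed

lemma gauss_integral_limit:
  "(\<lambda>K. integral {-(real K + 1/2)..real K + 1/2} (\<lambda>x. gauss x * cos (2 * pi * real m * x))) \<longlonglongrightarrow> gauss_coeff m"
proof -
  let ?w = "\<lambda>x. gauss x * cos (2 * pi * real m * x)"
  have w: "(?w has_integral gauss_coeff m) UNIV"
    using gaussian_cos_has_integral[OF T, of "2 * pi * real m"]
    by (simp add: gauss_def gauss_coeff_def power_mult_distrib)
  show ?thesis
  proof (rule LIMSEQ_I)
    fix e :: real assume "e > 0"
    with w obtain B where B: "B > 0" "\<And>a b. ball 0 B \<subseteq> cbox a b \<Longrightarrow>
        \<exists>z. (?w has_integral z) (cbox a b) \<and> norm (z - gauss_coeff m) < e"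
      unfolding has_integral' [of _ _ UNIV] by auto
    obtain K0 :: nat where K0: "real K0 > B" using reals_Archimedean2 by blast
    show "\<exists>K0. \<forall>K\<ge>K0. norm (integral {-(real K + 1/2)..real K + 1/2} ?w - gauss_coeff m) < e"
    proof (intro exI allI impI)
      fix K assume "K \<ge> K0"
      hence "B < real K" using K0 by linarith
      hence "ball 0 B \<subseteq> cbox (-(real K + 1/2)) (real K + 1/2)"
        by (auto simp: dist_real_def)
      from B(2)[OF this] show "norm (integral {-(real K + 1/2)..real K + 1/2} ?w - gauss_coeff m) < e"
        by (auto dest: integral_unique)
    qed
  qed
qed

lemma gauss_cos_term_partial_integral:
  "((\<lambda>x. (\<Sum>m<K. gauss_cos_term m x) * cos (2 * pi * real l * x)) has_integral (if l < K then gauss_coeff l else 0)) {-1/2..1/2}"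
proof -
  have "((\<lambda>x. \<Sum>m<K. (if m = 0 then 1 else 2) * gauss_coeff m * (cos (2 * pi * real m * x) * cos (2 * pi * real l * x)))
     has_integral (\<Sum>m<K. (if m = 0 then 1 else 2) * gauss_coeff m *
       (if m = l then if m = 0 then 1 else 1 / 2 else 0))) {-1/2..1/2}"
    by (intro has_integral_sum has_integral_mult_right has_integral_cos_cos) auto
  moreover have "(\<Sum>m<K. (if m = 0 then 1 else 2) * gauss_coeff m * (if m = l then if m = 0 then 1 else 1 / 2 else 0))
      = (\<Sum>m<K. if m = l then gauss_coeff l else 0)"
    by (intro sum.cong) auto
  ultimately show ?thesis
    by (simp add: gauss_cos_term_def sum_distrib_right sum_distrib_left mult_ac)
qed

lemma gauss_cos_term_bound: "norm (gauss_cos_term m x) \<le> 2 * sqrt (pi / T) * exp (- (pi\<^sup>2 / T * real m))"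
proof -
  have "real m \<le> (real m)\<^sup>2" by (cases "m = 0") (auto simp: power2_eq_square)
  hence "pi\<^sup>2 * real m / T \<le> pi\<^sup>2 * (real m)\<^sup>2 / T"
    using T by (intro divide_right_mono mult_left_mono) auto
  hence gauss_coeff: "gauss_coeff m \<le> sqrt (pi / T) * exp (- (pi\<^sup>2 / T * real m))"
    using T by (auto simp: gauss_coeff_def)
  have "gauss_coeff m \<ge> 0" using T by (simp add: gauss_coeff_def)
  hence "norm (gauss_cos_term m x) = (if m = 0 then 1 else 2) * gauss_coeff m * \<bar>cos (2 * pi * real m * x)\<bar>"
    by (simp add: gauss_cos_term_def abs_mult)
  also have "\<dots> \<le> 2 * gauss_coeff m * 1"
    using \<open>gauss_coeff m \<ge> 0\<close> by (intro mult_mono) auto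
  finally show ?thesis using gauss_coeff by simp
qed

lemma gauss_cos_term_uniform:
  "uniform_limit {-1/2..1/2} (\<lambda>K x. \<Sum>m<K. gauss_cos_term m x) (\<lambda>x. \<Sum>m. gauss_cos_term m x) sequentially"
  using T by (intro Weierstrass_m_test[where M = "\<lambda>m. 2 * sqrt (pi / T) * exp (- (pi\<^sup>2 / T * real m))"]
      gauss_cos_term_bound summable_mult summable_exp_neg) auto

text \<open>Poisson summation. Both sides are continuous and even, and for both the integral against
  cos (2 pi m x) is \<open>gauss_coeff m\<close>: on the left by unfolding to the whole line, on the
  right by orthogonality.\<close>

lemma gauss_pair_eq_gauss_cos_term: "x \<in> {-1/2..1/2} \<Longrightarrow> (\<Sum>j. gauss_pair j x) = (\<Sum>m. gauss_cos_term m x)"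
proof -
  let ?g = "\<lambda>x. (\<Sum>j. gauss_pair j x) - (\<Sum>m. gauss_cos_term m x)"
  assume "x \<in> {-1/2..1/2}"
  hence "?g x = 0"
  proof (rule even_fourier_unique[rotated 3])
    show "continuous_on {- 1/2..1/2} ?g"
      by (intro continuous_on_diff uniform_limit_theorem[OF _ gauss_pair_uniform]
          uniform_limit_theorem[OF _ gauss_cos_term_uniform] always_eventually allI continuous_on_sum
          continuous_on_gauss_pair) (auto simp: gauss_cos_term_def intro!: continuous_intros)
    show "?g (- x) = ?g x" for x
      by (simp add: gauss_pair_uminus gauss_cos_term_def)
    fix m :: nat
    have "((\<lambda>x. (\<Sum>j. gauss_pair j x) * cos (2 * pi * real m * x)) has_integral gauss_coeff m) {-1/2..1/2}"
    proof (rule has_integral_uniform_limit_mult_cos[OF _ _ gauss_pair_partial_integral gauss_integral_limit])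
      show "uniform_limit {- 1 / 2..1 / 2} (\<lambda>K x. \<Sum>j<Suc K. gauss_pair j x) (\<lambda>x. \<Sum>j. gauss_pair j x) sequentially"
        by (rule filterlim_compose[OF gauss_pair_uniform filterlim_Suc])
    qed (intro continuous_on_sum continuous_on_gauss_pair)
    moreover have "((\<lambda>x. (\<Sum>m. gauss_cos_term m x) * cos (2 * pi * real m * x)) has_integral gauss_coeff m) {-1/2..1/2}"
    proof (rule has_integral_uniform_limit_mult_cos[OF gauss_cos_term_uniform _ gauss_cos_term_partial_integral])
      show "(\<lambda>K. if m < K then gauss_coeff m else 0) \<longlonglongrightarrow> gauss_coeff m"
        by (rule tendsto_eventually) (use eventually_gt_at_top[of m] in eventually_elim, simp)
    qed (auto simp: gauss_cos_term_def intro!: continuous_intros)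
    ultimately have "((\<lambda>x. (\<Sum>j. gauss_pair j x) * cos (2 * pi * real m * x) -
        (\<Sum>m. gauss_cos_term m x) * cos (2 * pi * real m * x)) has_integral gauss_coeff m - gauss_coeff m) {-1/2..1/2}"
      by (rule has_integral_diff)
    thus "((\<lambda>x. ?g x * cos (2 * pi * real m * x)) has_integral 0) {-1/2..1/2}"
      by (simp add: left_diff_distrib)
  qed
  thus ?thesis by simp
qed

text \<open>Poisson summation at x = 1/2: there cos (2 pi m x) = (-1)^m produces the alternating
  signs of \<open>theta4\<close>, and the translates sit at the half-integers.\<close>

theorem theta4_transform_real:
  "sqrt (pi / T) * theta4 (exp (- (pi\<^sup>2 / T))) = 2 * (\<Sum>j. exp (- (T * (real j + 1/2)\<^sup>2)))"
proof -
  have half: "1/2 \<in> {-1/2..1/2::real}" by simp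
  have "(\<lambda>K. \<Sum>j<K. gauss_pair j (1/2)) \<longlonglongrightarrow> (\<Sum>j. gauss_pair j (1/2))"
    using tendsto_uniform_limitI[OF gauss_pair_uniform half] .
  hence lim1: "(\<lambda>K. \<Sum>j<Suc K. gauss_pair j (1/2)) \<longlonglongrightarrow> (\<Sum>j. gauss_pair j (1/2))"
    by (rule LIMSEQ_Suc)
  \<comment> \<open>The pair j contributes j + 1/2 and j - 1/2, so each half-integer point is met
    twice except the outermost, whose value tends to 0.\<close>
  have eq1: "(\<Sum>j<Suc K. gauss_pair j (1/2)) = 2 * (\<Sum>j<K. gauss (real j + 1/2)) + gauss (real K + 1/2)" for K
  proof (induction K)
    case (Suc K)
    have "gauss (1/2 - real (Suc K)) = gauss (real K + 1/2)"
      using gauss_uminus[of "real K + 1/2"] by (simp add: algebra_simps del: gauss_uminus)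
    thus ?case using Suc by (simp add: gauss_pair_def algebra_simps)
  qed (simp add: gauss_pair_def)
  have "summable (\<lambda>j. gauss (real j + 1/2))"
  proof (rule summable_comparison_test')
    show "summable (\<lambda>j. exp (- (T / 4 * real j)))" using T by (intro summable_exp_neg) auto
    show "norm (gauss (real j + 1/2)) \<le> exp (- (T / 4 * real j))" if "j \<ge> 1" for j
      using gauss_le[OF that, of "real j + 1/2"] by (simp add: gauss_def)
  qed
  note sums = summable_LIMSEQ[OF this] summable_LIMSEQ_zero[OF this]
  have "(\<lambda>K. 2 * (\<Sum>j<K. gauss (real j + 1/2)) + gauss (real K + 1/2)) \<longlonglongrightarrow> 2 * (\<Sum>j. gauss (real j + 1/2)) + 0"
    by (intro tendsto_intros sums)
  from LIMSEQ_unique[OF lim1[unfolded eq1] this]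
  have lhs: "(\<Sum>j. gauss_pair j (1/2)) = 2 * (\<Sum>j. gauss (real j + 1/2))" by simp
  have "(\<lambda>K. \<Sum>m<K. gauss_cos_term m (1/2)) \<longlonglongrightarrow> (\<Sum>m. gauss_cos_term m (1/2))"
    using tendsto_uniform_limitI[OF gauss_cos_term_uniform half] .
  hence lim2: "(\<lambda>K. \<Sum>m<Suc K. gauss_cos_term m (1/2)) \<longlonglongrightarrow> (\<Sum>m. gauss_cos_term m (1/2))"
    by (rule LIMSEQ_Suc)
  define q where "q = exp (- (pi\<^sup>2 / T))"
  have q: "norm q < 1" using T by (simp add: q_def)
  have gauss_coeff_q: "gauss_coeff m = sqrt (pi / T) * q ^ m\<^sup>2" for m
    by (simp add: gauss_coeff_def q_def exp_of_nat_mult[symmetric] mult.commute)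
  have eq2: "(\<Sum>m<Suc K. gauss_cos_term m (1/2)) = sqrt (pi / T) * (1 + 2 * (\<Sum>s=1..K. (-1) ^ s * q ^ s\<^sup>2))" for K
  proof -
    have "gauss_cos_term (Suc m) (1/2) = sqrt (pi / T) * (2 * ((-1) ^ Suc m * q ^ (Suc m)\<^sup>2))" for m
      using cos_npi[of "Suc m"] by (simp add: gauss_cos_term_def gauss_coeff_q mult_ac del: of_nat_Suc power_Suc)
    moreover have "gauss_cos_term 0 (1/2) = sqrt (pi / T)" by (simp add: gauss_cos_term_def gauss_coeff_q)
    ultimately show ?thesis
      by (simp only: sum.lessThan_Suc_shift One_nat_def sum.atLeast1_atMost_eq sum_distrib_left distrib_left)
  qed
  have "(\<lambda>K. sqrt (pi / T) * (1 + 2 * (\<Sum>s=1..K. (-1) ^ s * q ^ s\<^sup>2))) \<longlonglongrightarrow> sqrt (pi / T) * theta4 q"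
    by (intro tendsto_mult tendsto_const theta4_sums q)
  from LIMSEQ_unique[OF lim2[unfolded eq2] this]
  have "(\<Sum>m. gauss_cos_term m (1/2)) = sqrt (pi / T) * theta4 q" .
  with lhs gauss_pair_eq_gauss_cos_term[OF half] show ?thesis by (simp add: q_def gauss_def)
qed

end

section \<open>The dual series and its continuation to the half-plane\<close>

text \<open>Jacobi's theta function with index 2 at argument 0, divided by 2 q^(1/4): (j + 1/2)^2 =
  1/4 + j(j + 1). What remains is a power series with value 1 at 0.\<close>

definition oblong_series :: "'a \<Rightarrow> 'a::{real_normed_field,banach}" where
  "oblong_series q = (\<Sum>j. q ^ (j * Suc j))"

lemma summable_oblong:
  fixes q :: "'a::{real_normed_field,banach}"
  assumes q: "norm q < 1"
  shows "summable (\<lambda>j. norm (q ^ (j * Suc j)))"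
proof (rule summable_comparison_test')
  show "summable (\<lambda>j. norm q ^ j)" using q by (simp add: summable_geometric)
  have "norm (q ^ (j * Suc j)) \<le> norm q ^ j" for j
    unfolding norm_power using q by (intro power_decreasing) auto
  thus "norm (norm (q ^ (j * Suc j))) \<le> norm q ^ j" for j
    by (simp only: real_norm_def abs_norm_cancel)
qed

lemma oblong_series_sums:
  fixes q :: "'a::{real_normed_field,banach}"
  shows "norm q < 1 \<Longrightarrow> (\<lambda>j. q ^ (j * Suc j)) sums oblong_series q"
  unfolding oblong_series_def by (intro summable_sums summable_norm_cancel[OF summable_oblong])

lemma oblong_series_near_1:
  fixes q :: "'a::{real_normed_field,banach}"
  assumes q: "norm q < 1"
  shows "norm (oblong_series q - 1) \<le> (norm q)\<^sup>2 / (1 - norm q)"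
proof -
  have "(\<lambda>j. q ^ (Suc j * Suc (Suc j))) sums (oblong_series q - 1)"
    using sums_Suc_iff[of "\<lambda>j. q ^ (j * Suc j)" "oblong_series q - 1"] oblong_series_sums[OF q]
    by simp
  moreover have "(\<lambda>j. (norm q)\<^sup>2 * norm q ^ j) sums ((norm q)\<^sup>2 * (1 / (1 - norm q)))"
    using q by (intro sums_mult geometric_sums) auto
  moreover have "norm (q ^ (Suc j * Suc (Suc j))) \<le> (norm q)\<^sup>2 * norm q ^ j" for j
    unfolding norm_power power_add[symmetric] using q by (intro power_decreasing) auto
  ultimately show ?thesis
    using norm_suminf_le[of "\<lambda>j. q ^ (Suc j * Suc (Suc j))" "\<lambda>j. (norm q)\<^sup>2 * norm q ^ j"]
    by (auto simp: sums_iff)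
qed

lemma oblong_series_holomorphic: "(oblong_series :: complex \<Rightarrow> complex) holomorphic_on ball 0 1"
proof (rule power_series_holomorphic)
  let ?a = "\<lambda>n. if n \<in> range (\<lambda>j. j * Suc j) then 1 else 0 :: complex"
  fix w :: complex assume w: "w \<in> ball 0 1"
  \<comment> \<open>Because the exponents increase strictly, the lacunary series is a power series
    with coefficients 0 and 1.\<close>
  have "strict_mono (\<lambda>j. j * Suc j)"
    by (intro strict_monoI_Suc) auto
  hence "(\<lambda>j. ?a (j * Suc j) * (w - 0) ^ (j * Suc j)) sums oblong_series w
      \<longleftrightarrow> (\<lambda>n. ?a n * (w - 0) ^ n) sums oblong_series w"
    by (intro sums_mono_reindex) auto
  moreover have "(\<lambda>j. ?a (j * Suc j) * (w - 0) ^ (j * Suc j)) sums oblong_series w"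
    using oblong_series_sums[of w] w by (auto simp: dist_norm)
  ultimately show "(\<lambda>n. ?a n * (w - 0) ^ n) sums oblong_series w" by simp
qed

lemma overgf_holomorphic: "(overgf :: complex \<Rightarrow> complex) holomorphic_on ball 0 1"
proof (rule power_series_holomorphic)
  fix w :: complex assume w: "w \<in> ball 0 1"
  show "(\<lambda>n. of_nat (pbar n) * (w - 0) ^ n) sums overgf w"
    using overgf_sums[of w] w by (auto simp: dist_norm)
qed

lemma overgf_of_real: "0 \<le> \<rho> \<Longrightarrow> \<rho> < 1 \<Longrightarrow> overgf (complex_of_real \<rho>) = of_real (overgf \<rho>)"
  using sums_of_real[OF overgf_sums[of \<rho>], where 'a = complex] overgf_sums[of "complex_of_real \<rho>"]
  by (simp add: sums_iff)

lemma oblong_series_of_real: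
  "0 \<le> \<rho> \<Longrightarrow> \<rho> < 1 \<Longrightarrow> oblong_series (complex_of_real \<rho>) = of_real (oblong_series \<rho>)"
  using sums_of_real[OF oblong_series_sums[of \<rho>], where 'a = complex]
    oblong_series_sums[of "complex_of_real \<rho>"]
  by (simp add: sums_iff del: mult_Suc_right)

text \<open>The transformation with T = pi^2/t, multiplied by \<open>overgf\<close>; by Gauss'
  identity the theta series on the left disappears.\<close>

lemma overgf_transform_real:
  fixes t :: real
  assumes t: "t > 0"
  shows "overgf (exp (- t)) * (2 * exp (- (pi\<^sup>2 / (4 * t))) * oblong_series (exp (- (pi\<^sup>2 / t)))) = sqrt (t / pi)"
proof -
  define T where "T = pi\<^sup>2 / t"
  have T: "T > 0" using t by (simp add: T_def)
  have "pi\<^sup>2 / T = t" "sqrt (pi / T) = sqrt (t / pi)"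
    using t by (auto simp: T_def power2_eq_square)
  hence "sqrt (t / pi) * theta4 (exp (- t)) = 2 * (\<Sum>j. exp (- (T * (real j + 1/2)\<^sup>2)))"
    using theta4_transform_real[OF T] by simp
  also have "(\<lambda>j. exp (- (T * (real j + 1/2)\<^sup>2))) = (\<lambda>j. exp (- (T / 4)) * exp (- T) ^ (j * Suc j))"
  proof
    fix j :: nat
    have "exp (- (T / 4)) * exp (- T) ^ (j * Suc j) = exp (- (T / 4) + real (j * Suc j) * (- T))"
      by (simp only: exp_of_nat_mult exp_add)
    also have "- (T / 4) + real (j * Suc j) * (- T) = - (T * (real j + 1/2)\<^sup>2)"
      by (simp add: power2_eq_square algebra_simps)
    finally show "exp (- (T * (real j + 1/2)\<^sup>2)) = exp (- (T / 4)) * exp (- T) ^ (j * Suc j)" ..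
  qed
  also have "(\<Sum>j. exp (- (T / 4)) * exp (- T) ^ (j * Suc j)) = exp (- (T / 4)) * oblong_series (exp (- T))"
    using T sums_mult[OF oblong_series_sums[of "exp (- T)"], of "exp (- (T / 4))"] by (simp add: sums_iff)
  finally have *: "sqrt (t / pi) * theta4 (exp (- t)) = 2 * (exp (- (T / 4)) * oblong_series (exp (- T)))" .
  have "overgf (exp (- t)) * theta4 (exp (- t)) = 1"
    using t by (intro overgf_theta4) auto
  hence "sqrt (t / pi) = overgf (exp (- t)) * (sqrt (t / pi) * theta4 (exp (- t)))" by simp
  also have "\<dots> = overgf (exp (- t)) * (2 * exp (- (T / 4)) * oblong_series (exp (- T)))"
    unfolding * by simp
  finally show ?thesis by (simp add: T_def mult.commute)
qed

text \<open>Analytic continuation from the reals above 1. The product form keeps the left side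
  holomorphic on the whole half-plane, wherever zeros of \<open>oblong_series\<close> may lie; that
  the latter is nonzero is shown only on the chord, in \<open>overgf_major_arc\<close>.\<close>

theorem overgf_transform:
  fixes t :: complex
  assumes t: "Re t > 0"
  shows "overgf (exp (- t)) * (2 * exp (- (of_real (pi\<^sup>2) / (4 * t))) * oblong_series (exp (- (of_real (pi\<^sup>2) / t))))
           = csqrt (t / of_real pi)"
proof -
  let ?H = "{t. Re t > 0}"
  let ?f = "\<lambda>t. overgf (exp (- t)) * (2 * exp (- (of_real (pi\<^sup>2) / (4 * t))) *
              oblong_series (exp (- (of_real (pi\<^sup>2) / t)))) - csqrt (t / of_real pi)"
  have inv: "Re (of_real (pi\<^sup>2) / t) > 0" if "Re t > 0" for t
  proof -
    have "Re (of_real (pi\<^sup>2) / t) = pi\<^sup>2 * Re t / ((Re t)\<^sup>2 + (Im t)\<^sup>2)"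
      by (simp add: Re_divide)
    also have "\<dots> > 0" using that by (intro divide_pos_pos mult_pos_pos add_pos_nonneg) auto
    finally show ?thesis .
  qed
  have "?f t = 0"
  proof (rule analytic_continuation[of ?f ?H "of_real ` {1<..}" 2])
    show "?f holomorphic_on ?H"
    proof (intro holomorphic_intros)
      show "(\<lambda>t. overgf (exp (- t))) holomorphic_on ?H"
        by (rule holomorphic_on_compose_gen[unfolded o_def, OF _ overgf_holomorphic])
           (auto intro!: holomorphic_intros)
      show "(\<lambda>t. oblong_series (exp (- (of_real (pi\<^sup>2) / t)))) holomorphic_on ?H"
        by (rule holomorphic_on_compose_gen[unfolded o_def, OF _ oblong_series_holomorphic])
           (use inv in \<open>auto intro!: holomorphic_intros\<close>)
    qed (auto simp: complex_nonpos_Reals_iff divide_le_0_iff not_le[THEN iffD2, OF pi_gt_zero])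
    show "open ?H" by (rule open_halfspace_Re_gt)
    show "connected ?H" by (intro convex_connected convex_halfspace_Re_gt)
    show "complex_of_real ` {1<..} \<subseteq> ?H" by auto
    show "2 islimpt complex_of_real ` {1<..}"
    proof (rule islimpt_approachable[THEN iffD2], intro allI impI)
      fix e :: real assume "e > 0"
      thus "\<exists>x'\<in>complex_of_real ` {1<..}. x' \<noteq> 2 \<and> dist x' 2 < e"
        by (intro bexI[of _ "of_real (2 + e / 2)"] imageI) (auto simp: dist_norm)
    qed
    show "?f z = 0" if z: "z \<in> complex_of_real ` {1<..}" for z
    proof -
      obtain s where s: "z = complex_of_real s" "s > 1" using z by auto
      have "csqrt (z / of_real pi) = of_real (sqrt (s / pi))"
        using s by (simp flip: of_real_divide)
      also have "\<dots> = of_real (overgf (exp (- s)) *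
          (2 * exp (- (pi\<^sup>2 / (4 * s))) * oblong_series (exp (- (pi\<^sup>2 / s)))))"
        using overgf_transform_real[of s] s by simp
      finally show ?thesis
        using s by (simp add: overgf_of_real[symmetric] oblong_series_of_real[symmetric] exp_of_real[symmetric])
    qed
  qed (use t in auto)
  thus ?thesis by simp
qed

section \<open>The circle method\<close>

lemma has_integral_cis_int:
  "((\<lambda>y. cis (of_int k * y)) has_integral (if k = 0 then 2 * of_real pi else 0)) {-pi..pi}"
proof (cases "k = 0")
  case True
  thus ?thesis using has_integral_const_real[of "1::complex" "-pi" pi] by (simp add: scaleR_conv_of_real)
next
  case False
  have "((\<lambda>y. cis (of_int k * y)) has_integral
      cis (of_int k * pi) / (\<i> * of_int k) - cis (of_int k * (- pi)) / (\<i> * of_int k)) {-pi..pi}"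
  proof (rule fundamental_theorem_of_calculus)
    fix y :: real
    have "((\<lambda>y. exp (\<i> * of_int k * y) / (\<i> * of_int k)) has_field_derivative exp (\<i> * of_int k * y)) (at (of_real y))"
      using False by (auto intro!: derivative_eq_intros)
    from has_vector_derivative_real_field[OF this]
    show "((\<lambda>y. cis (of_int k * y) / (\<i> * of_int k)) has_vector_derivative cis (of_int k * y)) (at y within {-pi..pi})"
      by (simp add: cis_conv_exp mult_ac)
  qed auto
  moreover have "cis (of_int k * (- pi)) = cis (of_int k * pi)"
  proof -
    have "sin (of_int k * pi) = 0" by (simp add: sin_zero_iff_int2)
    thus ?thesis by (simp add: complex_eq_iff)
  qed
  ultimately show ?thesis using False by simp
qed

text \<open>Cauchy's formula on the circle |q| = exp (-a). Uniform convergence permits integration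
  term by term, and only the term m = n has frequency 0; partial sums with K > n therefore all have
  the same integral.\<close>

theorem pbar_integral:
  fixes a :: real
  assumes a: "a > 0"
  shows "((\<lambda>y. overgf (exp (- Complex a y)) * exp (of_nat n * Complex a y)) has_integral
            of_real (2 * pi * real (pbar n))) {-pi..pi}"
proof -
  let ?F = "\<lambda>y. overgf (exp (- Complex a y)) * exp (of_nat n * Complex a y)"
  define f where "f = (\<lambda>m y. of_nat (pbar m) * exp (- Complex a y) ^ m * exp (of_nat n * Complex a y))"
  have q: "norm (exp (- Complex a y)) < 1" for y using a by simp
  have f_eq: "f m y = of_real (real (pbar m) * exp ((real n - real m) * a)) * cis (of_int (int n - int m) * y)" for m y
  proof -
    have "f m y = of_nat (pbar m) * exp ((of_nat n - of_nat m) * Complex a y)"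
      by (simp add: f_def exp_of_nat_mult[symmetric] exp_add[symmetric] algebra_simps)
    also have "(of_nat n - of_nat m) * Complex a y = of_real ((real n - real m) * a) + \<i> * of_real ((real n - real m) * y)"
      by (simp add: complex_eq_iff)
    also have "exp \<dots> = of_real (exp ((real n - real m) * a)) * cis ((real n - real m) * y)"
      by (simp only: exp_add exp_of_real cis_conv_exp)
    finally show ?thesis by simp
  qed
  have sums: "(\<lambda>m. f m y) sums ?F y" for y
    unfolding f_def by (intro sums_mult2 overgf_sums q)
  have bound: "norm (f m y) \<le> exp (real n * a) * (real (pbar m) * exp (- a) ^ m)" for m y
    by (simp add: f_eq norm_mult exp_of_nat_mult[symmetric] exp_add[symmetric] algebra_simps
        flip: of_real_mult)
  have unif: "uniform_limit {-pi..pi} (\<lambda>K y. \<Sum>m<K. f m y) (\<lambda>y. \<Sum>m. f m y) sequentially"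
    using a by (intro Weierstrass_m_test[OF bound] summable_mult summable_pbar_real) auto
  have int: "((\<lambda>y. \<Sum>m<K. f m y) has_integral (\<Sum>m<K. of_real (real (pbar m) * exp ((real n - real m) * a)) *
      (if int n - int m = 0 then 2 * of_real pi else 0))) {-pi..pi}" for K
    unfolding f_eq by (intro has_integral_sum has_integral_mult_right has_integral_cis_int) auto
  have sum_eq: "(\<Sum>m<K. of_real (real (pbar m) * exp ((real n - real m) * a)) *
      (if int n - int m = 0 then 2 * of_real pi else 0)) = (of_real (2 * pi * real (pbar n)) :: complex)"
    if "K > n" for K
  proof -
    have "(\<Sum>m<K. of_real (real (pbar m) * exp ((real n - real m) * a)) *
      (if int n - int m = 0 then 2 * of_real pi else 0)) =
      (\<Sum>m<K. if m = n then (of_real (2 * pi * real (pbar n)) :: complex) else 0)"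
      by (intro sum.cong) (auto simp: mult_ac)
    also have "\<dots> = of_real (2 * pi * real (pbar n))" using that by simp
    finally show ?thesis .
  qed
  have cont: "continuous_on {-pi..pi} (\<lambda>y. \<Sum>m<K. f m y)" for K
    unfolding f_eq by (intro continuous_intros)
  obtain I J where IJ: "\<And>K. ((\<lambda>y. \<Sum>m<K. f m y) has_integral I K) {-pi..pi}"
    "((\<lambda>y. \<Sum>m. f m y) has_integral J) {-pi..pi}" "I \<longlonglongrightarrow> J"
    by (rule uniform_limit_integral[OF unif cont]) auto
  have "I K = of_real (2 * pi * real (pbar n))" if "K > n" for K
    using IJ(1)[of K] int[of K] sum_eq[OF that] has_integral_unique by metis
  hence "I \<longlonglongrightarrow> of_real (2 * pi * real (pbar n))"
    by (intro tendsto_eventually) (use eventually_gt_at_top[of n] in eventually_elim, simp)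
  with IJ(3) have "J = of_real (2 * pi * real (pbar n))" by (rule LIMSEQ_unique)
  moreover have "(\<Sum>m. f m y) = ?F y" for y using sums[of y] by (simp add: sums_iff)
  ultimately show ?thesis using IJ(2) by simp
qed

section \<open>The main term on chord and arc\<close>

text \<open>On the arc \<open>|t| = \<pi>/(2\<surd>n)\<close> the exponent \<open>\<pi>\<^sup>2/(4t) + n t\<close> is \<open>\<mu> cos \<phi>\<close>.\<close>

definition overmain :: "nat \<Rightarrow> complex \<Rightarrow> complex" where
  "overmain n t = csqrt (t / of_real pi) / 2 * exp (of_real (pi\<^sup>2) / (4 * t) + of_nat n * t)"

lemma overmain_holomorphic: "overmain n holomorphic_on {t. Re t > 0}"
  unfolding overmain_def[abs_def]
  by (intro holomorphic_intros)
     (auto simp: complex_nonpos_Reals_iff divide_le_0_iff not_le[THEN iffD2, OF pi_gt_zero])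

lemma cos_pos_of_abs_le: "\<bar>\<phi>\<bar> \<le> pi / 3 \<Longrightarrow> cos \<phi> > 0"
  using pi_gt_zero by (intro cos_gt_zero_pi; linarith)

text \<open>The right half-plane is convex, so \<open>overmain n\<close> has a primitive there.
  Chord and arc both run from x exp (-i pi/3) to x exp (i pi/3), as cos (pi/3) = 1/2.\<close>

lemma overmain_chord_eq_arc:
  assumes n: "n > 0" and x: "x > 0"
  shows "integral {- (sqrt 3 / 2 * x)..sqrt 3 / 2 * x} (\<lambda>y. overmain n (Complex (x / 2) y)) =
         integral {-pi/3..pi/3} (\<lambda>\<phi>. overmain n (of_real x * cis \<phi>) * of_real x * cis \<phi>)"
proof -
  let ?H = "{t. Re t > 0}" and ?c = "sqrt 3 / 2 * x"
  obtain G where G: "\<And>t. t \<in> ?H \<Longrightarrow> (G has_field_derivative overmain n t) (at t within ?H)"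
    using holomorphic_convex_primitive'[of ?H "overmain n"] overmain_holomorphic
      convex_halfspace_Re_gt open_halfspace_Re_gt by metis
  have lin: "(overmain n has_contour_integral G (Complex (x/2) ?c) - G (Complex (x/2) (- ?c)))
      (linepath (Complex (x/2) (- ?c)) (Complex (x/2) ?c))"
  proof -
    have "path_image (linepath (Complex (x/2) (- ?c)) (Complex (x/2) ?c)) \<subseteq> ?H"
      unfolding path_image_linepath using x
      by (intro closed_segment_subset convex_halfspace_Re_gt) auto
    from contour_integral_primitive[OF G valid_path_linepath this] show ?thesis by simp
  qed
  have arc: "(overmain n has_contour_integral G (Complex (x/2) ?c) - G (Complex (x/2) (- ?c)))
      (part_circlepath 0 x (-pi/3) (pi/3))"
  proof -
    have "path_image (part_circlepath 0 x (-pi/3) (pi/3)) \<subseteq> ?H"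
      using x by (auto simp: path_image_part_circlepath' closed_segment_eq_real_ivl intro!: mult_pos_pos cos_pos_of_abs_le)
    from contour_integral_primitive[OF G valid_path_part_circlepath this]
    have "(overmain n has_contour_integral G (of_real x * exp (\<i> * of_real (pi/3))) -
         G (of_real x * exp (\<i> * of_real (-pi/3)))) (part_circlepath 0 x (-pi/3) (pi/3))"
      by (simp add: )
    moreover have "of_real x * exp (\<i> * of_real (pi/3)) = Complex (x/2) ?c"
      "of_real x * exp (\<i> * of_real (-pi/3)) = Complex (x/2) (- ?c)"
      unfolding cis_conv_exp[symmetric] by (simp_all add: complex_eq_iff cos_60 sin_60)
    ultimately show ?thesis by simp
  qed
  have "\<i> * integral {- ?c..?c} (\<lambda>y. overmain n (Complex (x / 2) y)) =
      contour_integral (linepath (Complex (x/2) (- ?c)) (Complex (x/2) ?c)) (overmain n)"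
    using x by (subst contour_integral_linepath_same_Re[of _ "x / 2" _ "- ?c" ?c]) auto
  also have "\<dots> = contour_integral (part_circlepath 0 x (-pi/3) (pi/3)) (overmain n)"
    using lin arc by (simp add: contour_integral_unique)
  also have "\<dots> = integral {-pi/3..pi/3} (\<lambda>\<phi>. \<i> * (overmain n (of_real x * cis \<phi>) * of_real x * cis \<phi>))"
    by (subst contour_integral_part_circlepath_eq) (simp_all add: mult_ac)
  also have "\<dots> = \<i> * integral {-pi/3..pi/3} (\<lambda>\<phi>. overmain n (of_real x * cis \<phi>) * of_real x * cis \<phi>)"
    by (rule integral_mult_right)
  finally show ?thesis by simp
qed

text \<open>The substitution \<open>\<sigma> = 2 sin (\<phi>/2)\<close> turns the arc integral into a Gaussian one.\<close>

lemma overmain_arc_integral: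
  assumes n: "n > 0"
  defines "\<mu> \<equiv> pi * sqrt (real n)" and "x \<equiv> pi / (2 * sqrt (real n))"
  shows "Re (integral {-pi/3..pi/3} (\<lambda>\<phi>. overmain n (of_real x * cis \<phi>) * of_real x * cis \<phi>))
      = sqrt (x / pi) / 2 * x * exp \<mu> * integral {-1..1} (\<lambda>\<sigma>. (1 - \<sigma>\<^sup>2) * exp (- (\<mu> / 2 * \<sigma>\<^sup>2)))"
proof -
  have s: "sqrt (real n) > 0" using n by simp
  have x: "x > 0" using s by (simp add: x_def)
  have nx: "real n * x = \<mu> / 2"
    using s by (simp add: x_def \<mu>_def field_simps)
  have px: "pi\<^sup>2 / (4 * x) = \<mu> / 2"
    using s by (simp add: x_def \<mu>_def field_simps power2_eq_square)
  let ?K = "sqrt (x / pi) / 2 * x"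
  have eq: "overmain n (of_real x * cis \<phi>) * of_real x * cis \<phi> =
      of_real (?K * exp (\<mu> * cos \<phi>)) * cis (3 * \<phi> / 2)" if "\<phi> \<in> {-pi/3..pi/3}" for \<phi>
  proof -
    have "csqrt (of_real x * cis \<phi> / of_real pi) = of_real (sqrt (x / pi)) * cis (\<phi> / 2)"
    proof (rule csqrt_unique)
      show "(of_real (sqrt (x / pi)) * cis (\<phi> / 2))\<^sup>2 = of_real x * cis \<phi> / of_real pi"
      proof -
        have "(of_real (sqrt (x / pi)) * cis (\<phi> / 2))\<^sup>2 = of_real ((sqrt (x / pi))\<^sup>2) * cis \<phi>"
          by (subst power_mult_distrib, subst Complex.DeMoivre) (simp only: of_real_power, simp)
        moreover have "(sqrt (x / pi))\<^sup>2 = x / pi"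
          using x by (intro real_sqrt_pow2) auto
        ultimately show ?thesis by (simp only: of_real_divide) simp
      qed
      \<comment> \<open>A positive real part singles out the principal branch of the square
        root.\<close>
      have "cos (\<phi> / 2) > 0" using that by (intro cos_pos_of_abs_le) (simp, linarith)
      hence "0 < sqrt (x / pi) * cos (\<phi> / 2)"
        using x by (intro mult_pos_pos real_sqrt_gt_zero divide_pos_pos) auto
      hence "0 < Re (of_real (sqrt (x / pi)) * cis (\<phi> / 2))" by simp
      thus "0 < Re (of_real (sqrt (x / pi)) * cis (\<phi> / 2)) \<or>
          Re (of_real (sqrt (x / pi)) * cis (\<phi> / 2)) = 0 \<and>
          0 \<le> Im (of_real (sqrt (x / pi)) * cis (\<phi> / 2))"
        by (rule disjI1)
    qed
    moreover have "of_real (pi\<^sup>2) / (4 * (of_real x * cis \<phi>)) + of_nat n * (of_real x * cis \<phi>) = of_real (\<mu> * cos \<phi>)"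
    proof -
      have "of_real (pi\<^sup>2) / (4 * (of_real x * cis \<phi>)) = of_real (pi\<^sup>2 / (4 * x)) * cis (- \<phi>)"
        by (simp only: cis_inverse[symmetric] divide_inverse of_real_mult of_real_inverse
              inverse_mult_distrib of_real_numeral mult_ac)
      also have "\<dots> = of_real (\<mu> / 2) * cis (- \<phi>)" by (simp only: px)
      finally have 1: "of_real (pi\<^sup>2) / (4 * (of_real x * cis \<phi>)) = of_real (\<mu> / 2) * cis (- \<phi>)" .
      have "of_nat n * (of_real x * cis \<phi>) = of_real (real n * x) * cis \<phi>" by simp
      also have "\<dots> = of_real (\<mu> / 2) * cis \<phi>" by (simp only: nx)
      finally have 2: "of_nat n * (of_real x * cis \<phi>) = of_real (\<mu> / 2) * cis \<phi>" .
      show ?thesis unfolding 1 2 by (simp add: complex_eq_iff)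
    qed
    ultimately have "overmain n (of_real x * cis \<phi>) * of_real x * cis \<phi> =
      of_real (sqrt (x / pi)) * cis (\<phi> / 2) / 2 * of_real (exp (\<mu> * cos \<phi>)) * of_real x * cis \<phi>"
      by (simp only: overmain_def exp_of_real)
    also have "\<dots> = of_real (?K * exp (\<mu> * cos \<phi>)) * (cis (\<phi> / 2) * cis \<phi>)"
      by simp
    \<comment> \<open>One half of the angle comes from the square root, one whole from dt = i t
      d\<phi>.\<close>
    also have "cis (\<phi> / 2) * cis \<phi> = cis (3 * \<phi> / 2)"
      by (simp add: cis_mult)
    finally show ?thesis .
  qed
  let ?h = "\<lambda>\<phi>. of_real (?K * exp (\<mu> * cos \<phi>)) * cis (3 * \<phi> / 2)"
  have "?h integrable_on {-pi/3..pi/3}"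
    by (intro integrable_continuous_interval continuous_intros) auto
  hence "integral {-pi/3..pi/3} (Re \<circ> ?h) = Re (integral {-pi/3..pi/3} ?h)"
    by (rule integral_linear[OF _ bounded_linear_Re])
  moreover have "Re \<circ> ?h = (\<lambda>\<phi>. ?K * exp (\<mu> * cos \<phi>) * cos (3 * \<phi> / 2))"
    by (rule ext) simp
  moreover have "integral {-pi/3..pi/3} (\<lambda>\<phi>. overmain n (of_real x * cis \<phi>) * of_real x * cis \<phi>)
      = integral {-pi/3..pi/3} ?h"
    by (intro integral_cong eq)
  ultimately have "Re (integral {-pi/3..pi/3} (\<lambda>\<phi>. overmain n (of_real x * cis \<phi>) * of_real x * cis \<phi>))
      = integral {-pi/3..pi/3} (\<lambda>\<phi>. ?K * exp (\<mu> * cos \<phi>) * cos (3 * \<phi> / 2))"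
    by (simp only:)
  also have "\<dots> = integral {-1..1} (\<lambda>\<sigma>. ?K * exp \<mu> * ((1 - \<sigma>\<^sup>2) * exp (- (\<mu> / 2 * \<sigma>\<^sup>2))))"
  proof -
    let ?f = "\<lambda>\<sigma>. ?K * exp \<mu> * ((1 - \<sigma>\<^sup>2) * exp (- (\<mu> / 2 * \<sigma>\<^sup>2)))" and ?g = "\<lambda>\<phi>. 2 * sin (\<phi> / 2)"
    have "((\<lambda>\<phi>. cos (\<phi> / 2) *\<^sub>R ?f (?g \<phi>)) has_integral (integral {?g (-pi/3)..?g (pi/3)} ?f)) {-pi/3..pi/3}"
    proof (rule has_integral_substitution[where c = "-2" and d = 2])
      show "continuous_on {-2..2} ?f" by (intro continuous_intros)
      show "(?g has_field_derivative cos (\<phi> / 2)) (at \<phi> within {-pi/3..pi/3})" for \<phi>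
        by (auto intro!: derivative_eq_intros)
    qed (use sin_ge_minus_one sin_le_one in \<open>auto simp: sin_30\<close>)
    moreover have "?g (-pi/3) = -1" "?g (pi/3) = 1"
      by (simp_all add: sin_30)
    moreover have "cos (\<phi> / 2) *\<^sub>R ?f (?g \<phi>) = ?K * exp (\<mu> * cos \<phi>) * cos (3 * \<phi> / 2)" for \<phi>
    proof -
      have c1: "cos \<phi> = 1 - 2 * (sin (\<phi> / 2))\<^sup>2"
        using cos_double_sin[of "\<phi> / 2"] by simp
      \<comment> \<open>The triple-angle formula supplies the derivative cos (\<phi>/2) of the
        substitution and leaves the polynomial factor 1 - \<sigma>^2.\<close>
      have "cos (3 * \<phi> / 2) = 4 * cos (\<phi> / 2) ^ 3 - 3 * cos (\<phi> / 2)"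
        using cos_treble_cos[of "\<phi> / 2"] by simp
      also have "\<dots> = cos (\<phi> / 2) * (1 - (2 * sin (\<phi> / 2))\<^sup>2)"
        unfolding power_mult_distrib sin_squared_eq
        by (simp add: power3_eq_cube power2_eq_square right_diff_distrib)
      finally have c3: "cos (3 * \<phi> / 2) = cos (\<phi> / 2) * (1 - (2 * sin (\<phi> / 2))\<^sup>2)" .
      have "exp (\<mu> * cos \<phi>) = exp \<mu> * exp (- (\<mu> / 2 * (2 * sin (\<phi> / 2))\<^sup>2))"
        unfolding c1 exp_add[symmetric] by (simp add: algebra_simps power_mult_distrib)
      thus ?thesis unfolding c3 by (simp add: mult_ac)
    qed
    ultimately have "((\<lambda>\<phi>. ?K * exp (\<mu> * cos \<phi>) * cos (3 * \<phi> / 2)) has_integral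
        integral {-1..1} ?f) {-pi/3..pi/3}" by (simp only:)
    thus ?thesis by (rule integral_unique)
  qed
  also have "\<dots> = ?K * exp \<mu> * integral {-1..1} (\<lambda>\<sigma>. (1 - \<sigma>\<^sup>2) * exp (- (\<mu> / 2 * \<sigma>\<^sup>2)))"
    by (rule integral_mult_right)
  finally show ?thesis .
qed

section \<open>The truncated Gaussian integral\<close>

text \<open>Beyond 1 the integrand is at most \<sigma> exp (-T \<sigma>^2), which has an elementary
  primitive; each of the two tails is at most exp (-T) / (2T).\<close>

lemma gauss_unit_integral_bounds:
  fixes T :: real
  assumes T: "T > 0"
  defines "G \<equiv> integral {-1..1} (\<lambda>\<sigma>. exp (- (T * \<sigma>\<^sup>2)))"
  shows "G \<le> sqrt (pi / T)" "sqrt (pi / T) \<le> G + exp (- T) / T"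
proof -
  let ?g = "\<lambda>\<sigma>. exp (- (T * \<sigma>\<^sup>2))"
  have int: "?g integrable_on {a..b}" for a b
    by (intro integrable_continuous_interval continuous_intros)
  have lim: "(\<lambda>K. integral {-(real K + 1/2)..real K + 1/2} ?g) \<longlonglongrightarrow> sqrt (pi / T)"
    using gauss_integral_limit[OF T, of 0] by (simp add: gauss_def[OF T] gauss_coeff_def[OF T])
  have tail: "0 \<le> integral {1..A} ?g" "integral {1..A} ?g \<le> exp (- T) / (2 * T)" if "A \<ge> 1" for A
  proof -
    show "0 \<le> integral {1..A} ?g" by (intro integral_nonneg int) auto
    have 1: "((\<lambda>\<sigma>. \<sigma> * ?g \<sigma>) has_integral (- ?g A / (2 * T) - (- ?g 1 / (2 * T)))) {1..A}"
      using that T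
      by (intro fundamental_theorem_of_calculus)
         (auto simp flip: has_real_derivative_iff_has_vector_derivative intro!: derivative_eq_intros)
    have "integral {1..A} ?g \<le> - ?g A / (2 * T) - (- ?g 1 / (2 * T))"
      by (rule has_integral_le[OF integrable_integral[OF int] 1])
         (use mult_right_mono[of 1] in force)
    also have "\<dots> \<le> exp (- T) / (2 * T)" using T by simp
    finally show "integral {1..A} ?g \<le> exp (- T) / (2 * T)" .
  qed
  have split: "integral {-A..A} ?g = G + 2 * integral {1..A} ?g" if "A \<ge> 1" for A
  proof -
    have "integral {-A..-1} ?g = integral {1..A} ?g"
      using Henstock_Kurzweil_Integration.integral_reflect_real[of A 1 ?g] by simp
    moreover have "integral {-A..A} ?g = integral {-A..-1} ?g + integral {-1..A} ?g"
      using that by (intro Henstock_Kurzweil_Integration.integral_combine[symmetric] int) auto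
    moreover have "integral {-1..A} ?g = integral {-1..1} ?g + integral {1..A} ?g"
      using that by (intro Henstock_Kurzweil_Integration.integral_combine[symmetric] int) auto
    ultimately show ?thesis by (simp add: G_def)
  qed
  have ev: "\<forall>\<^sub>F K::nat in sequentially. real K + 1/2 \<ge> 1"
    using eventually_ge_at_top[of 1] by eventually_elim simp
  show "G \<le> sqrt (pi / T)"
  proof (rule tendsto_lowerbound[OF lim])
    show "\<forall>\<^sub>F K in sequentially. G \<le> integral {-(real K + 1/2)..real K + 1/2} ?g"
      using ev
    proof eventually_elim
      case (elim K)
      show ?case using split[OF elim] tail(1)[OF elim] by linarith
    qed
  qed simp
  have "\<forall>\<^sub>F K in sequentially. integral {-(real K + 1/2)..real K + 1/2} ?g \<le> G + exp (- T) / T"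
    using ev
  proof eventually_elim
    case (elim K)
    have "2 * (exp (- T) / (2 * T)) = exp (- T) / T" by simp
    thus ?case using split[OF elim] tail(2)[OF elim] by linarith
  qed
  thus "sqrt (pi / T) \<le> G + exp (- T) / T"
    by (rule tendsto_upperbound[OF lim]) simp
qed

text \<open>Integration by parts in disguise: (1 - 2 T \<sigma>^2) exp (-T \<sigma>^2) is the
  derivative of \<sigma> exp (-T \<sigma>^2), and 1 - \<sigma>^2 is 1/(2T) times 1 - 2 T \<sigma>^2
  plus the constant 1 - 1/(2T). With T = \<mu>/2 this constant is the factor 1 - 1/\<mu> of the
  asymptotics.\<close>

lemma overmain_gauss_bound:
  fixes T :: real
  assumes T: "T \<ge> 1 / 2"
  shows "\<bar>integral {-1..1} (\<lambda>\<sigma>. (1 - \<sigma>\<^sup>2) * exp (- (T * \<sigma>\<^sup>2))) - sqrt (pi / T) * (1 - 1 / (2 * T))\<bar> \<le> exp (- T) / T"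
proof -
  let ?g = "\<lambda>\<sigma>. exp (- (T * \<sigma>\<^sup>2))"
  define G where "G = integral {-1..1} ?g"
  have T0: "T > 0" using T by simp
  have 1: "((\<lambda>\<sigma>. (1 - 2 * T * \<sigma>\<^sup>2) * ?g \<sigma>) has_integral (1 * ?g 1 - (-1) * ?g (-1))) {-1..1}"
    by (intro fundamental_theorem_of_calculus)
       (auto simp flip: has_real_derivative_iff_has_vector_derivative
             simp: power2_eq_square algebra_simps intro!: derivative_eq_intros)
  have 2: "(?g has_integral G) {-1..1}"
    unfolding G_def by (intro integrable_integral integrable_continuous_interval continuous_intros)
  have "((\<lambda>\<sigma>. 1 / (2 * T) * ((1 - 2 * T * \<sigma>\<^sup>2) * ?g \<sigma>) + (1 - 1 / (2 * T)) * ?g \<sigma>) has_integral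
     (1 / (2 * T) * (1 * ?g 1 - (-1) * ?g (-1)) + (1 - 1 / (2 * T)) * G)) {-1..1}"
    by (intro has_integral_add has_integral_mult_right 1 2)
  moreover have "1 / (2 * T) * ((1 - 2 * T * \<sigma>\<^sup>2) * ?g \<sigma>) + (1 - 1 / (2 * T)) * ?g \<sigma> = (1 - \<sigma>\<^sup>2) * ?g \<sigma>" for \<sigma>
    using T0 by (simp add: field_simps)
  ultimately have eq: "integral {-1..1} (\<lambda>\<sigma>. (1 - \<sigma>\<^sup>2) * ?g \<sigma>) = exp (- T) / T + (1 - 1 / (2 * T)) * G"
    by (simp add: integral_unique)
  \<comment> \<open>T \<ge> 1/2 makes \<open>w\<close> nonnegative. The boundary term and the
    truncation error then enter with opposite signs, so the total is no larger than either
    bound.\<close>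
  define w where "w = 1 - 1 / (2 * T)"
  have w: "0 \<le> w" "w \<le> 1" using T by (auto simp: w_def field_simps)
  define d where "d = sqrt (pi / T) - G"
  have d: "0 \<le> d" "d \<le> exp (- T) / T"
    using gauss_unit_integral_bounds[OF T0] by (auto simp: G_def d_def)
  have "0 \<le> w * d" "w * d \<le> 1 * (exp (- T) / T)"
    using w d mult_mono[of w 1 d "exp (- T) / T"] by auto
  moreover have "integral {-1..1} (\<lambda>\<sigma>. (1 - \<sigma>\<^sup>2) * ?g \<sigma>) - sqrt (pi / T) * w = exp (- T) / T - w * d"
    unfolding eq w_def[symmetric] d_def by (simp add: algebra_simps)
  ultimately show ?thesis unfolding w_def[symmetric] by linarith
qed

section \<open>Minor and major arcs\<close>

text \<open>At positive arguments the dual series is at least its first term 1, so dropping it from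
  the transformation gives an upper bound.\<close>

lemma overgf_real_le:
  fixes t :: real
  assumes t: "t > 0"
  shows "overgf (exp (- t)) \<le> sqrt (t / pi) / 2 * exp (pi\<^sup>2 / (4 * t))"
proof -
  define q where "q = exp (- (pi\<^sup>2 / t))"
  have q: "0 < q" "q < 1" using t by (auto simp: q_def)
  have "1 \<le> oblong_series q"
    using sum_le_suminf[of "\<lambda>j. q ^ (j * Suc j)" "{0}"] oblong_series_sums[of q] q
    by (auto simp: sums_iff)
  moreover have "overgf (exp (- t)) \<ge> 0"
    using overprod_real_le_overgf[of "exp (- t)" 0] t by (simp add: overprod_def)
  ultimately have "overgf (exp (- t)) * (2 * exp (- (pi\<^sup>2 / (4 * t))) * 1)
      \<le> overgf (exp (- t)) * (2 * exp (- (pi\<^sup>2 / (4 * t))) * oblong_series q)"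
    by (intro mult_left_mono) auto
  also have "\<dots> = sqrt (t / pi)" using overgf_transform_real[OF t] by (simp add: q_def)
  finally have "overgf (exp (- t)) * 2 * exp (- (pi\<^sup>2 / (4 * t))) * exp (pi\<^sup>2 / (4 * t))
      \<le> sqrt (t / pi) * exp (pi\<^sup>2 / (4 * t))"
    by (intro mult_right_mono) (auto simp: mult.assoc)
  also have "overgf (exp (- t)) * 2 * exp (- (pi\<^sup>2 / (4 * t))) * exp (pi\<^sup>2 / (4 * t)) = 2 * overgf (exp (- t))"
    by (simp add: mult.assoc exp_add[symmetric])
  finally show ?thesis by simp
qed

text \<open>For small a the quotient of 1 - exp (-a) and |1 - q| is close to a / |a + iy|, which is
  1/2 at |y| = sqrt 3 a; the constant 51/100 leaves room for a up to 1/50. The exact tool is |1 -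
  q|^2 = (1 - \<rho>)^2 + 2 \<rho> (1 - cos y).\<close>

lemma cmod_one_minus_exp_ge:
  fixes a y :: real
  assumes a: "0 < a" "a \<le> 1 / 50" and y: "sqrt 3 * a \<le> \<bar>y\<bar>" "\<bar>y\<bar> \<le> pi"
  shows "1 - exp (- a) \<le> (51/100) * cmod (1 - exp (- Complex a y))"
proof -
  define \<rho> where "\<rho> = exp (- a)"
  define z where "z = sqrt 3 * a / 2"
  have \<rho>: "1 - a \<le> \<rho>" "\<rho> < 1" "0 < \<rho>"
    using a exp_ge_add_one_self[of "- a"] by (auto simp: \<rho>_def)
  have z: "0 < z" "z\<^sup>2 = 3 / 4 * a\<^sup>2"
    using a by (auto simp: z_def power_mult_distrib power_divide)
  have z2: "z\<^sup>2 \<le> 3 / 4 * (1 / 50)\<^sup>2"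
    unfolding z using a by (intro mult_left_mono power_mono) auto
  have "\<bar>sin z - z\<bar> \<le> z ^ 3 / 6"
    using Maclaurin_sin_bound[of z 3] z(1) by (simp add: numeral_3_eq_3 sin_coeff_def fact_numeral)
  hence "z - z ^ 3 / 6 \<le> sin z" by linarith
  hence "z * (1 - z\<^sup>2 / 6) \<le> sin z"
    by (simp add: power3_eq_cube power2_eq_square right_diff_distrib)
  also have "sin z \<le> sin (\<bar>y\<bar> / 2)"
    using y z by (intro sin_monotone_2pi_le) (auto simp: z_def)
  finally have "(z * (1 - z\<^sup>2 / 6))\<^sup>2 \<le> (sin (\<bar>y\<bar> / 2))\<^sup>2"
    using z z2 by (intro power_mono mult_nonneg_nonneg) (auto simp: power2_eq_square)
  moreover have "(sin (\<bar>y\<bar> / 2))\<^sup>2 = (1 - cos y) / 2"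
    using cos_double_sin[of "\<bar>y\<bar> / 2"] by (cases "y \<ge> 0") auto
  moreover have "3 / 4 * a\<^sup>2 * (999/1000) \<le> (z * (1 - z\<^sup>2 / 6))\<^sup>2"
  proof -
    have "(9999/10000) \<le> 1 - z\<^sup>2 / 6" using z2 by (simp add: power2_eq_square)
    hence "(9999/10000)\<^sup>2 \<le> (1 - z\<^sup>2 / 6)\<^sup>2" by (intro power_mono) auto
    moreover have "(999/1000) \<le> (9999/10000 :: real)\<^sup>2" by (simp add: power2_eq_square)
    ultimately have "(999/1000) \<le> (1 - z\<^sup>2 / 6)\<^sup>2" by linarith
    thus ?thesis unfolding power_mult_distrib z by (intro mult_left_mono) auto
  qed
  ultimately have c: "3 / 2 * a\<^sup>2 * (999/1000) \<le> 1 - cos y" by simp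
  have "exp (- Complex a y) = of_real \<rho> * cis (- y)"
    by (simp add: complex_eq_iff Re_exp Im_exp \<rho>_def)
  hence "(cmod (1 - exp (- Complex a y)))\<^sup>2 = (1 - \<rho> * cos y)\<^sup>2 + (\<rho> * sin y)\<^sup>2"
    by (simp add: cmod_power2)
  also have "\<dots> = (1 - \<rho>)\<^sup>2 + 2 * \<rho> * (1 - cos y)"
    unfolding power_mult_distrib sin_squared_eq by (simp add: power2_eq_square algebra_simps)
  finally have m: "(cmod (1 - exp (- Complex a y)))\<^sup>2 = (1 - \<rho>)\<^sup>2 + 2 * \<rho> * (1 - cos y)" .
  \<comment> \<open>Ideally the factor is 3. As 0.51^2 = 0.2601 and 0.2601 (1 + 2.9) > 1, the value
    2.9 suffices.\<close>
  have "(29/10) * a\<^sup>2 \<le> 2 * (98/100) * (3 / 2 * a\<^sup>2 * (999/1000))" by simp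
  also have "\<dots> \<le> 2 * \<rho> * (1 - cos y)"
    using \<rho> a by (intro mult_mono c) auto
  finally have 1: "(29/10) * a\<^sup>2 \<le> 2 * \<rho> * (1 - cos y)" .
  have le: "(1 - \<rho>)\<^sup>2 \<le> a\<^sup>2" using \<rho> by (intro power_mono) auto
  have "(1 - \<rho>)\<^sup>2 \<le> (2601/10000) * ((1 - \<rho>)\<^sup>2 + 2 * \<rho> * (1 - cos y))"
  proof -
    have "W \<le> 2601 / 10000 * (W + D)" if "W \<le> V" "29 / 10 * V \<le> D" "0 \<le> W" for W V D :: real
    proof -
      have "29 / 10 * W \<le> D" using that by linarith
      thus ?thesis using that(3) by simp
    qed
    from this[OF le 1] show ?thesis by simp
  qed
  also have "\<dots> = ((51/100) * cmod (1 - exp (- Complex a y)))\<^sup>2"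
    unfolding power_mult_distrib m by (simp add: power2_eq_square)
  finally show ?thesis unfolding \<rho>_def[symmetric] by (rule power2_le_imp_le) simp
qed

text \<open>The factor 98/100 is 2 (1 - 51/100). It multiplies \<rho>/(1 - \<rho>) = 1/(1 - \<rho>)
  - 1, which is at least 1/a - 1 because 1 - \<rho> \<le> a.\<close>

lemma overgf_minor_arc:
  assumes a: "0 < a" "a \<le> 1 / 50" and y: "sqrt 3 * a \<le> \<bar>y\<bar>" "\<bar>y\<bar> \<le> pi"
  shows "cmod (overgf (exp (- Complex a y)) * exp (of_nat n * Complex a y)) \<le>
           sqrt (a / pi) / 2 * exp (pi\<^sup>2 / (4 * a) + real n * a - (98/100) * (1 / a - 1))"
proof -
  define \<rho> where "\<rho> = exp (- a)"
  have \<rho>: "1 - a \<le> \<rho>" "\<rho> < 1" "0 < \<rho>"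
    using a exp_ge_add_one_self[of "- a"] by (auto simp: \<rho>_def)
  let ?q = "exp (- Complex a y)"
  have q: "cmod ?q = \<rho>" by (simp add: \<rho>_def)
  have "1 / cmod (1 - ?q) \<le> (51/100) / (1 - \<rho>)"
  proof -
    have "0 < cmod (1 - ?q)"
      using cmod_one_minus_exp_ge[OF a y] \<rho>(2) unfolding \<rho>_def[symmetric] by linarith
    thus ?thesis
      using cmod_one_minus_exp_ge[OF a y] \<rho> unfolding \<rho>_def[symmetric] by (simp add: field_simps)
  qed
  hence "2 * \<rho> * (1 / (1 - \<rho>) - (51/100) / (1 - \<rho>)) \<le> 2 * \<rho> * (1 / (1 - \<rho>) - 1 / cmod (1 - ?q))"
    using \<rho> by (intro mult_left_mono diff_left_mono) auto
  moreover have "2 * \<rho> * (1 / (1 - \<rho>) - (51/100) / (1 - \<rho>)) = (98/100) * (1 / (1 - \<rho>) - 1)"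
  proof -
    define h where "h = 1 / (1 - \<rho>)"
    have h: "\<rho> * h = h - 1" using \<rho> by (simp add: h_def field_simps)
    have "2 * \<rho> * (h - (51/100) * h) = (98/100) * (\<rho> * h)" by (simp add: algebra_simps)
    thus ?thesis unfolding h by (simp add: h_def)
  qed
  moreover have "1 / a \<le> 1 / (1 - \<rho>)"
    using \<rho> by (intro divide_left_mono) auto
  ultimately have S: "- 2 * \<rho> * (1 / (1 - \<rho>) - 1 / cmod (1 - ?q)) \<le> - ((98/100) * (1 / a - 1))"
    by simp
  have "cmod (overgf ?q) \<le> overgf \<rho> * exp (- 2 * \<rho> * (1 / (1 - \<rho>) - 1 / cmod (1 - ?q)))"
    using norm_overgf_le[of ?q] q \<rho> by simp
  also have "\<dots> \<le> sqrt (a / pi) / 2 * exp (pi\<^sup>2 / (4 * a)) * exp (- ((98/100) * (1 / a - 1)))"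
    using overgf_real_le[of a] a S unfolding \<rho>_def[symmetric] by (intro mult_mono) auto
  finally have "cmod (overgf ?q) * exp (real n * a) \<le>
      sqrt (a / pi) / 2 * exp (pi\<^sup>2 / (4 * a)) * exp (- ((98/100) * (1 / a - 1))) * exp (real n * a)"
    by (intro mult_right_mono) auto
  also have "\<dots> = sqrt (a / pi) / 2 * exp (pi\<^sup>2 / (4 * a) + real n * a - (98/100) * (1 / a - 1))"
  proof -
    have "exp A * exp (- C) * exp B = exp (A + B - C)" for A B C :: real
      by (simp add: exp_add[symmetric] algebra_simps)
    thus ?thesis by (simp only: mult.assoc)
  qed
  finally show ?thesis by (simp add: norm_mult)
qed

text \<open>On the chord |t| \<le> 2a, hence Re (pi^2/t) = pi^2 a / |t|^2 lies between m and 4m with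
  m = pi^2/(4a). So |Q| \<le> exp (-m), and the dual series differs from 1 by O(Q^2). The main term
  is at most exp (m + m/4) / 2, which leaves exp (-3m/4). The hypothesis \<open>na\<close> says that
  a is half the saddle point, and then m = \<mu>.\<close>

lemma overgf_major_arc:
  assumes n: "n > 0" and y: "\<bar>y\<bar> \<le> sqrt 3 * a" and a: "a > 0" "2 * a \<le> 1"
  assumes na: "real n * a = pi\<^sup>2 / (16 * a)"
  shows "cmod (overgf (exp (- Complex a y)) * exp (of_nat n * Complex a y) - overmain n (Complex a y))
           \<le> 2 * exp (- (3 * pi\<^sup>2 / (16 * a)))"
proof -
  define t where "t = Complex a y"
  define m where "m = pi\<^sup>2 / (4 * a)"
  define Q where "Q = exp (- (of_real (pi\<^sup>2) / t))"
  define ob where "ob = oblong_series Q"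
  have t: "Re t > 0" "t \<noteq> 0" using a by (auto simp: t_def complex_eq_iff)
  have y2: "y\<^sup>2 \<le> 3 * a\<^sup>2"
    using power_mono[OF y, of 2] by (simp add: power_mult_distrib)
  have Re_inv: "Re (of_real (pi\<^sup>2) / t) = pi\<^sup>2 * a / (a\<^sup>2 + y\<^sup>2)"
    by (simp add: t_def Re_divide)
  have "pi\<^sup>2 * a / (4 * a\<^sup>2) \<le> pi\<^sup>2 * a / (a\<^sup>2 + y\<^sup>2)"
    using a y2 by (intro divide_left_mono mult_pos_pos add_pos_nonneg) auto
  hence Re_ge: "m \<le> Re (of_real (pi\<^sup>2) / t)"
    using a unfolding Re_inv by (simp add: m_def power2_eq_square)
  have "pi\<^sup>2 * a / (a\<^sup>2 + y\<^sup>2) \<le> pi\<^sup>2 * a / a\<^sup>2"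
    using a by (intro divide_left_mono mult_pos_pos add_pos_nonneg) auto
  hence Re_le: "Re (of_real (pi\<^sup>2) / t) \<le> 4 * m"
    using a unfolding Re_inv by (simp add: m_def power2_eq_square)
  have "m \<ge> 4"
  proof -
    have "4 * (4 * a) \<le> 9" using a by simp
    also have "9 \<le> pi\<^sup>2" using power_mono[of 3 pi 2] pi_gt3 by simp
    finally show ?thesis using a by (simp add: m_def field_simps)
  qed
  have "exp (- m) \<le> 1 / 2"
  proof -
    have "2 \<le> exp m" using exp_ge_add_one_self[of m] \<open>m \<ge> 4\<close> by linarith
    thus ?thesis by (simp add: exp_minus field_simps)
  qed
  have Qm: "cmod Q \<le> exp (- m)" unfolding Q_def using Re_ge by simp
  hence Q: "cmod Q \<le> 1 / 2" using \<open>exp (- m) \<le> 1 / 2\<close> by linarith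
  have "cmod (ob - 1) \<le> (cmod Q)\<^sup>2 / (1 - cmod Q)"
    unfolding ob_def using Q by (intro oblong_series_near_1) auto
  also have "\<dots> \<le> (cmod Q)\<^sup>2 / (1 / 2)"
    using Q by (intro divide_left_mono) auto
  finally have ob1: "cmod (ob - 1) \<le> 2 * (cmod Q)\<^sup>2" by simp
  have "(cmod Q)\<^sup>2 \<le> (1 / 2)\<^sup>2" using Q by (intro power_mono) auto
  hence "cmod (ob - 1) \<le> 1 / 2" using ob1 by (simp add: power2_eq_square)
  hence ob2: "cmod ob \<ge> 1 / 2"
    using norm_triangle_ineq2[of 1 "1 - ob"] by (simp add: norm_minus_commute)
  hence ob0: "ob \<noteq> 0" by auto
  have tr: "overgf (exp (- t)) * (2 * exp (- (of_real (pi\<^sup>2) / (4 * t))) * ob) = csqrt (t / of_real pi)"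
    using overgf_transform[OF t(1)] by (simp add: ob_def Q_def)
  have "overmain n t = overgf (exp (- t)) * ob * (exp (- (of_real (pi\<^sup>2) / (4 * t))) *
      exp (of_real (pi\<^sup>2) / (4 * t))) * exp (of_nat n * t)"
    unfolding overmain_def tr[symmetric] exp_add by (simp add: mult_ac)
  also have "exp (- (of_real (pi\<^sup>2) / (4 * t))) * exp (of_real (pi\<^sup>2) / (4 * t)) = (1::complex)"
    by (simp add: exp_add[symmetric])
  finally have om: "overmain n t = overgf (exp (- t)) * exp (of_nat n * t) * ob" by (simp add: mult_ac)
  hence "overgf (exp (- t)) * exp (of_nat n * t) - overmain n t = overmain n t * (1 - ob) / ob"
    using ob0 by (simp add: field_simps)
  hence "cmod (overgf (exp (- t)) * exp (of_nat n * t) - overmain n t)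
      = cmod (overmain n t) * (cmod (ob - 1) / cmod ob)"
    by (simp only: norm_mult norm_divide norm_minus_commute[of 1 ob] times_divide_eq_right)
  also have "\<dots> \<le> (exp (m + m / 4) / 2) * (2 * (exp (- m))\<^sup>2 / (1 / 2))"
  proof (intro mult_mono frac_le)
    have "cmod (t / of_real pi) \<le> 1"
    proof -
      have "(cmod t)\<^sup>2 \<le> (2 * a)\<^sup>2" using y2 by (simp add: t_def cmod_power2 power_mult_distrib)
      hence "cmod t \<le> 2 * a" by (rule power2_le_imp_le) (use a in simp)
      hence "cmod t \<le> pi" using a pi_gt3 by linarith
      thus ?thesis by (simp add: norm_divide)
    qed
    hence "cmod (csqrt (t / of_real pi)) \<le> 1" by (simp add: norm_csqrt)
    moreover have "Re (of_real (pi\<^sup>2) / (4 * t) + of_nat n * t) \<le> m + m / 4"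
    proof -
      have "of_real (pi\<^sup>2) / (4 * t) = (of_real (pi\<^sup>2) / t) / of_real 4" by simp
      hence "Re (of_real (pi\<^sup>2) / (4 * t)) = Re (of_real (pi\<^sup>2) / t) / 4" by (simp only: Re_divide_of_real)
      moreover have "Re (of_nat n * t) = m / 4" using na by (simp add: t_def m_def)
      ultimately show ?thesis using Re_le by simp
    qed
    ultimately show "cmod (overmain n t) \<le> exp (m + m / 4) / 2"
      unfolding overmain_def norm_mult norm_divide norm_exp_eq_Re
      using mult_mono[of "cmod (csqrt (t / of_real pi)) / 2" "1 / 2" "exp (Re (of_real (pi\<^sup>2) / (4 * t) + of_nat n * t))" "exp (m + m / 4)"]
      by simp
    show "cmod (ob - 1) \<le> 2 * (exp (- m))\<^sup>2"
      by (rule order_trans[OF ob1 mult_left_mono[OF power_mono[OF Qm norm_ge_zero]]]) simp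
  qed (use ob2 in auto)
  also have "\<dots> = 2 * exp (m + m / 4 - 2 * m)"
    by (simp add: power2_eq_square exp_add[symmetric] exp_minus exp_diff field_simps)
  also have "m + m / 4 - 2 * m = - (3 * pi\<^sup>2 / (16 * a))" by (simp add: m_def)
  finally show ?thesis by (simp add: t_def)
qed

section \<open>The asymptotic estimate with explicit error\<close>

text \<open>After multiplication by s^8 the left side is 3 s^(19/2) exp (0.98 - 0.462 s). The
  tangent of ln at 74 linearises the power; its slope 9.5/74 is below 0.462, so the worst case is s
  = 74, where the exponent is still below 8 < ln (20000/3).\<close>

lemma decay_bound:
  fixes s :: real
  assumes s: "s \<ge> 74"
  shows "3 * (s\<^sup>2 / sqrt s) * exp (49 / 50 - (462 / 1000) * s) \<le> 20000 / s ^ 8"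
proof -
  have "ln (s / 74) \<le> s / 74 - 1" using s by (intro ln_le_minus_one) auto
  hence "ln s - ln 74 \<le> s / 74 - 1" using s by (simp add: ln_div)
  hence "74 * (ln s - ln 74) \<le> 74 * (s / 74 - 1)" by (intro mult_left_mono) auto
  hence ln_s: "74 * ln s \<le> 74 * ln 74 + s - 74" by (simp add: right_diff_distrib)
  have "ln (74::real) \<le> 432292 / 100000"
  proof -
    \<comment> \<open>74 is near 2^6, so ln 74 \<le> 6 ln 2 + 10/64 is sharp enough.\<close>
    have "ln (74 / 2 ^ 6 :: real) = ln 74 - ln (2 ^ 6)" by (rule ln_divide_pos) auto
    moreover have "ln ((2::real) ^ 6) = 6 * ln 2" by (simp only: ln_realpow)
    moreover have "ln (74 / 2 ^ 6 :: real) \<le> 74 / 2 ^ 6 - 1" by (intro ln_le_minus_one) auto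
    ultimately show ?thesis using ln2_le_25_over_36 by simp
  qed
  hence "100000 * ln (74::real) \<le> 432292" by simp
  hence "9500 * ln s + 980 - 462 * s \<le> 8000"
    using s ln_s by linarith
  hence "(19 / 2) * ln s + 49 / 50 - (462 / 1000) * s \<le> 8" by simp
  also have "8 \<le> 12 * ln (2::real)" using ln2_ge_two_thirds by simp
  also have "\<dots> = ln (2 ^ 12)" by (simp only: ln_realpow)
  also have "\<dots> \<le> ln (20000 / 3)" by simp
  finally have "exp ((19 / 2) * ln s + 49 / 50 - (462 / 1000) * s) \<le> exp (ln (20000 / 3))"
    by (simp only: exp_le_cancel_iff)
  hence 1: "exp ((19 / 2) * ln s + (49 / 50 - (462 / 1000) * s)) \<le> 20000 / 3"
    by (simp add: algebra_simps)
  have "exp ((19 / 2) * ln s) = s ^ 8 * (s\<^sup>2 / sqrt s)"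
  proof -
    have "(19 / 2) * ln s = real 10 * ln s - ln s / 2" by simp
    also have "ln s / 2 = ln (sqrt s)" using s by (simp add: ln_sqrt)
    finally have "exp ((19 / 2) * ln s) = exp (real 10 * ln s) / exp (ln (sqrt s))"
      by (simp only: exp_diff)
    also have "exp (real 10 * ln s) = s ^ 10"
      using s by (simp only: exp_of_nat_mult exp_ln)
    also have "exp (ln (sqrt s)) = sqrt s" using s by simp
    finally show ?thesis by (simp flip: power_add)
  qed
  with 1 have "s ^ 8 * (s\<^sup>2 / sqrt s) * exp (49 / 50 - (462 / 1000) * s) \<le> 20000 / 3"
    by (simp only: exp_add)
  thus ?thesis using s by (simp add: field_simps)
qed

text \<open>The interval from -pi to pi is cut at c and -c, with c = sqrt 3 a: the middle part is
  the chord, compared with \<open>overmain\<close>, and \<open>B\<close> bounds the integrand on the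
  two outer parts.\<close>

lemma pbar_circle_estimate:
  assumes n: "n \<ge> 5476"
  defines "s \<equiv> sqrt (real n)"
  defines "\<mu> \<equiv> pi * s" and "x \<equiv> pi / (2 * s)"
  defines "B \<equiv> sqrt (x / 2 / pi) / 2 *
             exp (pi\<^sup>2 / (4 * (x / 2)) + real n * (x / 2) - (98/100) * (1 / (x / 2) - 1))"
  shows "\<bar>2 * pi * real (pbar n) - sqrt (x / pi) / 2 * x * exp \<mu> *
             integral {-1..1} (\<lambda>\<sigma>. (1 - \<sigma>\<^sup>2) * exp (- (\<mu> / 2 * \<sigma>\<^sup>2)))\<bar>
           \<le> 2 * pi * B + 4 * exp (- (3 / 4 * \<mu>))"
proof -
  define a where "a = x / 2"
  define c where "c = sqrt 3 * a"
  let ?F = "\<lambda>y. overgf (exp (- Complex a y)) * exp (of_nat n * Complex a y)"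
  let ?M = "\<lambda>y. overmain n (Complex a y)"
  have s: "s \<ge> 74" unfolding s_def using n by (intro real_le_rsqrt) simp
  have ss: "s * s = real n" by (simp add: s_def)
  have x: "x > 0" using s by (simp add: x_def)
  have xs: "a = pi / (4 * s)" by (simp add: a_def x_def)
  have a: "a > 0" "a \<le> 1 / 50"
  proof -
    have "pi * 50 \<le> 4 * s" using s pi_approx by simp
    thus "a \<le> 1 / 50" using s by (simp add: xs field_simps)
  qed (use x in \<open>simp add: a_def\<close>)
  have "sqrt 3 \<le> 2" by (intro real_le_lsqrt) auto
  hence "c \<le> 2 * (1 / 50)"
    unfolding c_def using a by (intro mult_mono) auto
  moreover have "c > 0" using a by (simp add: c_def)
  ultimately have c: "c > 0" "c \<le> 1 / 2" "c \<le> pi"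
    using pi_gt3 by linarith+
  have I: "(?F has_integral of_real (2 * pi * real (pbar n))) {-pi..pi}"
    by (rule pbar_integral) (use a in auto)
  have sub: "?F integrable_on {u..v}" if "-pi \<le> u" "v \<le> pi" for u v
    by (rule integrable_on_subinterval[OF has_integral_integrable[OF I]]) (use that in auto)
  have "integral {-pi..pi} ?F = integral {-pi..-c} ?F + integral {-c..pi} ?F"
    using c by (intro Henstock_Kurzweil_Integration.integral_combine[symmetric] sub) auto
  also have "integral {-c..pi} ?F = integral {-c..c} ?F + integral {c..pi} ?F"
    using c by (intro Henstock_Kurzweil_Integration.integral_combine[symmetric] sub) auto
  finally have split: "of_real (2 * pi * real (pbar n)) =
      integral {-pi..-c} ?F + (integral {-c..c} ?F + integral {c..pi} ?F)"
    using I by (simp add: integral_unique)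
  have minor: "cmod (?F y) \<le> B" if "c \<le> \<bar>y\<bar>" "\<bar>y\<bar> \<le> pi" for y
    using overgf_minor_arc[OF a, of y n] that unfolding c_def B_def a_def by simp
  have B0: "B \<ge> 0" using x by (simp add: B_def)
  have min1: "cmod (integral {-pi..-c} ?F) \<le> B * (pi - c)"
    using c minor has_integral_bound_real[OF B0 finite.emptyI integrable_integral[OF sub[of "-pi" "-c"]]] by auto
  have min2: "cmod (integral {c..pi} ?F) \<le> B * (pi - c)"
    using c minor has_integral_bound_real[OF B0 finite.emptyI integrable_integral[OF sub[of c pi]]] by auto
  have contM: "continuous_on {-c..c} ?M"
    by (rule continuous_on_compose2[OF holomorphic_on_imp_continuous_on[OF overmain_holomorphic]])
       (use a in \<open>auto simp: Complex_eq intro!: continuous_intros\<close>)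
  have intM: "?M integrable_on {-c..c}" by (rule integrable_continuous_interval[OF contM])
  have na: "real n * a = pi\<^sup>2 / (16 * a)"
    using s by (simp add: xs ss[symmetric] power2_eq_square field_simps)
  have "3 * pi\<^sup>2 / (16 * a) = 3 / 4 * \<mu>"
    using s by (simp add: xs \<mu>_def power2_eq_square field_simps)
  hence major: "cmod (?F y - ?M y) \<le> 2 * exp (- (3 / 4 * \<mu>))" if "\<bar>y\<bar> \<le> c" for y
    using overgf_major_arc[of n y a] n a na that by (simp only: c_def)
  have maj: "cmod (integral {-c..c} ?F - integral {-c..c} ?M) \<le> 2 * exp (- (3 / 4 * \<mu>)) * (2 * c)"
  proof -
    have "((\<lambda>y. ?F y - ?M y) has_integral (integral {-c..c} ?F - integral {-c..c} ?M)) {-c..c}"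
      using c by (intro has_integral_diff integrable_integral sub intM) auto
    hence "cmod (integral {-c..c} ?F - integral {-c..c} ?M) \<le>
        2 * exp (- (3 / 4 * \<mu>)) * Henstock_Kurzweil_Integration.content {-c..c}"
    proof (rule has_integral_bound_real[OF _ finite.emptyI, rotated])
      show "cmod (?F y - ?M y) \<le> 2 * exp (- (3 / 4 * \<mu>))" if "y \<in> {-c..c} - {}" for y
        using that by (intro major) auto
    qed simp
    thus ?thesis using c by simp
  qed
  also have "\<dots> \<le> 2 * exp (- (3 / 4 * \<mu>)) * 2" using c by (intro mult_left_mono) auto
  finally have maj': "cmod (integral {-c..c} ?F - integral {-c..c} ?M) \<le> 4 * exp (- (3 / 4 * \<mu>))" by simp
  let ?R = "sqrt (x / pi) / 2 * x * exp \<mu> * integral {-1..1} (\<lambda>\<sigma>. (1 - \<sigma>\<^sup>2) * exp (- (\<mu> / 2 * \<sigma>\<^sup>2)))"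
  have "n > 0" using n by simp
  have "Re (integral {-c..c} ?M) = ?R"
    using overmain_chord_eq_arc[OF \<open>n > 0\<close> x] overmain_arc_integral[OF \<open>n > 0\<close>]
    by (simp add: c_def a_def x_def \<mu>_def s_def)
  hence "2 * pi * real (pbar n) - ?R = Re (of_real (2 * pi * real (pbar n)) - integral {-c..c} ?M)"
    by simp
  also have "\<bar>\<dots>\<bar> \<le> cmod (of_real (2 * pi * real (pbar n)) - integral {-c..c} ?M)"
    by (rule abs_Re_le_cmod)
  also have "of_real (2 * pi * real (pbar n)) - integral {-c..c} ?M =
      integral {-pi..-c} ?F + ((integral {-c..c} ?F - integral {-c..c} ?M) + integral {c..pi} ?F)"
    unfolding split by simp
  also have "cmod \<dots> \<le> cmod (integral {-pi..-c} ?F) +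
      (cmod (integral {-c..c} ?F - integral {-c..c} ?M) + cmod (integral {c..pi} ?F))"
    by (rule order_trans[OF norm_triangle_ineq add_left_mono[OF norm_triangle_ineq]])
  also have "\<dots> \<le> B * (pi - c) + (4 * exp (- (3 / 4 * \<mu>)) + B * (pi - c))"
    by (intro add_mono min1 min2 maj')
  also have "\<dots> \<le> 2 * pi * B + 4 * exp (- (3 / 4 * \<mu>))"
    using B0 c by (simp add: algebra_simps)
  finally show ?thesis .
qed

theorem pbar_asymptotics:
  assumes n: "n \<ge> 5476"
  shows "\<bar>8 * real n * real (pbar n) / exp (pi * sqrt (real n)) - (1 - 1 / (pi * sqrt (real n)))\<bar>
           \<le> 20000 / real n ^ 4"
proof -
  define s where "s = sqrt (real n)"
  define \<mu> where "\<mu> = pi * s"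
  define x where "x = pi / (2 * s)"
  define B where "B = sqrt (x / 2 / pi) / 2 *
             exp (pi\<^sup>2 / (4 * (x / 2)) + real n * (x / 2) - (98/100) * (1 / (x / 2) - 1))"
  define J where "J = integral {-1..1} (\<lambda>\<sigma>. (1 - \<sigma>\<^sup>2) * exp (- (\<mu> / 2 * \<sigma>\<^sup>2)))"
  have s: "s \<ge> 74" unfolding s_def using n by (intro real_le_rsqrt) simp
  have ss: "real n = s\<^sup>2" by (simp add: s_def)
  have \<mu>: "\<mu> \<ge> 1" "\<mu> \<ge> 3 * s" using s pi_gt3 mult_mono[of 3 pi 74 s] mult_right_mono[of 3 pi s] by (auto simp: \<mu>_def)
  have est: "\<bar>2 * pi * real (pbar n) - sqrt (x / pi) / 2 * x * exp \<mu> * J\<bar>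
      \<le> 2 * pi * B + 4 * exp (- (3 / 4 * \<mu>))"
    using pbar_circle_estimate[OF n] by (simp only: s_def \<mu>_def x_def B_def J_def)
  \<comment> \<open>The normalisation that turns 2 pi \<open>pbar n\<close> into 8 n
    \<open>pbar n\<close> / exp \<mu>. By \<open>K\<close> it turns the prefactor of the main term
    into sqrt (\<mu>/(2 pi)), the inverse of the full Gaussian integral.\<close>
  define w where "w = exp (- \<mu>) * (4 * s\<^sup>2 / pi)"
  have w: "w > 0" using s by (simp add: w_def)
  have K: "w * (sqrt (x / pi) / 2 * x * exp \<mu>) = sqrt (\<mu> / (2 * pi))"
  proof -
    have "x / pi = (s / 2) / s\<^sup>2" using s by (simp add: x_def power2_eq_square)
    hence 1: "sqrt (x / pi) = sqrt (s / 2) / s"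
      using s by (simp only: real_sqrt_divide) simp
    have 2: "\<mu> / (2 * pi) = s / 2" by (simp add: \<mu>_def)
    have 3: "w * (k / 2 * x * exp \<mu>) = s * k" for k
    proof -
      have "exp (- \<mu>) * exp \<mu> = 1" by (simp add: exp_add[symmetric])
      hence "w * (k / 2 * x * exp \<mu>) = 4 * s\<^sup>2 / pi * (k / 2 * x)"
        by (simp add: w_def mult_ac)
      also have "\<dots> = s * k" using s by (simp add: x_def power2_eq_square field_simps)
      finally show ?thesis .
    qed
    show ?thesis unfolding 3 1 2 using s by simp
  qed
  have "\<bar>J - sqrt (pi / (\<mu> / 2)) * (1 - 1 / (2 * (\<mu> / 2)))\<bar> \<le> exp (- (\<mu> / 2)) / (\<mu> / 2)"
    unfolding J_def by (rule overmain_gauss_bound) (use \<mu> in auto)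
  hence J: "\<bar>J - sqrt (2 * pi / \<mu>) * (1 - 1 / \<mu>)\<bar> \<le> 2 * exp (- (\<mu> / 2)) / \<mu>"
    by (simp add: mult.commute)
  have sq: "sqrt (\<mu> / (2 * pi)) * sqrt (2 * pi / \<mu>) = 1"
    using \<mu> by (simp flip: real_sqrt_mult)
  have "\<bar>sqrt (\<mu> / (2 * pi)) * J - (1 - 1 / \<mu>)\<bar> = sqrt (\<mu> / (2 * pi)) * \<bar>J - sqrt (2 * pi / \<mu>) * (1 - 1 / \<mu>)\<bar>"
  proof -
    have "sqrt (\<mu> / (2 * pi)) * J - (1 - 1 / \<mu>) = sqrt (\<mu> / (2 * pi)) * (J - sqrt (2 * pi / \<mu>) * (1 - 1 / \<mu>))"
      using sq by (simp add: right_diff_distrib mult.assoc[symmetric])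
    thus ?thesis using \<mu> by (simp add: abs_mult)
  qed
  also have "\<dots> \<le> \<mu> * (2 * exp (- (\<mu> / 2)) / \<mu>)"
  proof (intro mult_mono J)
    have "\<mu> / (2 * pi) \<le> \<mu>\<^sup>2"
    proof -
      have "\<mu> / (2 * pi) \<le> \<mu> / 1" using \<mu> pi_gt3 by (intro divide_left_mono) auto
      also have "\<dots> \<le> \<mu>\<^sup>2" using \<mu> by (simp add: power2_eq_square)
      finally show ?thesis .
    qed
    thus "sqrt (\<mu> / (2 * pi)) \<le> \<mu>" using \<mu> by (intro real_le_lsqrt) auto
  qed (use \<mu> in auto)
  also have "\<dots> = 2 * exp (- (\<mu> / 2))" using \<mu> by simp
  finally have main: "\<bar>sqrt (\<mu> / (2 * pi)) * J - (1 - 1 / \<mu>)\<bar> \<le> 2 * exp (- (\<mu> / 2))" .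
  define E where "E = exp (49 / 50 - (462 / 1000) * s)"
  have "w * (2 * pi * real (pbar n)) - w * (sqrt (x / pi) / 2 * x * exp \<mu> * J)
      = w * (2 * pi * real (pbar n) - sqrt (x / pi) / 2 * x * exp \<mu> * J)"
    by (simp only: right_diff_distrib)
  hence "\<bar>w * (2 * pi * real (pbar n)) - w * (sqrt (x / pi) / 2 * x * exp \<mu> * J)\<bar>
      = w * \<bar>2 * pi * real (pbar n) - sqrt (x / pi) / 2 * x * exp \<mu> * J\<bar>"
    using w by (simp only: abs_mult abs_of_pos)
  also have "\<dots> \<le> w * (2 * pi * B + 4 * exp (- (3 / 4 * \<mu>)))"
    using w by (intro mult_left_mono est) auto
  finally have h1: "\<bar>w * (2 * pi * real (pbar n)) - sqrt (\<mu> / (2 * pi)) * J\<bar>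
      \<le> w * (2 * pi * B) + w * (4 * exp (- (3 / 4 * \<mu>)))"
    unfolding K[symmetric] by (simp only: mult.assoc distrib_left)
  have h2: "w * (2 * pi * real (pbar n)) = 8 * real n * real (pbar n) / exp \<mu>"
    by (simp add: w_def ss exp_minus field_simps)
  have h3: "w * (2 * pi * B) \<le> 2 * (s\<^sup>2 / sqrt s) * E"
  proof -
    have "x / 2 / pi = (1 / (2 * sqrt s))\<^sup>2"
      using s by (simp add: x_def power_divide power_mult_distrib)
    hence 1: "sqrt (x / 2 / pi) = 1 / (2 * sqrt s)" using s by (simp only: real_sqrt_abs) simp
    have "pi\<^sup>2 / (4 * (x / 2)) + real n * (x / 2) - (98/100) * (1 / (x / 2) - 1)
        = pi * s + pi * s / 4 - (98/100) * (4 * s / pi - 1)"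
      using s by (simp add: x_def ss power2_eq_square field_simps)
    hence B: "B = 1 / (4 * sqrt s) * exp (pi * s + pi * s / 4 - (98/100) * (4 * s / pi - 1))"
      unfolding B_def 1 by simp
    have "w * (2 * pi * B) = 2 * (s\<^sup>2 / sqrt s) *
        (exp (- \<mu>) * exp (pi * s + pi * s / 4 - (98/100) * (4 * s / pi - 1)))"
      by (simp add: w_def B field_simps)
    also have "exp (- \<mu>) * exp (pi * s + pi * s / 4 - (98/100) * (4 * s / pi - 1))
        = exp (pi * s / 4 - (98/100) * (4 * s / pi - 1))"
      by (simp add: exp_add[symmetric] \<mu>_def)
    also have "2 * (s\<^sup>2 / sqrt s) * \<dots> \<le> 2 * (s\<^sup>2 / sqrt s) * E"
    proof (intro mult_left_mono)
      \<comment> \<open>The surplus of the line over the saddle point against the saving of the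
        minor arcs, per unit of s = sqrt n.\<close>
      have "pi / 4 - (98/100) * (4 / pi) \<le> - (462 / 1000)"
      proof -
        have "4 / 3.1416 \<le> 4 / pi" using pi_approx by (intro divide_left_mono) auto
        thus ?thesis using pi_approx by simp
      qed
      hence "(pi / 4 - (98/100) * (4 / pi)) * s \<le> - (462 / 1000) * s"
        by (rule mult_right_mono) (use s in simp)
      moreover have "pi * s / 4 - (98/100) * (4 * s / pi - 1) = (pi / 4 - (98/100) * (4 / pi)) * s + 49 / 50"
        by (simp add: left_diff_distrib right_diff_distrib)
      ultimately have "pi * s / 4 - (98/100) * (4 * s / pi - 1) \<le> 49 / 50 - 462 / 1000 * s"
        by linarith
      thus "exp (pi * s / 4 - (98/100) * (4 * s / pi - 1)) \<le> E"
        by (simp only: E_def exp_le_cancel_iff)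
    qed (use s in auto)
    finally show ?thesis .
  qed
  have h4: "w * (4 * exp (- (3 / 4 * \<mu>))) \<le> 1 / 2 * E"
  proof -
    have "exp (- \<mu>) * exp (- (3 / 4 * \<mu>)) = exp (- (7 / 4 * \<mu>))"
      by (simp add: exp_add[symmetric])
    hence "w * (4 * exp (- (3 / 4 * \<mu>))) = 16 * s\<^sup>2 / pi * exp (- (7 / 4 * \<mu>))"
      by (simp add: w_def mult_ac)
    also have "\<dots> \<le> exp s * exp (- (7 / 4 * \<mu>))"
    proof (intro mult_right_mono)
      have "16 * s\<^sup>2 / pi \<le> 16 * s\<^sup>2 / 3" using pi_gt3 by (intro divide_left_mono) auto
      also have "\<dots> \<le> (s / 4) ^ 4"
      proof -
        have "74 * 74 \<le> s * s" using s by (intro mult_mono) auto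
        hence "74 * 74 * (s * s) \<le> s * s * (s * s)" by (intro mult_right_mono) auto
        moreover have "(s / 4) ^ 4 = s * s * (s * s) / 256"
          by (simp add: power_divide power4_eq_xxxx)
        ultimately show ?thesis
          unfolding power2_eq_square using zero_le_square[of s] by linarith
      qed
      also have "\<dots> \<le> exp (s / 4) ^ 4"
        using exp_ge_add_one_self[of "s / 4"] s by (intro power_mono) linarith+
      also have "\<dots> = exp s" by (simp flip: exp_of_nat_mult)
      finally show "16 * s\<^sup>2 / pi \<le> exp s" .
    qed auto
    also have "\<dots> = exp (s - 7 / 4 * \<mu>)" by (simp add: exp_add[symmetric])
    also have "\<dots> \<le> exp ((49 / 50 - (462 / 1000) * s) - 1)" using \<mu> s by simp
    also have "\<dots> \<le> 1 / 2 * E"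
      unfolding exp_diff[of _ 1] E_def[symmetric] using exp_ge_add_one_self[of 1]
      by (simp add: E_def field_simps)
    finally show ?thesis .
  qed
  have h5: "2 * exp (- (\<mu> / 2)) \<le> 1 / 2 * E"
  proof -
    have "exp (- (\<mu> / 2)) \<le> exp ((49 / 50 - (462 / 1000) * s) - 3)" using \<mu> s by simp
    also have "\<dots> = E / exp 3" by (simp only: exp_diff E_def)
    also have "\<dots> \<le> E / 4" using exp_ge_add_one_self[of 3] by (intro divide_left_mono) (auto simp: E_def)
    finally show ?thesis by simp
  qed
  have h6: "E \<le> (s\<^sup>2 / sqrt s) * E"
  proof -
    have "sqrt s \<le> s\<^sup>2" using s by (intro real_le_lsqrt) (auto simp: power_mult[symmetric] intro: order_trans[OF _ power_increasing[of 1 4 s]])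
    hence "1 \<le> s\<^sup>2 / sqrt s" using s by simp
    from mult_right_mono[OF this, of E] show ?thesis by (simp add: E_def)
  qed
  \<comment> \<open>The minor arcs cost 2X, where X is s^2 / sqrt s times \<open>E\<close>; the
    chord and the Gaussian truncation cost half of \<open>E\<close> each, and E \<le> X.\<close>
  have key: "\<bar>b - m\<bar> \<le> 3 * X" if "\<bar>a - q\<bar> \<le> e1 + e2" "a = b" "e1 \<le> 2 * X" "e2 \<le> 1 / 2 * E"
    "d \<le> 1 / 2 * E" "E \<le> X" "\<bar>q - m\<bar> \<le> d" for a b m q e1 e2 d X :: real
  proof -
    have "\<bar>b - m\<bar> \<le> \<bar>a - q\<bar> + \<bar>q - m\<bar>" unfolding \<open>a = b\<close> by linarith
    thus ?thesis using that by linarith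
  qed
  have "\<bar>8 * real n * real (pbar n) / exp \<mu> - (1 - 1 / \<mu>)\<bar> \<le> 3 * (s\<^sup>2 / sqrt s) * E"
    using key[OF h1 h2 h3[unfolded mult.assoc[of 2 "s\<^sup>2 / sqrt s"]] h4 h5 h6 main]
    by (simp only: mult.assoc)
  also have "\<dots> \<le> 20000 / s ^ 8" unfolding E_def by (rule decay_bound[OF s])
  also have "s ^ 8 = real n ^ 4" unfolding ss by (simp flip: power_mult)
  finally show ?thesis by (simp add: \<mu>_def s_def)
qed

section \<open>Second differences\<close>

text \<open>The term n = 0 is a division by zero and hence 0, so the sum is the usual truncated
  logarithmic series. In the tail the denominators are dropped, which leaves a geometric
  series.\<close>

lemma ln_one_plus_bound:
  fixes x :: real
  assumes x: "\<bar>x\<bar> < 1" and K: "K > 0"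
  shows "\<bar>ln (1 + x) - (\<Sum>n<K. - ((- x) ^ n) / real n)\<bar> \<le> \<bar>x\<bar> ^ K / (1 - \<bar>x\<bar>)"
proof -
  have s: "(\<lambda>n. - ((- x) ^ n) / real n) sums ln (1 + x)" using ln_series'[OF x] by simp
  have t: "(\<lambda>n. - ((- x) ^ (n + K)) / real (n + K)) sums (ln (1 + x) - (\<Sum>n<K. - ((- x) ^ n) / real n))"
    using sums_split_initial_segment[OF s, of K] .
  have g: "(\<lambda>n. \<bar>x\<bar> ^ K * \<bar>x\<bar> ^ n) sums (\<bar>x\<bar> ^ K * (1 / (1 - \<bar>x\<bar>)))"
    using x by (intro sums_mult geometric_sums) auto
  have "norm (- ((- x) ^ (n + K)) / real (n + K)) \<le> \<bar>x\<bar> ^ K * \<bar>x\<bar> ^ n" for n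
  proof -
    have "norm (- ((- x) ^ (n + K)) / real (n + K)) = \<bar>x\<bar> ^ (n + K) / real (n + K)"
      by (simp add: power_abs)
    also have "\<dots> \<le> \<bar>x\<bar> ^ (n + K) / 1"
      using K by (intro divide_left_mono) auto
    finally show ?thesis by (simp add: power_add mult.commute)
  qed
  from norm_suminf_le[of "\<lambda>n. - ((- x) ^ (n + K)) / real (n + K)", OF this sums_summable[OF g]]
  show ?thesis using t g by (simp add: sums_iff)
qed

text \<open>Maclaurin's formula with Lagrange remainder; the coefficients are the binomial ones of
  exponent -s. The factor 2 bounds the remaining power of 1 + t at the intermediate point.\<close>

lemma powr_minus_taylor:
  fixes s z :: real
  assumes s: "s \<ge> 0" and z: "\<bar>z\<bar> \<le> 1 / 1000" and sK: "s + real K \<le> 10"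
  shows "\<bar>(1 + z) powr (- s) - (\<Sum>k<K. (\<Prod>i<k. - s - real i) / fact k * z ^ k)\<bar>
           \<le> 2 * ((\<Prod>i<K. s + real i) / fact K) * \<bar>z\<bar> ^ K"
proof -
  define d where "d = (\<lambda>m t. (\<Prod>i<m. - s - real i) * (1 + t) powr (- s - real m))"
  have "\<forall>m t. m < K \<and> \<bar>t\<bar> \<le> \<bar>z\<bar> \<longrightarrow> DERIV (d m) t :> d (Suc m) t"
  proof (intro allI impI)
    fix m t assume t: "m < K \<and> \<bar>t\<bar> \<le> \<bar>z\<bar>"
    hence "1 + t > 0" using z by linarith
    thus "DERIV (d m) t :> d (Suc m) t"
      unfolding d_def by (auto intro!: derivative_eq_intros simp: algebra_simps)
  qed
  from Maclaurin_bi_le[of d, OF refl this]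
  obtain t where t: "\<bar>t\<bar> \<le> \<bar>z\<bar>"
    "d 0 z = (\<Sum>m<K. d m 0 / fact m * z ^ m) + d K t / fact K * z ^ K" by auto
  have "\<bar>(1 + z) powr (- s) - (\<Sum>k<K. (\<Prod>i<k. - s - real i) / fact k * z ^ k)\<bar> = \<bar>d K t / fact K * z ^ K\<bar>"
    using t(2) by (simp add: d_def)
  also have "\<dots> = (\<Prod>i<K. s + real i) / fact K * (1 + t) powr (- s - real K) * \<bar>z\<bar> ^ K"
  proof -
    have "\<bar>\<Prod>i<K. - s - real i\<bar> = (\<Prod>i<K. s + real i)"
      unfolding abs_prod using s by (intro prod.cong) auto
    thus ?thesis by (simp add: d_def abs_mult power_abs)
  qed
  also have "\<dots> \<le> (\<Prod>i<K. s + real i) / fact K * 2 * \<bar>z\<bar> ^ K"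
  proof (intro mult_right_mono mult_left_mono)
    have t1: "999 / 1000 \<le> 1 + t" using t(1) z by linarith
    have "(1 + t) powr (- s - real K) = inverse ((1 + t) powr (s + real K))"
      by (simp add: powr_minus[symmetric])
    also have "\<dots> \<le> inverse (1 / 2)"
    proof (intro le_imp_inverse_le)
      \<comment> \<open>The cap s + K \<le> 10 allows a single constant for all exponents, since
        0.999^10 > 1/2.\<close>
      have "1 / 2 \<le> (999 / 1000 :: real) ^ 10" by (simp add: power_divide)
      also have "\<dots> = (999 / 1000) powr 10" by (simp add: powr_numeral)
      also have "\<dots> \<le> (999 / 1000) powr (s + real K)" using sK by (intro powr_mono') auto
      also have "\<dots> \<le> (1 + t) powr (s + real K)" using t1 s by (intro powr_mono2) auto
      finally show "1 / 2 \<le> (1 + t) powr (s + real K)" .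
    qed simp
    finally show "(1 + t) powr (- s - real K) \<le> 2" by simp
  qed (use s in \<open>auto intro!: divide_nonneg_pos prod_nonneg\<close>)
  finally show ?thesis by (simp add: mult_ac)
qed

text \<open>Orders up to 7 make the remainder of \<open>ln (1 - 1/\<mu>)\<close> of the same order \<open>m\<^sup>-\<^sup>4\<close> as the error of the
  circle method.\<close>

lemma ln_pbar_expansion:
  assumes m: "m \<ge> 5476"
  shows "pbar m > 0"
    and "\<bar>ln (real (pbar m)) - (pi * sqrt (real m) - ln 8 - ln (real m)
           - (\<Sum>k=1..7. (1 / (pi * sqrt (real m))) ^ k / real k))\<bar> \<le> 20200 / real m ^ 4"
proof -
  define s where "s = sqrt (real m)"
  define v where "v = 1 / (pi * s)"
  define X where "X = 8 * real m * real (pbar m) / exp (pi * s)"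
  define e where "e = 1 / real m ^ 4"
  have s: "s \<ge> 74" unfolding s_def using m by (intro real_le_rsqrt) simp
  have ss: "real m = s\<^sup>2" by (simp add: s_def)
  have "3 * 74 \<le> pi * s" using s pi_gt3 by (intro mult_mono) auto
  hence ps: "pi * s \<ge> 222" by simp
  have v: "0 < v" "v \<le> 1 / 200"
  proof -
    show "v > 0" using ps by (simp add: v_def)
    have "v \<le> 1 / 200" unfolding v_def using ps by (intro divide_left_mono) auto
    thus "v \<le> 1 / 200" .
  qed
  have e: "0 < e" "e \<le> 1 / 1000000000"
  proof -
    have "(1000000000 :: real) \<le> 5000 ^ 4" by simp
    also have "\<dots> \<le> real m ^ 4" using m by (intro power_mono) auto
    finally have "e \<le> 1 / 1000000000" unfolding e_def using m by (intro divide_left_mono) auto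
    thus "e \<le> 1 / 1000000000" .
    show "e > 0" using m by (simp add: e_def)
  qed
  have X: "\<bar>X - (1 - v)\<bar> \<le> 20000 * e"
    using pbar_asymptotics[OF m] by (simp add: X_def v_def s_def e_def)
  have X0: "X > 0" using X v e by linarith
  show pos: "pbar m > 0"
  proof (rule ccontr)
    assume "\<not> pbar m > 0"
    hence "X = 0" by (simp add: X_def)
    thus False using X0 by simp
  qed
  \<comment> \<open>The factorisation X = (1 - v)(1 + w) is exact: \<open>v\<close> carries the
    expansion and \<open>w\<close> the whole error of the circle method.\<close>
  define w where "w = (X - (1 - v)) / (1 - v)"
  have w1: "\<bar>w\<bar> \<le> 20110 * e"
  proof -
    have "\<bar>w\<bar> = \<bar>X - (1 - v)\<bar> / (1 - v)" using v by (simp add: w_def)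
    also have "\<dots> \<le> 20000 * e / (199 / 200)"
      using X v e by (intro frac_le) auto
    also have "\<dots> \<le> 20110 * e" using e by simp
    finally show ?thesis .
  qed
  hence w2: "\<bar>w\<bar> \<le> 1 / 1000" using e by linarith
  have "\<bar>ln (1 + w)\<bar> \<le> \<bar>w\<bar> / (1 - \<bar>w\<bar>)"
    using ln_one_plus_bound[of w 1] w2 by simp
  also have "\<dots> \<le> 20110 * e / (999 / 1000)"
    using w1 w2 e by (intro frac_le) auto
  finally have lw: "\<bar>ln (1 + w)\<bar> \<le> 20150 * e" using e by simp
  have "X = (1 - v) * (1 + w)" using v by (simp add: w_def field_simps)
  hence lnX: "ln X = ln (1 - v) + ln (1 + w)"
    using v w2 by (simp add: ln_mult_pos)
  \<comment> \<open>The index 0 is split off because its term is 0 by the convention on division by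
    zero.\<close>
  have "{..<8::nat} = insert 0 {1..7}" by auto
  hence "(\<Sum>n<8. - ((- (- v)) ^ n) / real n) = - (\<Sum>k=1..7. v ^ k / real k)"
    by (simp add: sum_negf)
  hence "\<bar>ln (1 - v) + (\<Sum>k=1..7. v ^ k / real k)\<bar> \<le> v ^ 8 / (1 - v)"
    using ln_one_plus_bound[of "- v" 8] v by simp
  also have "v ^ 8 / (1 - v) \<le> e / (199 / 200)"
  proof (intro frac_le)
    have "v ^ 8 = 1 / (pi ^ 8 * s ^ 8)" by (simp add: v_def power_mult_distrib power_divide)
    also have "\<dots> \<le> 1 / (1 * s ^ 8)"
      using s pi_gt3 by (intro divide_left_mono mult_right_mono one_le_power) auto
    also have "\<dots> = e" by (simp add: e_def ss power_mult[symmetric])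
    finally show "v ^ 8 \<le> e" .
  qed (use v e in auto)
  finally have lv: "\<bar>ln (1 - v) + (\<Sum>k=1..7. v ^ k / real k)\<bar> \<le> 2 * e" using e by simp
  have "ln X = ln 8 + ln (real m) + ln (real (pbar m)) - pi * s"
    using pos m by (simp add: X_def ln_mult ln_div)
  hence "ln (real (pbar m)) - (pi * s - ln 8 - ln (real m) - (\<Sum>k=1..7. v ^ k / real k))
      = (ln (1 - v) + (\<Sum>k=1..7. v ^ k / real k)) + ln (1 + w)"
    using lnX by simp
  hence "\<bar>ln (real (pbar m)) - (pi * s - ln 8 - ln (real m) - (\<Sum>k=1..7. v ^ k / real k))\<bar> \<le> 20200 * e"
    using lv lw e by linarith
  thus "\<bar>ln (real (pbar m)) - (pi * sqrt (real m) - ln 8 - ln (real m)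
           - (\<Sum>k=1..7. (1 / (pi * sqrt (real m))) ^ k / real k))\<bar> \<le> 20200 / real m ^ 4"
    by (simp add: v_def s_def e_def)
qed

section \<open>Second differences of powers\<close>

text \<open>The offsets p, q, t of three consecutive integers are relative to n, with q in the
  middle: with y = 1/n the triple is -y, 0, y for u(n) and 0, y, 2y for u(n+1), so both are expanded
  at the same point.\<close>

definition powr_diff :: "real \<Rightarrow> real \<Rightarrow> real \<Rightarrow> real \<Rightarrow> real" where
  "powr_diff s p q t = (1 + p) powr (- s) + (1 + t) powr (- s) - 2 * (1 + q) powr (- s)"

lemma powr_diff_bound:
  fixes s y :: real
  assumes s: "s \<ge> 0" "s + real K \<le> 10" and z: "\<bar>p\<bar> \<le> 1 / 1000" "\<bar>q\<bar> \<le> 1 / 1000" "\<bar>t\<bar> \<le> 1 / 1000"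
  shows "\<bar>powr_diff s p q t - (\<Sum>k<K. (\<Prod>i<k. - s - real i) / fact k * (p ^ k + t ^ k - 2 * q ^ k))\<bar>
           \<le> 2 * ((\<Prod>i<K. s + real i) / fact K) * (\<bar>p\<bar> ^ K + \<bar>t\<bar> ^ K + 2 * \<bar>q\<bar> ^ K)"
proof -
  let ?c = "\<lambda>k. (\<Prod>i<k. - s - real i) / fact k" and ?C = "2 * ((\<Prod>i<K. s + real i) / fact K)"
  have T: "\<bar>(1 + z) powr (- s) - (\<Sum>k<K. ?c k * z ^ k)\<bar> \<le> ?C * \<bar>z\<bar> ^ K" if "\<bar>z\<bar> \<le> 1 / 1000" for z
    using powr_minus_taylor[OF s(1) that s(2)] .
  have "(\<Sum>k<K. ?c k * (p ^ k + t ^ k - 2 * q ^ k)) =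
      (\<Sum>k<K. ?c k * p ^ k) + (\<Sum>k<K. ?c k * t ^ k) - 2 * (\<Sum>k<K. ?c k * q ^ k)"
    by (simp add: sum.distrib[symmetric] sum_subtractf[symmetric] sum_distrib_left)
       (simp add: algebra_simps add_divide_distrib diff_divide_distrib)
  moreover have "?C * (\<bar>p\<bar> ^ K + \<bar>t\<bar> ^ K + 2 * \<bar>q\<bar> ^ K) = ?C * \<bar>p\<bar> ^ K + ?C * \<bar>t\<bar> ^ K + 2 * (?C * \<bar>q\<bar> ^ K)"
    by (simp add: distrib_left mult.left_commute)
  ultimately show ?thesis
    using T[OF z(1)] T[OF z(2)] T[OF z(3)] unfolding powr_diff_def by linarith
qed

lemmas taylor_numerals = fact_numeral prod.lessThan_Suc sum.lessThan_Suc eval_nat_numeral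

text \<open>The exponent s is later multiplied by a^(2s), where y = a^2, so the order K is chosen
  with 2s + 2K \<ge> 10. Each estimate is proved with a smaller constant and then weakened to that
  of the forward case, so that one lemma can treat both.\<close>

lemma powr_diff_central:
  assumes y: "0 \<le> y" "y \<le> 1 / 2000"
  shows "\<bar>powr_diff (1/2) (-y) 0 y - (3 / 4 * y ^ 2 + 35 / 64 * y ^ 4)\<bar> \<le> 17 * y ^ 5"
    and "\<bar>powr_diff 1 (-y) 0 y - 2 * y ^ 2\<bar> \<le> 36 * y ^ 4"
    and "\<bar>powr_diff (3/2) (-y) 0 y - 15 / 4 * y ^ 2\<bar> \<le> 89 * y ^ 4"
    and "\<bar>powr_diff 2 (-y) 0 y - 6 * y ^ 2\<bar> \<le> 80 * y ^ 3"
    and "\<bar>powr_diff (5/2) (-y) 0 y - 35 / 4 * y ^ 2\<bar> \<le> 132 * y ^ 3"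
    and "\<bar>powr_diff 3 (-y) 0 y\<bar> \<le> 72 * y ^ 2"
    and "\<bar>powr_diff (7/2) (-y) 0 y\<bar> \<le> 95 * y ^ 2"
    and "\<bar>powr_diff 4 (-y) 0 y\<bar> \<le> 120 * y ^ 2"
    and "\<bar>powr_diff (9/2) (-y) 0 y\<bar> \<le> 149 * y ^ 2"
proof -
  have y': "\<bar>- y\<bar> \<le> 1 / 1000" "\<bar>0::real\<bar> \<le> 1 / 1000" "\<bar>y\<bar> \<le> 1 / 1000" using y by auto
  note B = powr_diff_bound[OF _ _ y']
  have weaken: "x \<le> d * y ^ k" if "x \<le> c * y ^ k" "c \<le> d" for x c d k
    using order_trans[OF that(1) mult_right_mono[OF that(2)]] y by simp
  show "\<bar>powr_diff (1/2) (-y) 0 y - (3 / 4 * y ^ 2 + 35 / 64 * y ^ 4)\<bar> \<le> 17 * y ^ 5"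
    by (rule weaken[of _ "63 / 64"]) (use B[of "1/2" 5] y in \<open>simp_all add: taylor_numerals\<close>)
  show "\<bar>powr_diff 1 (-y) 0 y - 2 * y ^ 2\<bar> \<le> 36 * y ^ 4"
    by (rule weaken[of _ "4"]) (use B[of "1" 4] y in \<open>simp_all add: taylor_numerals\<close>)
  show "\<bar>powr_diff (3/2) (-y) 0 y - 15 / 4 * y ^ 2\<bar> \<le> 89 * y ^ 4"
    by (rule weaken[of _ "315 / 32"]) (use B[of "3/2" 4] y in \<open>simp_all add: taylor_numerals\<close>)
  show "\<bar>powr_diff 2 (-y) 0 y - 6 * y ^ 2\<bar> \<le> 80 * y ^ 3"
    by (rule weaken[of _ "16"]) (use B[of "2" 3] y in \<open>simp_all add: taylor_numerals\<close>)
  show "\<bar>powr_diff (5/2) (-y) 0 y - 35 / 4 * y ^ 2\<bar> \<le> 132 * y ^ 3"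
    by (rule weaken[of _ "105 / 4"]) (use B[of "5/2" 3] y in \<open>simp_all add: taylor_numerals\<close>)
  show "\<bar>powr_diff 3 (-y) 0 y\<bar> \<le> 72 * y ^ 2"
    by (rule weaken[of _ "24"]) (use B[of "3" 2] y in \<open>simp_all add: taylor_numerals\<close>)
  show "\<bar>powr_diff (7/2) (-y) 0 y\<bar> \<le> 95 * y ^ 2"
    by (rule weaken[of _ "63 / 2"]) (use B[of "7/2" 2] y in \<open>simp_all add: taylor_numerals\<close>)
  show "\<bar>powr_diff 4 (-y) 0 y\<bar> \<le> 120 * y ^ 2"
    by (rule weaken[of _ "40"]) (use B[of "4" 2] y in \<open>simp_all add: taylor_numerals\<close>)
  show "\<bar>powr_diff (9/2) (-y) 0 y\<bar> \<le> 149 * y ^ 2"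
    by (rule weaken[of _ "99 / 2"]) (use B[of "9/2" 2] y in \<open>simp_all add: taylor_numerals\<close>)
qed

lemma powr_diff_forward:
  assumes y: "0 \<le> y" "y \<le> 1 / 2000"
  shows "\<bar>powr_diff (1/2) 0 y (2 * y) - (3 / 4 * y ^ 2 - 15 / 8 * y ^ 3 + 245 / 64 * y ^ 4)\<bar> \<le> 17 * y ^ 5"
    and "\<bar>powr_diff 1 0 y (2 * y) - (2 * y ^ 2 - 6 * y ^ 3)\<bar> \<le> 36 * y ^ 4"
    and "\<bar>powr_diff (3/2) 0 y (2 * y) - (15 / 4 * y ^ 2 - 105 / 8 * y ^ 3)\<bar> \<le> 89 * y ^ 4"
    and "\<bar>powr_diff 2 0 y (2 * y) - 6 * y ^ 2\<bar> \<le> 80 * y ^ 3"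
    and "\<bar>powr_diff (5/2) 0 y (2 * y) - 35 / 4 * y ^ 2\<bar> \<le> 132 * y ^ 3"
    and "\<bar>powr_diff 3 0 y (2 * y)\<bar> \<le> 72 * y ^ 2"
    and "\<bar>powr_diff (7/2) 0 y (2 * y)\<bar> \<le> 95 * y ^ 2"
    and "\<bar>powr_diff 4 0 y (2 * y)\<bar> \<le> 120 * y ^ 2"
    and "\<bar>powr_diff (9/2) 0 y (2 * y)\<bar> \<le> 149 * y ^ 2"
proof -
  have y': "\<bar>0::real\<bar> \<le> 1 / 1000" "\<bar>y\<bar> \<le> 1 / 1000" "\<bar>2 * y\<bar> \<le> 1 / 1000" using y by auto
  note B = powr_diff_bound[OF _ _ y']
  have weaken: "x \<le> d * y ^ k" if "x \<le> c * y ^ k" "c \<le> d" for x c d k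
    using order_trans[OF that(1) mult_right_mono[OF that(2)]] y by simp
  show "\<bar>powr_diff (1/2) 0 y (2 * y) - (3 / 4 * y ^ 2 - 15 / 8 * y ^ 3 + 245 / 64 * y ^ 4)\<bar> \<le> 17 * y ^ 5"
    by (rule weaken[of _ "1071 / 64"]) (use B[of "1/2" 5] y in \<open>simp_all add: taylor_numerals\<close>)
  show "\<bar>powr_diff 1 0 y (2 * y) - (2 * y ^ 2 - 6 * y ^ 3)\<bar> \<le> 36 * y ^ 4"
    by (rule weaken[of _ "36"]) (use B[of "1" 4] y in \<open>simp_all add: taylor_numerals\<close>)
  show "\<bar>powr_diff (3/2) 0 y (2 * y) - (15 / 4 * y ^ 2 - 105 / 8 * y ^ 3)\<bar> \<le> 89 * y ^ 4"
    by (rule weaken[of _ "2835 / 32"]) (use B[of "3/2" 4] y in \<open>simp_all add: taylor_numerals\<close>)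
  show "\<bar>powr_diff 2 0 y (2 * y) - 6 * y ^ 2\<bar> \<le> 80 * y ^ 3"
    by (rule weaken[of _ "80"]) (use B[of "2" 3] y in \<open>simp_all add: taylor_numerals\<close>)
  show "\<bar>powr_diff (5/2) 0 y (2 * y) - 35 / 4 * y ^ 2\<bar> \<le> 132 * y ^ 3"
    by (rule weaken[of _ "525 / 4"]) (use B[of "5/2" 3] y in \<open>simp_all add: taylor_numerals\<close>)
  show "\<bar>powr_diff 3 0 y (2 * y)\<bar> \<le> 72 * y ^ 2"
    by (rule weaken[of _ "72"]) (use B[of "3" 2] y in \<open>simp_all add: taylor_numerals\<close>)
  show "\<bar>powr_diff (7/2) 0 y (2 * y)\<bar> \<le> 95 * y ^ 2"
    by (rule weaken[of _ "189 / 2"]) (use B[of "7/2" 2] y in \<open>simp_all add: taylor_numerals\<close>)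
  show "\<bar>powr_diff 4 0 y (2 * y)\<bar> \<le> 120 * y ^ 2"
    by (rule weaken[of _ "120"]) (use B[of "4" 2] y in \<open>simp_all add: taylor_numerals\<close>)
  show "\<bar>powr_diff (9/2) 0 y (2 * y)\<bar> \<le> 149 * y ^ 2"
    by (rule weaken[of _ "297 / 2"]) (use B[of "9/2" 2] y in \<open>simp_all add: taylor_numerals\<close>)
qed

lemma scaled_difference_bound:
  fixes a :: real
  assumes "\<bar>A - P\<bar> \<le> E * (a\<^sup>2) ^ K" "0 \<le> c" "c * E \<le> B" "0 \<le> a" "a \<le> 1" "10 \<le> j + 2 * K" "0 \<le> E"
  shows "\<bar>c * a ^ j * A - c * a ^ j * P\<bar> \<le> B * a ^ 10"
proof -
  have "\<bar>c * a ^ j * A - c * a ^ j * P\<bar> = c * a ^ j * \<bar>A - P\<bar>"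
    using assms by (simp add: right_diff_distrib[symmetric] abs_mult)
  also have "\<dots> \<le> c * a ^ j * (E * (a\<^sup>2) ^ K)"
    using assms by (intro mult_left_mono) auto
  also have "\<dots> = c * E * a ^ (j + 2 * K)"
    by (simp add: power_add power_mult)
  also have "\<dots> \<le> B * a ^ 10"
    using assms by (intro mult_mono power_decreasing) (auto intro: order_trans[OF mult_nonneg_nonneg])
  finally show ?thesis .
qed

lemma ln_8_bounds: "0 \<le> ln (8::real)" "ln (8::real) \<le> 3"
proof -
  have "ln (8::real) = ln (2 ^ 3)" by simp
  also have "\<dots> = 3 * ln 2" by (simp only: ln_realpow)
  finally show "ln (8::real) \<le> 3" using ln_2_less_1 by simp
qed auto

text \<open>\<open>S\<close> stands for the second difference as a function of the exponent, for
  either triple of offsets. Only the exponents up to 5/2 leave main terms above order a^10.\<close>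

lemma smooth_difference_bound:
  fixes a :: real and S :: "real \<Rightarrow> real"
  assumes a: "0 \<le> a" "a \<le> 1"
    and S: "\<bar>S (1/2) - P1\<bar> \<le> 17 * (a\<^sup>2) ^ 5" "\<bar>S 1 - P2\<bar> \<le> 36 * (a\<^sup>2) ^ 4"
      "\<bar>S (3/2) - P3\<bar> \<le> 89 * (a\<^sup>2) ^ 4" "\<bar>S 2 - P4\<bar> \<le> 80 * (a\<^sup>2) ^ 3"
      "\<bar>S (5/2) - P5\<bar> \<le> 132 * (a\<^sup>2) ^ 3" "\<bar>S 3\<bar> \<le> 72 * (a\<^sup>2) ^ 2" "\<bar>S (7/2)\<bar> \<le> 95 * (a\<^sup>2) ^ 2"
      "\<bar>S 4\<bar> \<le> 120 * (a\<^sup>2) ^ 2" "\<bar>S (9/2)\<bar> \<le> 149 * (a\<^sup>2) ^ 2"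
  shows "\<bar>(pi * a * S (1/2) - ln 8 * a ^ 2 * S 1 - (\<Sum>k=1..7. 1 / (real k * pi ^ k) * a ^ (k + 2) * S (real (k + 2) / 2)))
          - (pi * a * P1 - ln 8 * a ^ 2 * P2 - 1 / pi * a ^ 3 * P3 - 1 / (2 * pi ^ 2) * a ^ 4 * P4
               - 1 / (3 * pi ^ 3) * a ^ 5 * P5)\<bar> \<le> 500 * a ^ 10"
proof -
  have b: "\<bar>1 / (real k * pi ^ k) * a ^ (k + 2) * A - 1 / (real k * pi ^ k) * a ^ (k + 2) * P\<bar> \<le> (E / real k) * a ^ 10"
    if "\<bar>A - P\<bar> \<le> E * (a\<^sup>2) ^ K" "0 \<le> E" "8 \<le> k + 2 * K" "k \<ge> 1" for A P E k K
  proof (rule scaled_difference_bound[OF that(1) _ _ a])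
    have "1 \<le> pi ^ k" using pi_gt3 by (intro one_le_power) auto
    hence "real k * 1 \<le> real k * pi ^ k" by (intro mult_left_mono) auto
    hence "1 / (real k * pi ^ k) \<le> 1 / real k" using that by (intro divide_left_mono) auto
    from mult_right_mono[OF this \<open>0 \<le> E\<close>] show "1 / (real k * pi ^ k) * E \<le> E / real k" by simp
  qed (use that in auto)
  \<comment> \<open>The constants are 4 * 17 from pi < 4, then 3 * 36 from ln 8 \<le> 3, and
    otherwise E/k because pi^k \<ge> 1. Their sum is below 500.\<close>
  have 1: "\<bar>pi * a ^ 1 * S (1/2) - pi * a ^ 1 * P1\<bar> \<le> 68 * a ^ 10"
    by (rule scaled_difference_bound[OF S(1) _ _ a]) (use pi_less_4 in auto)
  have 2: "\<bar>ln 8 * a ^ 2 * S 1 - ln 8 * a ^ 2 * P2\<bar> \<le> 108 * a ^ 10"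
    by (rule scaled_difference_bound[OF S(2) _ _ a]) (use ln_8_bounds in auto)
  have "1 + 2 = (3::nat)" by simp
  have 3: "\<bar>1 / pi * a ^ 3 * S (3/2) - 1 / pi * a ^ 3 * P3\<bar> \<le> 89 * a ^ 10"
    using b[OF S(3), of 1] unfolding \<open>1 + 2 = (3::nat)\<close> by simp
  have 4: "\<bar>1 / (2 * pi ^ 2) * a ^ 4 * S 2 - 1 / (2 * pi ^ 2) * a ^ 4 * P4\<bar> \<le> 40 * a ^ 10"
    using b[OF S(4), of 2] by simp
  have 5: "\<bar>1 / (3 * pi ^ 3) * a ^ 5 * S (5/2) - 1 / (3 * pi ^ 3) * a ^ 5 * P5\<bar> \<le> 44 * a ^ 10"
    using b[OF S(5), of 3] by simp
  have 6: "\<bar>1 / (4 * pi ^ 4) * a ^ 6 * S 3\<bar> \<le> 18 * a ^ 10"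
    using b[of "S 3" 0 72 2 4] S(6) by simp
  have 7: "\<bar>1 / (5 * pi ^ 5) * a ^ 7 * S (7/2)\<bar> \<le> 19 * a ^ 10"
    using b[of "S (7/2)" 0 95 2 5] S(7) by simp
  have 8: "\<bar>1 / (6 * pi ^ 6) * a ^ 8 * S 4\<bar> \<le> 20 * a ^ 10"
    using b[of "S 4" 0 120 2 6] S(8) by simp
  have 9: "\<bar>1 / (7 * pi ^ 7) * a ^ 9 * S (9/2)\<bar> \<le> 149 / 7 * a ^ 10"
    using b[of "S (9/2)" 0 149 2 7] S(9) by simp
  have key: "\<bar>(x1 - x2 - (x3 + x4 + x5 + x6 + x7 + x8 + x9)) - (y1 - y2 - y3 - y4 - y5)\<bar> \<le> 500 * M"
    if "\<bar>x1 - y1\<bar> \<le> 68 * M" "\<bar>x2 - y2\<bar> \<le> 108 * M" "\<bar>x3 - y3\<bar> \<le> 89 * M"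
      "\<bar>x4 - y4\<bar> \<le> 40 * M" "\<bar>x5 - y5\<bar> \<le> 44 * M" "\<bar>x6\<bar> \<le> 18 * M" "\<bar>x7\<bar> \<le> 19 * M"
      "\<bar>x8\<bar> \<le> 20 * M" "\<bar>x9\<bar> \<le> 149 / 7 * M" "0 \<le> M"
    for x1 x2 x3 x4 x5 x6 x7 x8 x9 y1 y2 y3 y4 y5 M :: real
    using that unfolding abs_le_iff by (intro conjI; linarith)
  have "{1..7::nat} = {1, 2, 3, 4, 5, 6, 7}" by auto
  hence sum: "(\<Sum>k=1..7. 1 / (real k * pi ^ k) * a ^ (k + 2) * S (real (k + 2) / 2)) =
      1 / pi * a ^ 3 * S (3/2) + 1 / (2 * pi ^ 2) * a ^ 4 * S 2
      + 1 / (3 * pi ^ 3) * a ^ 5 * S (5/2) + 1 / (4 * pi ^ 4) * a ^ 6 * S 3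
      + 1 / (5 * pi ^ 5) * a ^ 7 * S (7/2) + 1 / (6 * pi ^ 6) * a ^ 8 * S 4
      + 1 / (7 * pi ^ 7) * a ^ 9 * S (9/2)"
    by (simp add: eval_nat_numeral mult_ac add_ac)
  have "0 \<le> a ^ 10" using a by simp
  show ?thesis
    unfolding sum by (rule key[OF 1[unfolded power_one_right] 2 3 4 5 6 7 8 9 \<open>0 \<le> a ^ 10\<close>])
qed

section \<open>Second differences of the logarithm and of the reciprocal\<close>

text \<open>The coefficients are alternating harmonic numbers. Multiplied by 1 + z, the cubic is the
  truncated logarithm plus 11/6 z^4, so the error reduces to that of the logarithm.\<close>

lemma ln_over_one_plus_bound:
  fixes z :: real
  assumes z: "\<bar>z\<bar> \<le> 1 / 1000"
  shows "\<bar>ln (1 + z) / (1 + z) - (z - 3 / 2 * z ^ 2 + 11 / 6 * z ^ 3)\<bar> \<le> 3 * z ^ 4"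
proof -
  define e where "e = ln (1 + z) - (z - z ^ 2 / 2 + z ^ 3 / 3)"
  have z1: "999 / 1000 \<le> 1 + z" using z by linarith
  have "{..<4::nat} = {0, 1, 2, 3}" by auto
  hence "\<bar>e\<bar> \<le> z ^ 4 / (1 - \<bar>z\<bar>)"
    using ln_one_plus_bound[of z 4] z by (simp add: e_def algebra_simps)
  also have "\<dots> \<le> z ^ 4 / (999 / 1000)" using z by (intro divide_left_mono) auto
  finally have e: "\<bar>e\<bar> \<le> 1000 / 999 * z ^ 4" by simp
  have "ln (1 + z) / (1 + z) - (z - 3 / 2 * z ^ 2 + 11 / 6 * z ^ 3) = (e - 11 / 6 * z ^ 4) / (1 + z)"
    using z1 by (simp add: e_def field_simps eval_nat_numeral)
  hence "\<bar>ln (1 + z) / (1 + z) - (z - 3 / 2 * z ^ 2 + 11 / 6 * z ^ 3)\<bar> = \<bar>e - 11 / 6 * z ^ 4\<bar> / (1 + z)"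
    using z1 by simp
  also have "\<dots> \<le> (29 / 10 * z ^ 4) / (999 / 1000)"
    using e z1 zero_le_power2[of "z\<^sup>2"] by (intro frac_le) (auto simp: power_mult[symmetric] abs_le_iff)
  also have "\<dots> \<le> 3 * z ^ 4" using zero_le_power2[of "z\<^sup>2"] by (simp add: power_mult[symmetric])
  finally show ?thesis .
qed

definition ln_diff :: "real \<Rightarrow> real \<Rightarrow> real \<Rightarrow> real" where
  "ln_diff p q t = ln (1 + p) / (1 + p) + ln (1 + t) / (1 + t) - 2 * (ln (1 + q) / (1 + q))"

lemma ln_diff_central:
  assumes y: "0 \<le> y" "y \<le> 1 / 2000"
  shows "\<bar>ln_diff (-y) 0 y + 3 * y ^ 2\<bar> \<le> 6 * y ^ 4"
proof -
  define V where "V = (\<lambda>z::real. ln (1 + z) / (1 + z))"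
  have "\<bar>V y - (y - 3 / 2 * y ^ 2 + 11 / 6 * y ^ 3)\<bar> \<le> 3 * y ^ 4"
    unfolding V_def by (rule ln_over_one_plus_bound) (use y in simp)
  moreover have "\<bar>V (-y) - (- y - 3 / 2 * y ^ 2 - 11 / 6 * y ^ 3)\<bar> \<le> 3 * y ^ 4"
    using ln_over_one_plus_bound[of "-y", folded V_def] y by (simp only: V_def) simp
  moreover have "ln_diff (-y) 0 y = V (-y) + V y" by (simp add: ln_diff_def V_def)
  ultimately show ?thesis by linarith
qed

lemma ln_diff_forward:
  assumes y: "0 \<le> y" "y \<le> 1 / 2000"
  shows "\<bar>ln_diff 0 y (2 * y) - (11 * y ^ 3 - 3 * y ^ 2)\<bar> \<le> 54 * y ^ 4"
proof -
  define V where "V = (\<lambda>z::real. ln (1 + z) / (1 + z))"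
  have 1: "\<bar>V y - (y - 3 / 2 * y ^ 2 + 11 / 6 * y ^ 3)\<bar> \<le> 3 * y ^ 4"
    unfolding V_def by (rule ln_over_one_plus_bound) (use y in simp)
  have "\<bar>V (2 * y) - (2 * y - 3 / 2 * (2 * y) ^ 2 + 11 / 6 * (2 * y) ^ 3)\<bar> \<le> 3 * (2 * y) ^ 4"
    unfolding V_def by (rule ln_over_one_plus_bound) (use y in simp)
  hence 2: "\<bar>V (2 * y) - (2 * y - 6 * y ^ 2 + 44 / 3 * y ^ 3)\<bar> \<le> 48 * y ^ 4"
    unfolding power_mult_distrib by simp
  have 3: "ln_diff 0 y (2 * y) = V (2 * y) - 2 * V y" by (simp add: ln_diff_def V_def)
  show ?thesis using 1 2 unfolding 3 by linarith
qed

text \<open>This difference is multiplied by ln n, so a two-sided error would reach the upper bound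
  for u with a logarithm. The closed form 2 y^2 / (1 - y^2) gives a lower bound without error term;
  2 y^2 / ((1 + y)(1 + 2y)) does the same in the forward case.\<close>

lemma powr_diff_1_central:
  assumes y: "0 \<le> y" "y \<le> 1 / 2000"
  shows "2 * y ^ 2 \<le> powr_diff 1 (-y) 0 y" "powr_diff 1 (-y) 0 y \<le> 2 * y ^ 2 + 3 * y ^ 4"
proof -
  have y2: "y ^ 2 \<le> 1 / 4" using power_mono[of y "1/2" 2] y by (simp add: power_divide)
  have eq: "powr_diff 1 (-y) 0 y = 2 * y ^ 2 / (1 - y ^ 2)"
  proof -
    have "(1 - y) powr - 1 = 1 / (1 - y)" "(1 + y) powr - 1 = 1 / (1 + y)"
      using y by (simp_all add: powr_minus_divide)
    moreover have "1 / (1 - y) + 1 / (1 + y) - 2 = 2 * y ^ 2 / ((1 - y) * (1 + y))"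
    proof -
      have "1 - y \<noteq> 0" "1 + y \<noteq> 0" using y by auto
      thus ?thesis by (simp add: divide_simps) (simp add: power2_eq_square algebra_simps)
    qed
    moreover have "(1 - y) * (1 + y) = 1 - y ^ 2" by (simp add: power2_eq_square algebra_simps)
    ultimately show ?thesis by (simp add: powr_diff_def)
  qed
  have "2 * y ^ 2 * (1 - y ^ 2) \<le> 2 * y ^ 2" using y2 by (simp add: mult_left_le)
  thus "2 * y ^ 2 \<le> powr_diff 1 (-y) 0 y" unfolding eq using y2 by (simp add: pos_le_divide_eq)
  have "(2 * y ^ 2 + 3 * y ^ 4) * (1 - y ^ 2) = 2 * y ^ 2 + y ^ 4 * (1 - 3 * y ^ 2)"
    by (simp add: algebra_simps power_add[symmetric])
  moreover have "0 \<le> y ^ 4 * (1 - 3 * y ^ 2)" using y2 y by simp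
  ultimately show "powr_diff 1 (-y) 0 y \<le> 2 * y ^ 2 + 3 * y ^ 4"
    unfolding eq using y2 by (simp add: pos_divide_le_eq)
qed

lemma powr_diff_1_forward:
  assumes y: "0 \<le> y" "y \<le> 1 / 2000"
  shows "2 * y ^ 2 - 6 * y ^ 3 \<le> powr_diff 1 0 y (2 * y)"
    "powr_diff 1 0 y (2 * y) \<le> 2 * y ^ 2 - 6 * y ^ 3 + 14 * y ^ 4"
proof -
  define d where "d = (1 + y) * (1 + 2 * y)"
  have d: "d > 0" using y by (simp add: d_def)
  have eq: "powr_diff 1 0 y (2 * y) = 2 * y ^ 2 / d"
  proof -
    have "(1 + 2 * y) powr - 1 = 1 / (1 + 2 * y)" "(1 + y) powr - 1 = 1 / (1 + y)"
      using y by (simp_all add: powr_minus_divide)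
    moreover have "1 + 1 / (1 + 2 * y) - 2 * (1 / (1 + y)) = 2 * y ^ 2 / d"
      using y by (simp add: d_def field_simps power2_eq_square)
    ultimately show ?thesis by (simp add: powr_diff_def)
  qed
  have "(2 * y ^ 2 - 6 * y ^ 3) * d = 2 * y ^ 2 - (14 * y ^ 4 + 12 * y ^ 5)"
    by (simp add: d_def algebra_simps eval_nat_numeral)
  also have "\<dots> \<le> 2 * y ^ 2"
    using zero_le_power[OF y(1), of 4] zero_le_power[OF y(1), of 5] by linarith
  finally show "2 * y ^ 2 - 6 * y ^ 3 \<le> powr_diff 1 0 y (2 * y)"
    unfolding eq using d by (simp add: pos_le_divide_eq)
  have "2 * y ^ 2 \<le> 2 * y ^ 2 + (30 * y ^ 5 + 28 * y ^ 6)"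
    using zero_le_power[OF y(1), of 5] zero_le_power[OF y(1), of 6] by linarith
  also have "\<dots> = (2 * y ^ 2 - 6 * y ^ 3 + 14 * y ^ 4) * d"
    by (simp add: d_def algebra_simps eval_nat_numeral)
  finally show "powr_diff 1 0 y (2 * y) \<le> 2 * y ^ 2 - 6 * y ^ 3 + 14 * y ^ 4"
    unfolding eq using d by (simp add: pos_divide_le_eq)
qed

section \<open>The logarithm of the root and its second difference\<close>

definition lnr :: "real \<Rightarrow> nat \<Rightarrow> real" where
  "lnr \<alpha> m = (ln (real (pbar m)) - \<alpha> * ln (real m)) / real m"

lemma r_eq_exp_lnr:
  assumes m: "m \<ge> 5476"
  shows "r \<alpha> m = exp (lnr \<alpha> m)"
proof -
  have m0: "m > 0" using m by simp
  have "real (pbar m) / real m powr \<alpha> > 0"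
    using ln_pbar_expansion(1)[OF m] m0 by simp
  moreover have "root m X = exp (ln X / real m)" if "X > 0" for X
    using that m0 by (simp add: root_powr_inverse powr_def)
  ultimately have "r \<alpha> m = exp (ln (real (pbar m) / real m powr \<alpha>) / real m)"
    unfolding r_def by blast
  also have "ln (real (pbar m) / real m powr \<alpha>) = ln (real (pbar m)) - \<alpha> * ln (real m)"
    using ln_pbar_expansion(1)[OF m] m0 by (simp add: ln_div ln_powr)
  finally show ?thesis by (simp add: lnr_def)
qed

text \<open>The expansion at m = n (1 + z). Writing ln m as ln n + ln (1 + z) confines the
  dependence on m to z, so that second differences act on functions of z alone.\<close>

definition lnr_main :: "real \<Rightarrow> real \<Rightarrow> real \<Rightarrow> real" where
  "lnr_main \<alpha> n z = pi * (1 / sqrt n) * (1 + z) powr - (1/2) - ln 8 * (1 / sqrt n) ^ 2 * (1 + z) powr - 1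
     - (\<Sum>k=1..7. 1 / (real k * pi ^ k) * (1 / sqrt n) ^ (k + 2) * (1 + z) powr - (real (k + 2) / 2))
     - (1 + \<alpha>) * (1 / sqrt n) ^ 2 * (ln n * (1 + z) powr - 1 + ln (1 + z) / (1 + z))"

lemma lnr_expansion:
  assumes m: "m \<ge> 5476" and n: "n > 0" and mz: "real m = n * (1 + z)" and z: "\<bar>z\<bar> \<le> 1 / 1000"
  shows "\<bar>lnr \<alpha> m - lnr_main \<alpha> n z\<bar> \<le> 20400 * (1 / sqrt n) ^ 10"
proof -
  define a where "a = 1 / sqrt n"
  define b where "b = 1 / sqrt (real m)"
  have z1: "999 / 1000 \<le> 1 + z" using z by linarith
  have a: "a > 0" using n by (simp add: a_def)
  have m0: "real m > 0" using m by simp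
  have "b = a * (1 + z) powr - (1/2)"
    using n z1 by (simp add: a_def b_def mz powr_minus_divide powr_half_sqrt real_sqrt_mult)
  hence b: "b ^ j = a ^ j * (1 + z) powr - (real j / 2)" for j
    using z1 by (simp add: power_mult_distrib powr_power)
  have b2: "1 / real m = b ^ 2" using m0 by (simp add: b_def power_divide)
  have bm: "sqrt (real m) / real m = b" using m0 by (simp add: b_def real_div_sqrt field_simps)
  define T where "T = pi * sqrt (real m) - ln 8 - ln (real m) - (\<Sum>k=1..7. (1 / (pi * sqrt (real m))) ^ k / real k)"
  have "lnr_main \<alpha> n z = (T - \<alpha> * ln (real m)) / real m"
  proof -
    have "(T - \<alpha> * ln (real m)) / real m = pi * (sqrt (real m) / real m) - ln 8 * (1 / real m)
        - (\<Sum>k=1..7. (1 / (pi * sqrt (real m))) ^ k / real k) * (1 / real m) - (1 + \<alpha>) * (1 / real m) * ln (real m)"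
      by (simp add: T_def diff_divide_distrib add_divide_distrib algebra_simps)
    also have "\<dots> = pi * b ^ 1 - ln 8 * b ^ 2 - (\<Sum>k=1..7. 1 / (real k * pi ^ k) * b ^ (k + 2))
        - (1 + \<alpha>) * b ^ 2 * ln (real m)"
    proof -
      have "(1 / (pi * sqrt (real m))) ^ k / real k * b ^ 2 = 1 / (real k * pi ^ k) * b ^ (k + 2)" for k
        by (simp add: b_def power_add power_divide power_mult_distrib)
      thus ?thesis unfolding bm b2 sum_distrib_right by simp
    qed
    also have "(1 + \<alpha>) * b ^ 2 * ln (real m) = (1 + \<alpha>) * a ^ 2 * (ln n * (1 + z) powr - 1 + ln (1 + z) / (1 + z))"
    proof -
      define w where "w = (1 + z) powr - 1"
      have "ln (1 + z) / (1 + z) = ln (1 + z) * w" using z1 by (simp add: w_def powr_minus_divide)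
      moreover have "b ^ 2 = a ^ 2 * w" unfolding b by (simp add: w_def)
      moreover have "ln (real m) = ln n + ln (1 + z)"
        using n z1 unfolding mz by (intro ln_mult_pos) auto
      ultimately show ?thesis unfolding w_def[symmetric] by (simp only: distrib_left mult_ac)
    qed
    finally show ?thesis
      unfolding lnr_main_def a_def[symmetric] b by (simp add: mult.assoc)
  qed
  hence "lnr \<alpha> m - lnr_main \<alpha> n z = (ln (real (pbar m)) - T) / real m"
    by (simp add: lnr_def diff_divide_distrib)
  hence "\<bar>lnr \<alpha> m - lnr_main \<alpha> n z\<bar> = \<bar>ln (real (pbar m)) - T\<bar> / real m"
    using m0 by simp
  also have "\<dots> \<le> (20200 / real m ^ 4) / real m"
    unfolding T_def using ln_pbar_expansion(2)[OF m] by (intro divide_right_mono) auto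
  also have "\<dots> = 20200 * b ^ 10"
  proof -
    have "b ^ 10 = (1 / real m) ^ 5" unfolding b2 by (simp add: power_mult[symmetric])
    thus ?thesis using m0 by (simp add: power_divide eval_nat_numeral)
  qed
  also have "\<dots> \<le> 20200 * (a ^ 10 * (1001 / 1000) ^ 6)"
  proof (intro mult_left_mono)
    \<comment> \<open>The tenth power of 1/sqrt m is that of 1/sqrt n divided by (1 + z)^5; this
      costs less than 1.001^6, which turns 20200 into 20400.\<close>
    have "(1 + z) powr - (real 10 / 2) = 1 / (1 + z) ^ 5"
      using z1 by (simp add: powr_minus_divide powr_numeral)
    also have "\<dots> \<le> 1 / (999 / 1000) ^ 5"
      using z1 by (intro divide_left_mono power_mono mult_pos_pos) auto
    also have "\<dots> \<le> (1001 / 1000) ^ 6" by (simp add: power_divide)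
    finally show "b ^ 10 \<le> a ^ 10 * (1001 / 1000) ^ 6"
      unfolding b using a by (intro mult_left_mono) auto
  qed auto
  also have "\<dots> \<le> 20400 * a ^ 10" using a by (simp add: power_divide)
  finally show ?thesis by (simp add: a_def)
qed

text \<open>The main part is linear in the three functions of z, and 81600 = (1 + 2 + 1)
  20400.\<close>

lemma lnr_second_difference:
  fixes n :: real
  defines "a \<equiv> 1 / sqrt n"
  assumes n: "n > 0" and m: "m1 \<ge> 5476" "m2 \<ge> 5476" "m3 \<ge> 5476"
    and mz: "real m1 = n * (1 + p)" "real m2 = n * (1 + q)" "real m3 = n * (1 + t)"
    and z: "\<bar>p\<bar> \<le> 1 / 1000" "\<bar>q\<bar> \<le> 1 / 1000" "\<bar>t\<bar> \<le> 1 / 1000"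
  shows "\<bar>(lnr \<alpha> m1 + lnr \<alpha> m3 - 2 * lnr \<alpha> m2)
     - ((pi * a * powr_diff (1/2) p q t - ln 8 * a ^ 2 * powr_diff 1 p q t
          - (\<Sum>k=1..7. 1 / (real k * pi ^ k) * a ^ (k + 2) * powr_diff (real (k + 2) / 2) p q t))
        - (1 + \<alpha>) * a ^ 2 * (ln n * powr_diff 1 p q t + ln_diff p q t))\<bar> \<le> 81600 * a ^ 10"
proof -
  let ?W = "\<lambda>s. powr_diff s p q t"
  have eq: "lnr_main \<alpha> n p + lnr_main \<alpha> n t - 2 * lnr_main \<alpha> n q =
      (pi * a * ?W (1/2) - ln 8 * a ^ 2 * ?W 1 - (\<Sum>k=1..7. 1 / (real k * pi ^ k) * a ^ (k + 2) * ?W (real (k + 2) / 2)))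
        - (1 + \<alpha>) * a ^ 2 * (ln n * ?W 1 + ln_diff p q t)"
  proof -
    define R where "R = (\<lambda>z. \<Sum>k=1..7. 1 / (real k * pi ^ k) * a ^ (k + 2) * (1 + z) powr - (real (k + 2) / 2))"
    have R: "(\<Sum>k=1..7. 1 / (real k * pi ^ k) * a ^ (k + 2) * ?W (real (k + 2) / 2)) = R p + R t - 2 * R q"
      unfolding R_def powr_diff_def sum_distrib_left sum.distrib[symmetric] sum_subtractf[symmetric]
      by (intro sum.cong refl) (simp only: distrib_left right_diff_distrib mult_ac)
    have M: "lnr_main \<alpha> n z = pi * a * (1 + z) powr - (1/2) - ln 8 * a ^ 2 * (1 + z) powr - 1 - R z
       - (1 + \<alpha>) * a ^ 2 * (ln n * (1 + z) powr - 1 + ln (1 + z) / (1 + z))" for z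
      unfolding lnr_main_def a_def[symmetric] R_def ..
    have gen: "(P * x1 - l * y1 - r1 - c * (L' * y1 + v1)) + (P * x3 - l * y3 - r3 - c * (L' * y3 + v3))
         - 2 * (P * x2 - l * y2 - r2 - c * (L' * y2 + v2))
       = (P * (x1 + x3 - 2 * x2) - l * (y1 + y3 - 2 * y2) - (r1 + r3 - 2 * r2))
         - c * (L' * (y1 + y3 - 2 * y2) + (v1 + v3 - 2 * v2))"
      for P l c L' x1 x2 x3 y1 y2 y3 r1 r2 r3 v1 v2 v3 :: real
      by (simp add: algebra_simps)
    show ?thesis
      unfolding R unfolding M powr_diff_def ln_diff_def by (rule gen)
  qed
  have "\<bar>(x1 + x3 - 2 * x2) - (y1 + y3 - 2 * y2)\<bar> \<le> 81600 * e"
    if "\<bar>x1 - y1\<bar> \<le> 20400 * e" "\<bar>x2 - y2\<bar> \<le> 20400 * e" "\<bar>x3 - y3\<bar> \<le> 20400 * e"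
    for x1 x2 x3 y1 y2 y3 e :: real
    using that by linarith
  from this[OF lnr_expansion[OF m(1) n mz(1) z(1), of \<alpha>] lnr_expansion[OF m(2) n mz(2) z(2), of \<alpha>]
      lnr_expansion[OF m(3) n mz(3) z(3), of \<alpha>]]
  show ?thesis unfolding a_def[symmetric] eq .
qed

lemma u_eq_exp:
  assumes "m \<ge> 5477"
  shows "u \<alpha> m = exp (lnr \<alpha> (m - 1) + lnr \<alpha> (m + 1) - 2 * lnr \<alpha> m)"
proof -
  have m: "m - 1 \<ge> 5476" "m + 1 \<ge> 5476" "m \<ge> 5476" using assms by auto
  show ?thesis
    unfolding u_def r_eq_exp_lnr[OF m(1)] r_eq_exp_lnr[OF m(2)] r_eq_exp_lnr[OF m(3)]
    by (simp only: exp_diff exp_add exp_double)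
qed

section \<open>From the logarithm back to the quotient\<close>

lemma exp_le_quadratic:
  fixes x :: real
  assumes "\<bar>x\<bar> \<le> 1"
  shows "exp x \<le> 1 + x + x\<^sup>2"
proof (cases "x \<ge> 0")
  case True
  thus ?thesis using exp_bound[of x] assms by simp
next
  case False
  define v where "v = - x"
  have v: "0 \<le> v" using False by (simp add: v_def)
  have q: "1 + v + v\<^sup>2 / 2 \<le> exp v" by (rule exp_lower_Taylor_quadratic[OF v])
  \<comment> \<open>For negative x the claim says that 1 - v + v^2 times exp v is at least 1; the
    quadratic Taylor polynomial of exp v suffices, as the product has only nonnegative
    coefficients.\<close>
  have "1 \<le> 1 + (v\<^sup>2 / 2 + v ^ 3 / 2 + v ^ 4 / 2)" using v by simp
  also have "\<dots> = (1 - v + v\<^sup>2) * (1 + v + v\<^sup>2 / 2)"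
    by (simp add: power2_eq_square power3_eq_cube power4_eq_xxxx field_simps)
  also have "\<dots> \<le> (1 - v + v\<^sup>2) * exp v"
  proof (intro mult_left_mono q)
    have "1 - v + v\<^sup>2 = (v - 1 / 2)\<^sup>2 + 3 / 4" by (simp add: power2_eq_square algebra_simps)
    also have "\<dots> \<ge> 0" by simp
    finally show "0 \<le> 1 - v + v\<^sup>2" .
  qed
  finally have "exp (- v) \<le> 1 - v + v\<^sup>2" by (simp add: exp_minus field_simps)
  thus ?thesis by (simp add: v_def)
qed

lemma two_powr_ge:
  fixes x :: real
  assumes "x \<ge> 0"
  shows "1 + 2 / 3 * x \<le> 2 powr x"
proof -
  have "2 / 3 * x \<le> ln 2 * x" using ln2_ge_two_thirds assms by (intro mult_right_mono) auto
  also have "1 + ln 2 * x \<le> exp (ln 2 * x)" by (rule exp_ge_add_one_self)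
  finally show ?thesis by (simp add: powr_def mult.commute)
qed

text \<open>The logarithmic part enters with its sign: its error is one-sided up to a multiple of \<open>1 + \<alpha>\<close>
  without a factor \<open>l = ln n\<close>, since the upper bounds of the theorem leave no room for one.\<close>

lemma combine_log_part:
  fixes D G G0 a l \<alpha> S1 V m1 m2 :: real
  assumes D: "\<bar>D - (G - (1 + \<alpha>) * a\<^sup>2 * (l * S1 + V))\<bar> \<le> 81600 * a ^ 10"
    and G: "\<bar>G - G0\<bar> \<le> 500 * a ^ 10"
    and S1: "m1 \<le> S1" "S1 \<le> m1 + 14 * (a\<^sup>2) ^ 4" and V: "\<bar>V - m2\<bar> \<le> 54 * (a\<^sup>2) ^ 4"
    and \<alpha>: "\<alpha> \<ge> 0" and l: "l \<ge> 0"
  shows "D \<le> G0 - (1 + \<alpha>) * (a\<^sup>2 * (l * m1 + m2)) + (82500 + 54 * (1 + \<alpha>)) * a ^ 10"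
    and "G0 - (1 + \<alpha>) * (a\<^sup>2 * (l * m1 + m2)) - (82500 + (1 + \<alpha>) * (54 + 14 * l)) * a ^ 10 \<le> D"
proof -
  define c where "c = (1 + \<alpha>) * a\<^sup>2"
  have c: "c \<ge> 0" using \<alpha> by (simp add: c_def)
  have M: "a\<^sup>2 * (a\<^sup>2) ^ 4 = a ^ 10" by (simp only: power_mult[symmetric] power_add[symmetric]) simp
  have M0: "0 \<le> a ^ 10" unfolding M[symmetric] by simp
  have 1: "l * m1 \<le> l * S1" using S1 l by (intro mult_left_mono) auto
  have 2: "l * S1 \<le> l * (m1 + 14 * (a\<^sup>2) ^ 4)" using S1 l by (intro mult_left_mono) auto
  have "c * (l * m1 + m2 - 54 * (a\<^sup>2) ^ 4) \<le> c * (l * S1 + V)"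
    using 1 V by (intro mult_left_mono c) (simp add: abs_le_iff)
  moreover have "c * (l * m1 + m2 - 54 * (a\<^sup>2) ^ 4) =
      (1 + \<alpha>) * (a\<^sup>2 * (l * m1 + m2)) - 54 * (1 + \<alpha>) * (a\<^sup>2 * (a\<^sup>2) ^ 4)"
    unfolding c_def by (simp only: right_diff_distrib mult_ac)
  ultimately have lo: "(1 + \<alpha>) * (a\<^sup>2 * (l * m1 + m2)) - 54 * (1 + \<alpha>) * a ^ 10 \<le> c * (l * S1 + V)"
    unfolding M by linarith
  have "c * (l * S1 + V) \<le> c * (l * m1 + m2 + (54 + 14 * l) * (a\<^sup>2) ^ 4)"
    using 2 V by (intro mult_left_mono c) (simp add: abs_le_iff algebra_simps)
  moreover have "c * (l * m1 + m2 + (54 + 14 * l) * (a\<^sup>2) ^ 4) =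
      (1 + \<alpha>) * (a\<^sup>2 * (l * m1 + m2)) + (1 + \<alpha>) * (54 + 14 * l) * (a\<^sup>2 * (a\<^sup>2) ^ 4)"
    unfolding c_def by (simp add: algebra_simps)
  ultimately have hi: "c * (l * S1 + V) \<le> (1 + \<alpha>) * (a\<^sup>2 * (l * m1 + m2)) + (1 + \<alpha>) * (54 + 14 * l) * a ^ 10"
    unfolding M by linarith
  have "D \<le> G - c * (l * S1 + V) + 81600 * a ^ 10" "G - c * (l * S1 + V) - 81600 * a ^ 10 \<le> D"
    using D unfolding c_def[symmetric] abs_le_iff by linarith+
  moreover have "G \<le> G0 + 500 * a ^ 10" "G0 - 500 * a ^ 10 \<le> G" using G unfolding abs_le_iff by linarith+
  moreover have "(82500 + 54 * (1 + \<alpha>)) * a ^ 10 = 82500 * a ^ 10 + 54 * (1 + \<alpha>) * a ^ 10"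
    "(82500 + (1 + \<alpha>) * (54 + 14 * l)) * a ^ 10 = 82500 * a ^ 10 + (1 + \<alpha>) * (54 + 14 * l) * a ^ 10"
    by (simp_all only: distrib_right)
  ultimately show "D \<le> G0 - (1 + \<alpha>) * (a\<^sup>2 * (l * m1 + m2)) + (82500 + 54 * (1 + \<alpha>)) * a ^ 10"
    "G0 - (1 + \<alpha>) * (a\<^sup>2 * (l * m1 + m2)) - (82500 + (1 + \<alpha>) * (54 + 14 * l)) * a ^ 10 \<le> D"
    using lo hi M0 by linarith+
qed

text \<open>The lower bound rests on 1 + D \<le> exp D and pays only the linear error, which may
  contain l. The upper bound also pays D^2. As D is of order (1 + \<alpha>) a^5, this is of order (1
  + \<alpha>)^2 a^10 without a logarithm, and the growth in \<alpha> goes into 2^(18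
  \<alpha>).\<close>

lemma exp_enclosure:
  fixes D G0 X a l \<alpha> :: real
  assumes a: "0 < a" "a \<le> 1 / 74" and l: "l \<ge> 8" "l * a \<le> 2" and \<alpha>: "\<alpha> \<ge> 0" "\<alpha> * a ^ 4 \<le> 1 / 2"
    and G0: "\<bar>G0\<bar> \<le> 7 * a ^ 5" and X: "\<bar>X\<bar> \<le> 7 * a ^ 5"
    and up: "D \<le> G0 - (1 + \<alpha>) * X + (82500 + 54 * (1 + \<alpha>)) * a ^ 10"
    and lo: "G0 - (1 + \<alpha>) * X - (82500 + (1 + \<alpha>) * (54 + 14 * l)) * a ^ 10 \<le> D"
  shows "1 + (G0 - (1 + \<alpha>) * X) - 2 powr (16 + 7 * \<alpha>) * l * a ^ 10 < exp D"
    and "exp D < 1 + (G0 - (1 + \<alpha>) * X) + 2 powr (31 + 18 * \<alpha>) * a ^ 10"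
proof -
  define w where "w = 1 + \<alpha>"
  have w: "w \<ge> 1" using \<alpha> by (simp add: w_def)
  have a10: "a ^ 10 > 0" using a by simp
  have a5: "a ^ 5 > 0" using a by simp
  have pow: "a ^ 10 = a ^ 5 * a ^ 5" by (simp add: power_add[symmetric])
  have small: "a ^ 4 \<le> 1 / 29000000" "a ^ 5 \<le> 1 / 2000000000"
  proof -
    have "a ^ 4 \<le> (1 / 74) ^ 4" "a ^ 5 \<le> (1 / 74) ^ 5" using a by (intro power_mono; simp)+
    thus "a ^ 4 \<le> 1 / 29000000" "a ^ 5 \<le> 1 / 2000000000" by (simp_all add: power_divide)
  qed
  have err: "(82500 + w * (54 + 14 * l)) * a ^ 10 \<le> 2 * w * a ^ 5"
  proof -
    have "14 * l * a ^ 5 = 14 * (l * a) * a ^ 4" by (simp add: eval_nat_numeral)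
    also have "\<dots> \<le> 14 * 2 * (1 / 29000000)" using l a small by (intro mult_mono) auto
    finally have 1: "14 * l * a ^ 5 \<le> 1 / 2" by simp
    have "(82500 + w * (54 + 14 * l)) * a ^ 5 = 82500 * a ^ 5 + w * (54 * a ^ 5 + 14 * l * a ^ 5)"
      by (simp add: algebra_simps)
    also have "\<dots> \<le> 1 + w * 1" using 1 small w by (intro add_mono mult_left_mono) auto
    also have "\<dots> \<le> 2 * w" using w by simp
    finally have "(82500 + w * (54 + 14 * l)) * a ^ 5 * a ^ 5 \<le> 2 * w * a ^ 5"
      using a5 by (intro mult_right_mono) auto
    thus ?thesis by (simp only: pow mult.assoc)
  qed
  have err2: "(82500 + 54 * w) * a ^ 10 \<le> (82500 + w * (54 + 14 * l)) * a ^ 10"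
    using l w a10 by (intro mult_right_mono) (auto simp: algebra_simps)
  have "\<bar>w * X\<bar> \<le> w * (7 * a ^ 5)"
    using w X by (simp add: abs_mult mult_left_mono)
  moreover have "7 * a ^ 5 \<le> w * (7 * a ^ 5)" using w a5 by simp
  \<comment> \<open>The constant 16 is 7 for \<open>G0\<close>, 7 for the logarithmic part and 2 for
    the error, each times w = 1 + \<alpha>.\<close>
  ultimately have Dabs: "\<bar>D\<bar> \<le> 16 * (w * a ^ 5)"
    using up lo G0 err err2 unfolding w_def[symmetric] abs_le_iff by linarith
  have "\<bar>D\<bar> \<le> 1"
  proof -
    have "\<alpha> * a ^ 5 = \<alpha> * a ^ 4 * a" by (simp add: eval_nat_numeral)
    also have "\<dots> \<le> 1 / 2 * (1 / 74)" using \<alpha> a by (intro mult_mono) auto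
    finally have "16 * (w * a ^ 5) \<le> 1" using small by (simp add: w_def algebra_simps)
    thus ?thesis using Dabs by linarith
  qed
  hence "exp D \<le> 1 + D + D\<^sup>2" by (rule exp_le_quadratic)
  moreover have "D\<^sup>2 \<le> 256 * w\<^sup>2 * a ^ 10"
  proof -
    have "\<bar>D\<bar>\<^sup>2 \<le> (16 * (w * a ^ 5))\<^sup>2" using Dabs by (intro power_mono) auto
    thus ?thesis by (simp add: power_mult_distrib power_mult[symmetric])
  qed
  moreover have "(82500 + 54 * w) * a ^ 10 + 256 * w\<^sup>2 * a ^ 10 < 2 powr (31 + 18 * \<alpha>) * a ^ 10"
  proof -
    \<comment> \<open>Squaring gives (1 + \<alpha>)^2 \<le> 2^(18 \<alpha>), the source of the 18
      here; 2147483648 is 2^31.\<close>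
    have "w \<le> 2 powr (9 * \<alpha>)" using two_powr_ge[of "9 * \<alpha>"] \<alpha> by (simp add: w_def)
    hence "w\<^sup>2 \<le> (2 powr (9 * \<alpha>))\<^sup>2" using w by (intro power_mono) auto
    also have "\<dots> = 2 powr (18 * \<alpha>)" by (simp add: powr_power)
    finally have 1: "w\<^sup>2 \<le> 2 powr (18 * \<alpha>)" .
    have "1 \<le> w\<^sup>2" "w \<le> w\<^sup>2" using one_le_power[OF w, of 2] power_increasing[of 1 2 w] w by auto
    hence "82500 + 54 * w + 256 * w\<^sup>2 < 2147483648 * w\<^sup>2" by linarith
    also have "\<dots> \<le> 2147483648 * 2 powr (18 * \<alpha>)" using 1 by simp
    also have "\<dots> = 2 powr (31 + 18 * \<alpha>)" by (simp add: powr_add)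
    finally have "(82500 + 54 * w + 256 * w\<^sup>2) * a ^ 10 < 2 powr (31 + 18 * \<alpha>) * a ^ 10"
      using a10 by (intro mult_strict_right_mono)
    thus ?thesis by (simp add: distrib_right)
  qed
  ultimately show "exp D < 1 + (G0 - (1 + \<alpha>) * X) + 2 powr (31 + 18 * \<alpha>) * a ^ 10"
    using up unfolding w_def[symmetric] by linarith
  have "(82500 + w * (54 + 14 * l)) * a ^ 10 < 2 powr (16 + 7 * \<alpha>) * l * a ^ 10"
  proof (intro mult_strict_right_mono a10)
    \<comment> \<open>2^16 l with l \<ge> 8 exceeds the constant 82500 by a wide margin, and 2^(7
      \<alpha>) covers the terms linear in \<alpha>.\<close>
    have "1 + 4 * \<alpha> \<le> 2 powr (7 * \<alpha>)" using two_powr_ge[of "7 * \<alpha>"] \<alpha> by simp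
    hence 1: "65536 * (1 + 4 * \<alpha>) * l \<le> 65536 * 2 powr (7 * \<alpha>) * l"
      using l by (intro mult_right_mono) auto
    have "\<alpha> * 8 \<le> \<alpha> * l" using \<alpha> l by (intro mult_left_mono) auto
    hence "82500 + (54 + 54 * \<alpha> + 14 * l + 14 * (\<alpha> * l)) < 65536 * l + 262144 * (\<alpha> * l)"
      using l \<alpha> by linarith
    hence "82500 + w * (54 + 14 * l) < 65536 * (1 + 4 * \<alpha>) * l"
      by (simp add: w_def algebra_simps)
    also note 1
    also have "65536 * 2 powr (7 * \<alpha>) * l = 2 powr (16 + 7 * \<alpha>) * l" by (simp add: powr_add)
    finally show "82500 + w * (54 + 14 * l) < 2 powr (16 + 7 * \<alpha>) * l" .
  qed
  thus "1 + (G0 - (1 + \<alpha>) * X) - 2 powr (16 + 7 * \<alpha>) * l * a ^ 10 < exp D"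
    using lo exp_ge_add_one_self[of D] unfolding w_def[symmetric] by linarith
qed

text \<open>As a \<le> 1/74, a coefficient up to 74 pays for one power of a, so each of the four
  higher terms costs at most a^5 and the total is 3 + 4.\<close>

lemma quintic_bound:
  fixes a :: real
  assumes a: "0 < a" "a \<le> 1 / 74" and g: "\<bar>g5\<bar> \<le> 3" "\<bar>g6\<bar> \<le> 74" "\<bar>g7\<bar> \<le> 74" "\<bar>g8\<bar> \<le> 74" "\<bar>g9\<bar> \<le> 74"
  shows "\<bar>g5 * a ^ 5 + g6 * a ^ 6 + g7 * a ^ 7 + g8 * a ^ 8 + g9 * a ^ 9\<bar> \<le> 7 * a ^ 5"
proof -
  have 5: "\<bar>g5 * a ^ 5\<bar> \<le> 3 * a ^ 5" using a g(1) by (simp add: abs_mult)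
  have j: "\<bar>g * a ^ k\<bar> \<le> 1 * a ^ 5" if g: "\<bar>g\<bar> \<le> 74" and k: "k \<ge> 6" for g k
  proof -
    have "\<bar>g * a ^ k\<bar> = \<bar>g\<bar> * a ^ k" using a by (simp add: abs_mult)
    also have "\<dots> \<le> 74 * a ^ 6" using a that by (intro mult_mono power_decreasing) auto
    also have "\<dots> = 74 * a * a ^ 5" by (simp add: eval_nat_numeral)
    also have "\<dots> \<le> 1 * a ^ 5" using a by (intro mult_right_mono) auto
    finally show ?thesis .
  qed
  show ?thesis
    using 5 j[OF g(2), of 6] j[OF g(3), of 7] j[OF g(4), of 8] j[OF g(5), of 9]
    unfolding abs_le_iff by (intro conjI) (simp; linarith)+
qed

section \<open>Collecting coefficients in powers of 1/sqrt n\<close>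

context
  fixes n :: nat and a l :: real
  assumes n: "n \<ge> 5505"
  defines "a \<equiv> 1 / sqrt (real n)" and "l \<equiv> ln (real n)"
begin

lemma inv_sqrt_bounds: "0 < a" "a \<le> 1 / 74" and inv_sqrt_square: "a\<^sup>2 = 1 / real n" and inv_sqrt_square_le: "a\<^sup>2 \<le> 1 / 2000"
proof -
  have s: "sqrt (real n) \<ge> 74" using n by (intro real_le_rsqrt) simp
  have "1 / sqrt (real n) \<le> 1 / 74" using s n by (intro divide_left_mono) auto
  thus "a \<le> 1 / 74" by (simp add: a_def)
  show "0 < a" using n by (simp add: a_def)
  show sq: "a\<^sup>2 = 1 / real n" using n by (simp add: a_def power_divide)
  show "a\<^sup>2 \<le> 1 / 2000" unfolding sq using n by (intro divide_left_mono) auto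
qed

lemma ln_bounds_5505: "l \<ge> 8" "l * a \<le> 2"
proof -
  \<comment> \<open>5505 lies above 2^12, and ln 2 \<ge> 2/3.\<close>
  have "8 \<le> 12 * ln (2::real)" using ln2_ge_two_thirds by simp
  also have "\<dots> = ln (2 ^ 12)" by (simp only: ln_realpow)
  also have "\<dots> \<le> l" unfolding l_def using n by simp
  finally show "l \<ge> 8" .
  have s: "sqrt (real n) > 0" using n by simp
  have "l = 2 * ln (sqrt (real n))" using n by (simp add: l_def ln_sqrt)
  also have "\<dots> \<le> 2 * sqrt (real n)" using ln_le_minus_one[OF s] by simp
  finally have "l * a \<le> 2 * sqrt (real n) * a" using inv_sqrt_bounds by (intro mult_right_mono) auto
  thus "l * a \<le> 2" using s by (simp add: a_def)
qed

lemma pi_inverse_le: "0 < 1 / pi" "1 / pi \<le> 1" "0 < 1 / pi ^ 2" "1 / pi ^ 2 \<le> 1" "0 < 1 / pi ^ 3" "1 / pi ^ 3 \<le> 1"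
  using pi_gt3 one_le_power[of pi 2] one_le_power[of pi 3] by simp_all

lemma real_n_powers:
  "real n powr (5/2) = 1 / a ^ 5" "real n powr (7/2) = 1 / a ^ 7" "real n powr (9/2) = 1 / a ^ 9"
  "real n ^ 3 = 1 / a ^ 6" "real n ^ 4 = 1 / a ^ 8" "real n ^ 5 = 1 / a ^ 10"
proof -
  have a: "a = real n powr - (1/2)" using n by (simp add: a_def powr_minus_divide powr_half_sqrt)
  have "a ^ k = real n powr - (real k / 2)" for k
    unfolding a using n by (subst powr_power) auto
  hence "1 / a ^ k = real n powr (real k / 2)" for k
    by (simp add: powr_minus_divide)
  from this[of 5] this[of 7] this[of 9]
  show "real n powr (5/2) = 1 / a ^ 5" "real n powr (7/2) = 1 / a ^ 7" "real n powr (9/2) = 1 / a ^ 9"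
    by simp_all
  have "real n = 1 / a\<^sup>2" by (simp add: inv_sqrt_square)
  hence "real n ^ k = 1 / a ^ (2 * k)" for k by (simp add: power_divide power_mult)
  from this[of 3] this[of 4] this[of 5]
  show "real n ^ 3 = 1 / a ^ 6" "real n ^ 4 = 1 / a ^ 8" "real n ^ 5 = 1 / a ^ 10"
    by simp_all
qed

text \<open>The part of the expansion of ln u(n) without \<open>ln n\<close> and \<alpha>. Signs
  stay inside the coefficients so that \<open>quintic_bound\<close> applies literally.\<close>

definition central_main :: real where
  "central_main = (3 / 4 * pi) * a ^ 5 + (- 2 * ln 8) * a ^ 6 + (- 15 / 4 * (1 / pi)) * a ^ 7
     + (- 3 * (1 / pi ^ 2)) * a ^ 8 + (35 / 64 * pi - 35 / 12 * (1 / pi ^ 3)) * a ^ 9"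

text \<open>Left unexpanded in the shape produced by \<open>combine_log_part\<close>, with 2 y^2 and
  -3 y^2 as leading terms of the two differences, y = a^2.\<close>

definition central_log :: real where
  "central_log = a\<^sup>2 * (l * (2 * (a\<^sup>2) ^ 2) + (- 3 * (a\<^sup>2) ^ 2))"

definition forward_main :: real where
  "forward_main = (3 / 4 * pi) * a ^ 5 + (- 2 * ln 8) * a ^ 6 + (- 15 / 8 * pi - 15 / 4 * (1 / pi)) * a ^ 7
     + (6 * ln 8 - 3 * (1 / pi ^ 2)) * a ^ 8 + (245 / 64 * pi + 105 / 8 * (1 / pi) - 35 / 12 * (1 / pi ^ 3)) * a ^ 9"

definition forward_log :: real where
  "forward_log = a\<^sup>2 * (l * (2 * (a\<^sup>2) ^ 2 - 6 * (a\<^sup>2) ^ 3) + (11 * (a\<^sup>2) ^ 3 - 3 * (a\<^sup>2) ^ 2))"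

lemma main_part_bounds: "\<bar>central_main\<bar> \<le> 7 * a ^ 5" "\<bar>forward_main\<bar> \<le> 7 * a ^ 5"
proof -
  have bounds: "\<bar>3 / 4 * p\<bar> \<le> 3" "\<bar>- 2 * e\<bar> \<le> 74" "\<bar>- 15 / 4 * p1\<bar> \<le> 74" "\<bar>- 3 * p2\<bar> \<le> 74"
      "\<bar>35 / 64 * p - 35 / 12 * p3\<bar> \<le> 74" "\<bar>- 15 / 8 * p - 15 / 4 * p1\<bar> \<le> 74"
      "\<bar>6 * e - 3 * p2\<bar> \<le> 74" "\<bar>245 / 64 * p + 105 / 8 * p1 - 35 / 12 * p3\<bar> \<le> 74"
    if "0 < p" "p < 4" "0 < p1" "p1 \<le> 1" "0 < p2" "p2 \<le> 1" "0 < p3" "p3 \<le> 1" "0 \<le> e" "e \<le> 3"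
    for p p1 p2 p3 e :: real
    using that by (simp_all add: abs_le_iff)
  note b = bounds[OF pi_gt_zero pi_less_4 pi_inverse_le ln_8_bounds]
  show "\<bar>central_main\<bar> \<le> 7 * a ^ 5"
    unfolding central_main_def by (rule quintic_bound[OF inv_sqrt_bounds b(1-5)])
  show "\<bar>forward_main\<bar> \<le> 7 * a ^ 5"
    unfolding forward_main_def by (rule quintic_bound[OF inv_sqrt_bounds b(1,2,6-8)])
qed

lemma log_part_bounds: "\<bar>central_log\<bar> \<le> 7 * a ^ 5" "\<bar>forward_log\<bar> \<le> 7 * a ^ 5"
proof -
  have a5: "a ^ 5 \<ge> 0" using inv_sqrt_bounds by simp
  have "central_log = (2 * (l * a) - 3 * a) * a ^ 5"
    by (simp add: central_log_def power_mult[symmetric] algebra_simps eval_nat_numeral)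
  moreover have "\<bar>2 * (l * a) - 3 * a\<bar> \<le> 7"
    using ln_bounds_5505 inv_sqrt_bounds mult_nonneg_nonneg[of l a] by (simp add: abs_le_iff)
  ultimately show "\<bar>central_log\<bar> \<le> 7 * a ^ 5" using a5 by (simp add: abs_mult mult_right_mono)
  have "forward_log = (2 * (l * a) - 3 * a - 6 * ((l * a) * a\<^sup>2) + 11 * (a\<^sup>2 * a)) * a ^ 5"
    by (simp add: forward_log_def power_mult[symmetric] algebra_simps eval_nat_numeral)
  moreover have "\<bar>2 * (l * a) - 3 * a - 6 * ((l * a) * a\<^sup>2) + 11 * (a\<^sup>2 * a)\<bar> \<le> 7"
  proof -
    have "0 \<le> l * a" using ln_bounds_5505 inv_sqrt_bounds by simp
    moreover have "(l * a) * a\<^sup>2 \<le> 2 * (1 / 2000)"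
      by (intro mult_mono ln_bounds_5505 inv_sqrt_square_le) auto
    moreover have "a\<^sup>2 * a \<le> 1 / 2000 * (1 / 74)"
      using inv_sqrt_bounds by (intro mult_mono inv_sqrt_square_le) auto
    moreover have "0 \<le> (l * a) * a\<^sup>2" "0 \<le> a\<^sup>2 * a"
      using ln_bounds_5505 inv_sqrt_bounds by simp_all
    ultimately have "0 \<le> l * a" "6 * ((l * a) * a\<^sup>2) \<le> 1" "11 * (a\<^sup>2 * a) \<le> 1" "0 \<le> (l * a) * a\<^sup>2" "0 \<le> a\<^sup>2 * a"
      by linarith+
    moreover have "3 * a \<le> 1" using inv_sqrt_bounds by linarith
    ultimately show ?thesis using ln_bounds_5505 inv_sqrt_bounds unfolding abs_le_iff by (intro conjI; linarith)
  qed
  ultimately show "\<bar>forward_log\<bar> \<le> 7 * a ^ 5" using a5 by (simp add: abs_mult mult_right_mono)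
qed

lemma alpha_inv_sqrt_le: "2 * \<alpha> \<le> (real n)\<^sup>2 \<Longrightarrow> \<alpha> * a ^ 4 \<le> 1 / 2"
proof -
  assume *: "2 * \<alpha> \<le> (real n)\<^sup>2"
  have "a ^ 4 = (a\<^sup>2)\<^sup>2" by (simp flip: power_mult)
  also have "\<dots> = 1 / (real n)\<^sup>2" by (simp add: inv_sqrt_square power_divide)
  finally have "\<alpha> * a ^ 4 = \<alpha> / (real n)\<^sup>2" by simp
  also have "\<dots> \<le> 1 / 2" using * n by (simp add: divide_le_eq)
  finally show ?thesis .
qed

lemma u_central:
  assumes \<alpha>: "\<alpha> \<ge> 0" "2 * \<alpha> \<le> (real n)\<^sup>2"
  shows "1 + (central_main - (1 + \<alpha>) * central_log) - 2 powr (16 + 7 * \<alpha>) * l * a ^ 10 < u \<alpha> n"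
    and "u \<alpha> n < 1 + (central_main - (1 + \<alpha>) * central_log) + 2 powr (31 + 18 * \<alpha>) * a ^ 10"
proof -
  define D where "D = lnr \<alpha> (n - 1) + lnr \<alpha> (n + 1) - 2 * lnr \<alpha> n"
  have u: "u \<alpha> n = exp D" unfolding D_def using n by (intro u_eq_exp) simp
  have y: "0 \<le> a\<^sup>2" "a\<^sup>2 \<le> 1 / 2000" using inv_sqrt_square_le by auto
  have z: "\<bar>- a\<^sup>2\<bar> \<le> 1 / 1000" "\<bar>0::real\<bar> \<le> 1 / 1000" "\<bar>a\<^sup>2\<bar> \<le> 1 / 1000" using y by auto
  have m: "n - 1 \<ge> 5476" "n \<ge> 5476" "n + 1 \<ge> 5476" and n0: "real n > 0" using n by auto
  have mz: "real (n - 1) = real n * (1 + - a\<^sup>2)" "real n = real n * (1 + 0)" "real (n + 1) = real n * (1 + a\<^sup>2)"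
    using n by (auto simp: inv_sqrt_square of_nat_diff field_simps)
  note sd = lnr_second_difference[OF n0 m mz z, of \<alpha>, folded a_def l_def, folded D_def]
  note sm = smooth_difference_bound[OF less_imp_le[OF inv_sqrt_bounds(1)] order_trans[OF inv_sqrt_bounds(2)] powr_diff_central[OF y]]
  have S1: "powr_diff 1 (- a\<^sup>2) 0 (a\<^sup>2) \<le> 2 * (a\<^sup>2) ^ 2 + 14 * (a\<^sup>2) ^ 4"
    using powr_diff_1_central(2)[OF y] zero_le_power[OF y(1), of 4] by linarith
  have V: "\<bar>ln_diff (- a\<^sup>2) 0 (a\<^sup>2) - (- 3 * (a\<^sup>2) ^ 2)\<bar> \<le> 54 * (a\<^sup>2) ^ 4"
    using ln_diff_central[OF y] zero_le_power[OF y(1), of 4] by simp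
  have main: "pi * a * (3 / 4 * (a\<^sup>2) ^ 2 + 35 / 64 * (a\<^sup>2) ^ 4) - ln 8 * a\<^sup>2 * (2 * (a\<^sup>2) ^ 2)
      - 1 / pi * a ^ 3 * (15 / 4 * (a\<^sup>2) ^ 2) - 1 / (2 * pi\<^sup>2) * a ^ 4 * (6 * (a\<^sup>2) ^ 2)
      - 1 / (3 * pi ^ 3) * a ^ 5 * (35 / 4 * (a\<^sup>2) ^ 2) = central_main"
    unfolding central_main_def by (simp add: power_mult[symmetric] algebra_simps eval_nat_numeral)
  have "l \<ge> 0" using ln_bounds_5505 by simp
  note c = combine_log_part[OF sd sm[unfolded main] powr_diff_1_central(1)[OF y] S1 V \<alpha>(1) this,
      folded central_log_def]
  note e = exp_enclosure[OF inv_sqrt_bounds ln_bounds_5505 \<alpha>(1) alpha_inv_sqrt_le[OF \<alpha>(2)] main_part_bounds(1) log_part_bounds(1) c]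
  show "1 + (central_main - (1 + \<alpha>) * central_log) - 2 powr (16 + 7 * \<alpha>) * l * a ^ 10 < u \<alpha> n"
    "u \<alpha> n < 1 + (central_main - (1 + \<alpha>) * central_log) + 2 powr (31 + 18 * \<alpha>) * a ^ 10"
    unfolding u by (rule e; simp)+
qed

text \<open>u(n+1) is expanded at n itself, with offsets 0, 1/n, 2/n, because \<open>L1\<close> and
  \<open>U1\<close> are functions of n. This produces the odd powers of 1/n that cancel in the
  central case.\<close>

lemma u_forward:
  assumes \<alpha>: "\<alpha> \<ge> 0" "2 * \<alpha> \<le> (real n)\<^sup>2"
  shows "1 + (forward_main - (1 + \<alpha>) * forward_log) - 2 powr (16 + 7 * \<alpha>) * l * a ^ 10 < u \<alpha> (n + 1)"
    and "u \<alpha> (n + 1) < 1 + (forward_main - (1 + \<alpha>) * forward_log) + 2 powr (31 + 18 * \<alpha>) * a ^ 10"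
proof -
  define D where "D = lnr \<alpha> n + lnr \<alpha> (n + 2) - 2 * lnr \<alpha> (n + 1)"
  have u: "u \<alpha> (n + 1) = exp D" unfolding D_def using n u_eq_exp[of "n + 1" \<alpha>] by simp
  have y: "0 \<le> a\<^sup>2" "a\<^sup>2 \<le> 1 / 2000" using inv_sqrt_square_le by auto
  have z: "\<bar>0::real\<bar> \<le> 1 / 1000" "\<bar>a\<^sup>2\<bar> \<le> 1 / 1000" "\<bar>2 * a\<^sup>2\<bar> \<le> 1 / 1000" using y by auto
  have m: "n \<ge> 5476" "n + 1 \<ge> 5476" "n + 2 \<ge> 5476" and n0: "real n > 0" using n by auto
  have mz: "real n = real n * (1 + 0)" "real (n + 1) = real n * (1 + a\<^sup>2)" "real (n + 2) = real n * (1 + 2 * a\<^sup>2)"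
    using n by (auto simp: inv_sqrt_square field_simps)
  note sd = lnr_second_difference[OF n0 m mz z, of \<alpha>, folded a_def l_def, folded D_def]
  note sm = smooth_difference_bound[OF less_imp_le[OF inv_sqrt_bounds(1)] order_trans[OF inv_sqrt_bounds(2)] powr_diff_forward[OF y]]
  have main: "pi * a * (3 / 4 * (a\<^sup>2) ^ 2 - 15 / 8 * (a\<^sup>2) ^ 3 + 245 / 64 * (a\<^sup>2) ^ 4)
      - ln 8 * a\<^sup>2 * (2 * (a\<^sup>2) ^ 2 - 6 * (a\<^sup>2) ^ 3)
      - 1 / pi * a ^ 3 * (15 / 4 * (a\<^sup>2) ^ 2 - 105 / 8 * (a\<^sup>2) ^ 3) - 1 / (2 * pi\<^sup>2) * a ^ 4 * (6 * (a\<^sup>2) ^ 2)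
      - 1 / (3 * pi ^ 3) * a ^ 5 * (35 / 4 * (a\<^sup>2) ^ 2) = forward_main"
    unfolding forward_main_def by (simp add: power_mult[symmetric] algebra_simps eval_nat_numeral)
  have "l \<ge> 0" using ln_bounds_5505 by simp
  note c = combine_log_part[OF sd sm[unfolded main] powr_diff_1_forward[OF y] ln_diff_forward[OF y] \<alpha>(1) this,
      folded forward_log_def]
  note e = exp_enclosure[OF inv_sqrt_bounds ln_bounds_5505 \<alpha>(1) alpha_inv_sqrt_le[OF \<alpha>(2)] main_part_bounds(2) log_part_bounds(2) c]
  show "1 + (forward_main - (1 + \<alpha>) * forward_log) - 2 powr (16 + 7 * \<alpha>) * l * a ^ 10 < u \<alpha> (n + 1)"
    "u \<alpha> (n + 1) < 1 + (forward_main - (1 + \<alpha>) * forward_log) + 2 powr (31 + 18 * \<alpha>) * a ^ 10"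
    unfolding u by (rule e; simp)+
qed

lemma central_main_eq:
  "3 * pi / (4 * real n powr (5 / 2)) + (3 + 3 * \<alpha> - 2 * ln 8 - 2 * (1 + \<alpha>) * ln (real n)) / real n ^ 3
     - 15 / (4 * pi * real n powr (7 / 2)) - 3 / (pi\<^sup>2 * real n ^ 4)
     + 35 * (- 16 + 3 * pi ^ 4) / (192 * pi ^ 3 * real n powr (9 / 2))
   = central_main - (1 + \<alpha>) * central_log"
proof -
  have 9: "35 * (- 16 + 3 * pi ^ 4) / (192 * pi ^ 3) = 35 / 64 * pi - 35 / 12 * (1 / pi ^ 3)"
    by (simp add: field_simps eval_nat_numeral)
  have q: "x / (d * (1 / a ^ k)) = x / d * a ^ k" for x d k by simp
  have log: "central_log = (2 * l - 3) * a ^ 6"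
    by (simp add: central_log_def power_mult[symmetric] algebra_simps eval_nat_numeral)
  show ?thesis
    unfolding real_n_powers l_def[symmetric] q 9 central_main_def log by (simp add: algebra_simps)
qed

lemma forward_main_eq:
  "3 * pi / (4 * real n powr (5 / 2)) + (3 + 3 * \<alpha> - 2 * ln 8 - 2 * (1 + \<alpha>) * ln (real n)) / real n ^ 3
     - 15 * (2 + pi\<^sup>2) / (8 * pi * real n powr (7 / 2))
     + (- 3 - 11 * pi\<^sup>2 - 11 * \<alpha> * pi\<^sup>2 + 6 * pi\<^sup>2 * ln 8 + (6 + 6 * \<alpha>) * pi\<^sup>2 * ln (real n)) / (pi\<^sup>2 * real n ^ 4)
     + 35 * (21 * pi ^ 4 + 72 * pi\<^sup>2 - 16) / (192 * pi ^ 3 * real n powr (9 / 2))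
   = forward_main - (1 + \<alpha>) * forward_log"
proof -
  have 9: "35 * (21 * pi ^ 4 + 72 * pi\<^sup>2 - 16) / (192 * pi ^ 3)
      = 245 / 64 * pi + 105 / 8 * (1 / pi) - 35 / 12 * (1 / pi ^ 3)"
    by (simp add: field_simps eval_nat_numeral)
  have 7: "15 * (2 + pi\<^sup>2) / (8 * pi) = 15 / 8 * pi + 15 / 4 * (1 / pi)"
    by (simp add: field_simps eval_nat_numeral)
  have 8: "(- 3 - 11 * pi\<^sup>2 - 11 * \<alpha> * pi\<^sup>2 + 6 * pi\<^sup>2 * ln 8 + (6 + 6 * \<alpha>) * pi\<^sup>2 * l) / pi\<^sup>2
      = - 3 * (1 / pi\<^sup>2) - 11 - 11 * \<alpha> + 6 * ln 8 + (6 + 6 * \<alpha>) * l"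
    by (simp add: field_simps)
  have q: "x / (d * (1 / a ^ k)) = x / d * a ^ k" for x d k by simp
  have log: "forward_log = (2 * l - 3) * a ^ 6 + (11 - 6 * l) * a ^ 8"
    by (simp add: forward_log_def power_mult[symmetric] algebra_simps eval_nat_numeral)
  show ?thesis
    unfolding real_n_powers l_def[symmetric] q 7 8 9 forward_main_def log by (simp add: algebra_simps)
qed

end

section \<open>The four inequalities\<close>

theorem theorem3p1:
  fixes \<alpha> :: real and n :: nat
  assumes "\<alpha> \<ge> 0" and "int n \<ge> N \<alpha>"
  shows "L n \<alpha> < u \<alpha> n \<and> u \<alpha> n < U n \<alpha> \<and> L1 n \<alpha> < u \<alpha> (n + 1) \<and> u \<alpha> (n + 1) < U1 n \<alpha>"
proof -
  have "5505 \<le> N3 \<alpha>" "\<lceil>sqrt (2 * \<alpha>)\<rceil> \<le> N1 \<alpha>"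
    unfolding N1_def N3_def by (intro Max_ge; simp)+
  moreover have "N1 \<alpha> \<le> N \<alpha>" "N3 \<alpha> \<le> N \<alpha>"
    unfolding N_def by (intro Max_ge; simp)+
  ultimately have n: "n \<ge> 5505" and ceil: "\<lceil>sqrt (2 * \<alpha>)\<rceil> \<le> int n" using assms(2) by linarith+
  have "sqrt (2 * \<alpha>) \<le> real n" using ceil by linarith
  hence "(sqrt (2 * \<alpha>))\<^sup>2 \<le> (real n)\<^sup>2" using assms(1) by (intro power_mono) auto
  \<comment> \<open>This amounts to \<alpha> / n^2 \<le> 1/2, which keeps |D| \<le> 1, the range of
    the quadratic bound for exp.\<close>
  hence \<alpha>: "2 * \<alpha> \<le> (real n)\<^sup>2" using assms(1) by simp
  define A where "A = (1 / sqrt (real n)) ^ 10"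
  have A: "A > 0" using n by (simp add: A_def)
  have n5: "x / real n ^ 5 = x * A" for x using real_n_powers(6)[OF n] n by (simp add: A_def)
  have l: "ln (real n) \<ge> 8" by (rule ln_bounds_5505(1)[OF n])
  note c = u_central[OF n assms(1) \<alpha>, folded A_def central_main_eq[OF n]]
  note f = u_forward[OF n assms(1) \<alpha>, folded A_def forward_main_eq[OF n]]
  have p: "2 powr (7 * \<alpha> + 13) * 8 = 2 powr (16 + 7 * \<alpha>)"
    by (simp add: powr_add)
  \<comment> \<open>The other parts of the coefficient of n^(-5) in \<open>L\<close> are
    nonnegative, so only the exponential one has to match the error.\<close>
  have "2 powr (16 + 7 * \<alpha>) * ln (real n) * A \<le> (258 + (80 + 2 powr (16 + 7 * \<alpha>)) * ln (real n)) * A"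
    using A l by (intro mult_right_mono) (auto simp: algebra_simps)
  hence 1: "L n \<alpha> < u \<alpha> n" using c(1) unfolding L_def n5 by linarith
  have "2 powr (31 + 18 * \<alpha>) * A \<le> (6 * \<alpha> + 2 ^ 12 + 2 powr (31 + 18 * \<alpha>) + (2 + 17 * \<alpha>) * ln (real n)) * A"
    using A l assms(1) by (intro mult_right_mono) auto
  hence 2: "u \<alpha> n < U n \<alpha>" using c(2) unfolding U_def n5 by linarith
  have "2 powr (16 + 7 * \<alpha>) * ln (real n) * A \<le>
      A * (256 + 105 * (9 * pi\<^sup>2 * (4 + pi\<^sup>2) - 16) / (128 * pi ^ 3)
            + 8 * (3 * \<alpha> + 2 powr (7 * \<alpha> + 13) + 13) * ln (real n))"
  proof -
    have "1 \<le> pi\<^sup>2" using pi_gt3 by (intro one_le_power) auto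
    hence "9 * 1 * (4 + 0) \<le> 9 * pi\<^sup>2 * (4 + pi\<^sup>2)" by (intro mult_mono) auto
    hence "0 \<le> 105 * (9 * pi\<^sup>2 * (4 + pi\<^sup>2) - 16) / (128 * pi ^ 3)" by simp
    moreover have "8 * (3 * \<alpha> + 2 powr (7 * \<alpha> + 13) + 13) * ln (real n) =
        2 powr (16 + 7 * \<alpha>) * ln (real n) + 8 * (3 * \<alpha> + 13) * ln (real n)"
      unfolding p[symmetric] by (simp add: algebra_simps)
    moreover have "0 \<le> 8 * (3 * \<alpha> + 13) * ln (real n)" using assms(1) l by simp
    ultimately have "2 powr (16 + 7 * \<alpha>) * ln (real n) \<le> 256 + 105 * (9 * pi\<^sup>2 * (4 + pi\<^sup>2) - 16) / (128 * pi ^ 3)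
            + 8 * (3 * \<alpha> + 2 powr (7 * \<alpha> + 13) + 13) * ln (real n)" by linarith
    thus ?thesis using A by (simp only: mult.commute[of A]) (simp add: mult_right_mono)
  qed
  moreover have "1 / real n ^ 5 = A" using n5[of 1] by simp
  ultimately have 3: "L1 n \<alpha> < u \<alpha> (n + 1)" using f(1) unfolding L1_def by simp
  have "2 powr (31 + 18 * \<alpha>) * A \<le> (12 + (2 ^ 12 + 26) * pi\<^sup>2 - 12 * pi\<^sup>2 * ln 8 + 32 * \<alpha> * pi\<^sup>2
          + pi\<^sup>2 * 2 powr (31 + 18 * \<alpha>) + (2 + 17 * \<alpha>) * pi\<^sup>2 * ln (real n)) * A"
  proof (intro mult_right_mono)
    have "1 \<le> pi\<^sup>2" using pi_gt3 by (intro one_le_power) auto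
    hence "1 * 2 powr (31 + 18 * \<alpha>) \<le> pi\<^sup>2 * 2 powr (31 + 18 * \<alpha>)" by (intro mult_right_mono) auto
    \<comment> \<open>The only negative summand in the last coefficient of \<open>U1\<close> is at
      most 36 pi^2 in size, against 4122 pi^2.\<close>
    moreover have "12 * pi\<^sup>2 * ln 8 \<le> 12 * pi\<^sup>2 * 3" using ln_8_bounds by (intro mult_left_mono) auto
    moreover have "0 \<le> pi\<^sup>2" "(2 ^ 12 + 26) * pi\<^sup>2 = 4122 * pi\<^sup>2" by simp_all
    moreover have "0 \<le> 32 * \<alpha> * pi\<^sup>2" "0 \<le> (2 + 17 * \<alpha>) * pi\<^sup>2 * ln (real n)" using assms(1) l by auto
    ultimately show "2 powr (31 + 18 * \<alpha>) \<le> 12 + (2 ^ 12 + 26) * pi\<^sup>2 - 12 * pi\<^sup>2 * ln 8 + 32 * \<alpha> * pi\<^sup>2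
          + pi\<^sup>2 * 2 powr (31 + 18 * \<alpha>) + (2 + 17 * \<alpha>) * pi\<^sup>2 * ln (real n)" by linarith
  qed (use A in simp)
  hence 4: "u \<alpha> (n + 1) < U1 n \<alpha>" using f(2) unfolding U1_def n5 by linarith
  from 1 2 3 4 show ?thesis by blast
qed

end
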